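(* Let $K_{[\mathrm{Id}]}$ denote the cut locus from $[\mathrm{Id}]$ of the sub-Riemannian manifold $L(4,1)=SU(2)/\!\approx$ (with the sub-Riemannian structure induced from the $\mathbf{k}\oplus\mathbf{p}$ structure on $SU(2)$, as described in the context). Then $K_{[\mathrm{Id}]}=K^{loc}\cup K^{sym}$, where $$K^{loc}=\{[e^{tk}]\ :\ t\in\mathbb{R}\}\setminus\{[\mathrm{Id}]\},$$ $$K^{sym}=\Big\{[g]\in L(4,1)\ :\ \text{for a fixed } g^*\in[g]\ \exists\, x_1,x_2\in[\mathrm{Id}],\ x_1\neq x_2,\ \text{such that } \forall x^*\in[\mathrm{Id}]:\ d(g^*,x_1)=d(g^*,x_2)\le d(g^*,x^* )\Big\},$$ and $d$ is the sub-Riemannian (Carnot–Carathéodory) distance on $SU(2)$. (Here $[h]$ denotes the $\approx$-class of $h\in SU(2)$.)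
   Context: $SU(2)=\left\{\begin{pmatrix}\alpha&\beta\\-\bar\beta&\bar\alpha\end{pmatrix}:\alpha,\beta\in\mathbb{C},\ |\alpha|^2+|\beta|^2=1\right\}$. Let $p_1=\frac12\begin{pmatrix}0&1\\-1&0\end{pmatrix}$, $p_2=\frac12\begin{pmatrix}0&i\\i&0\end{pmatrix}$, $k=\frac12\begin{pmatrix}i&0\\0&-i\end{pmatrix}$, $\mathbf{p}=\mathrm{span}\{p_1,p_2\}$, and let $\langle\cdot,\cdot\rangle$ be the inner product on $\mathbf{p}$ for which $p_1,p_2$ are orthonormal. The $\mathbf{k}\oplus\mathbf{p}$ sub-Riemannian structure on $SU(2)$ is the distribution $\Delta(g)=g\mathbf{p}$ with metric $\mathbf{g}_g(v,w)=\langle g^{-1}v,g^{-1}w\rangle$; horizontal curves are Lipschitz curves with velocity a.e. in $\Delta$, their length is $\int\sqrt{\mathbf{g}(\dot\gamma,\dot\gamma)}\,dt$, and $d(g,h)$ is the infimum of lengths of horizontal curves joining $g$ to $h$. Every $g\in SU(2)$ can be written $g=e^{-bp_2}e^{ap_1}e^{cp_2}$ with $a\in[0,\pi]$, $b\in[0,2\pi)$, $c\in\mathbb{R}/4\pi$. Define $g_1\approx g_2$ iff there exist such representations $g_1=e^{-b_1p_2}e^{a_1p_1}e^{c_1p_2}$, $g_2=e^{-b_2p_2}e^{a_2p_1}e^{c_2p_2}$ with $a_1=a_2$, $b_1=b_2$, $c_1\equiv c_2 \bmod \pi$. The quotient $L(4,1)=SU(2)/\!\approx$, with quotient map $\Pi$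 (a local diffeomorphism), carries the sub-Riemannian structure with distribution $\Pi_*(\Delta(h))$ at $[h]$ and metric induced by $\mathbf{g}$ via $\Pi_*$ (well defined independently of the representative $h$); lengths and distance $\hat d$ on $L(4,1)$ are defined as on $SU(2)$. The cut locus $K_{[\mathrm{Id}]}$ is the set of points $q\in L(4,1)$ for which there exist two distinct geodesics parametrized by arclength starting from $[\mathrm{Id}]$ which both reach $q$ at the same time $t>0$ and are both length-minimizing on $[0,t]$. *)

theory Defs
  imports "HOL-Analysis.Analysis"
begin

type_synonym cmat = "complex^2^2"

definition mat2 :: "complex \<Rightarrow> complex \<Rightarrow> complex \<Rightarrow> complex \<Rightarrow> cmat" where
  "mat2 a b c d = (\<chi> i j. if i = 1 then (if j = 1 then a else b) else (if j = 1 then c else d))"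

definition SU2 :: "cmat set" where
  "SU2 = {mat2 \<alpha> \<beta> (- cnj \<beta>) (cnj \<alpha>) | \<alpha> \<beta>. (cmod \<alpha>)^2 + (cmod \<beta>)^2 = 1}"

definition Id2 :: cmat where "Id2 = mat 1"

definition p1 :: cmat where "p1 = mat2 0 (1/2) (-1/2) 0"
definition p2 :: cmat where "p2 = mat2 0 (\<i>/2) (\<i>/2) 0"
definition kk :: cmat where "kk = mat2 (\<i>/2) 0 0 (-\<i>/2)"

primrec mpow :: "cmat \<Rightarrow> nat \<Rightarrow> cmat" where
  "mpow X 0 = mat 1"
| "mpow X (Suc n) = X ** mpow X n"

definition mexp :: "cmat \<Rightarrow> cmat" where
  "mexp X = (\<Sum>n. (1 / fact n) *\<^sub>R mpow X n)"

text \<open>The subspace p = span{p1,p2} and its inner product (p1, p2 orthonormal).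
  Coordinates of X = x1 p1 + x2 p2 are x1 = 2 Re(X12), x2 = 2 Im(X12).\<close>
definition in_p :: "cmat \<Rightarrow> bool" where
  "in_p X \<longleftrightarrow> (\<exists>x1 x2::real. X = x1 *\<^sub>R p1 + x2 *\<^sub>R p2)"

definition pc1 :: "cmat \<Rightarrow> real" where "pc1 X = 2 * Re (X $ 1 $ 2)"
definition pc2 :: "cmat \<Rightarrow> real" where "pc2 X = 2 * Im (X $ 1 $ 2)"

definition ip_p :: "cmat \<Rightarrow> cmat \<Rightarrow> real" where
  "ip_p X Y = pc1 X * pc1 Y + pc2 X * pc2 Y"

definition sr_metric :: "cmat \<Rightarrow> cmat \<Rightarrow> cmat \<Rightarrow> real" where
  "sr_metric g v w = ip_p (matrix_inv g ** v) (matrix_inv g ** w)"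

definition horizontal :: "(real \<Rightarrow> cmat) \<Rightarrow> real \<Rightarrow> real \<Rightarrow> bool" where
  "horizontal \<gamma> a b \<longleftrightarrow> a \<le> b \<and> (\<forall>t\<in>{a..b}. \<gamma> t \<in> SU2) \<and>
     (\<exists>C. C-lipschitz_on {a..b} \<gamma>) \<and>
     (AE t in lebesgue. t \<in> {a..b} \<longrightarrow>
        \<gamma> differentiable (at t within {a..b}) \<and>
        in_p (matrix_inv (\<gamma> t) ** vector_derivative \<gamma> (at t within {a..b})))"

definition hlength :: "(real \<Rightarrow> cmat) \<Rightarrow> real \<Rightarrow> real \<Rightarrow> real" where
  "hlength \<gamma> a b = integral {a..b} (\<lambda>t. sqrt (sr_metric (\<gamma> t)
      (vector_derivative \<gamma> (at t within {a..b})) (vector_derivative \<gamma> (at t within {a..b}))))"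

definition sr_dist :: "cmat \<Rightarrow> cmat \<Rightarrow> real" where
  "sr_dist g h = Inf {hlength \<gamma> a b | \<gamma> a b. horizontal \<gamma> a b \<and> \<gamma> a = g \<and> \<gamma> b = h}"

definition Erep :: "real \<Rightarrow> real \<Rightarrow> real \<Rightarrow> cmat" where
  "Erep b a c = mexp ((- b) *\<^sub>R p2) ** mexp (a *\<^sub>R p1) ** mexp (c *\<^sub>R p2)"

definition approx_rel :: "cmat \<Rightarrow> cmat \<Rightarrow> bool" where
  "approx_rel g1 g2 \<longleftrightarrow> g1 \<in> SU2 \<and> g2 \<in> SU2 \<and>
     (\<exists>a b c1 c2. a \<in> {0..pi} \<and> b \<in> {0..<2*pi} \<and>
        g1 = Erep b a c1 \<and> g2 = Erep b a c2 \<and> (\<exists>n::int. c1 - c2 = of_int n * pi))"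

definition cls :: "cmat \<Rightarrow> cmat set" where
  "cls g = {h. approx_rel g h}"

definition L41 :: "cmat set set" where
  "L41 = cls ` SU2"

text \<open>Horizontal curves in L(4,1): curves that are the projection of a horizontal
  curve in SU(2) (Pi is a covering / local isometry).  Their length is the length
  of a horizontal lift.\<close>
definition horizontal_L :: "(real \<Rightarrow> cmat set) \<Rightarrow> real \<Rightarrow> real \<Rightarrow> bool" where
  "horizontal_L \<Gamma> a b \<longleftrightarrow> (\<exists>\<gamma>. horizontal \<gamma> a b \<and> (\<forall>t\<in>{a..b}. \<Gamma> t = cls (\<gamma> t)))"

definition hlength_L :: "(real \<Rightarrow> cmat set) \<Rightarrow> real \<Rightarrow> real \<Rightarrow> real" where
  "hlength_L \<Gamma> a b = hlength (SOME \<gamma>. horizontal \<gamma> a b \<and> (\<forall>t\<in>{a..b}. \<Gamma> t = cls (\<gamma> t))) a b"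

definition dist_L :: "cmat set \<Rightarrow> cmat set \<Rightarrow> real" where
  "dist_L P Q = Inf {hlength_L \<Gamma> a b | \<Gamma> a b. horizontal_L \<Gamma> a b \<and> \<Gamma> a = P \<and> \<Gamma> b = Q}"

definition arclength_L :: "(real \<Rightarrow> cmat set) \<Rightarrow> real \<Rightarrow> bool" where
  "arclength_L \<Gamma> T \<longleftrightarrow> (\<forall>a b. 0 \<le> a \<and> a \<le> b \<and> b \<le> T \<longrightarrow> hlength_L \<Gamma> a b = b - a)"

definition minimizing_L :: "(real \<Rightarrow> cmat set) \<Rightarrow> real \<Rightarrow> real \<Rightarrow> bool" where
  "minimizing_L \<Gamma> a b \<longleftrightarrow> hlength_L \<Gamma> a b = dist_L (\<Gamma> a) (\<Gamma> b)"

definition geodesic_L :: "(real \<Rightarrow> cmat set) \<Rightarrow> real \<Rightarrow> bool" where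
  "geodesic_L \<Gamma> T \<longleftrightarrow> horizontal_L \<Gamma> 0 T \<and> arclength_L \<Gamma> T \<and>
     (\<forall>s\<in>{0..T}. \<exists>\<epsilon>>0. \<forall>a b. a \<in> {0..T} \<and> b \<in> {0..T} \<and> a \<le> b \<and>
        \<bar>a - s\<bar> < \<epsilon> \<and> \<bar>b - s\<bar> < \<epsilon> \<longrightarrow> minimizing_L \<Gamma> a b)"

definition cut_locus_L :: "cmat set set" where
  "cut_locus_L = {q \<in> L41. \<exists>t>0. \<exists>\<Gamma>1 \<Gamma>2.
      geodesic_L \<Gamma>1 t \<and> geodesic_L \<Gamma>2 t \<and>
      \<Gamma>1 0 = cls Id2 \<and> \<Gamma>2 0 = cls Id2 \<and> \<Gamma>1 t = q \<and> \<Gamma>2 t = q \<and>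
      minimizing_L \<Gamma>1 0 t \<and> minimizing_L \<Gamma>2 0 t \<and>
      (\<exists>s\<in>{0..t}. \<Gamma>1 s \<noteq> \<Gamma>2 s)}"

definition K_loc :: "cmat set set" where
  "K_loc = {cls (mexp (t *\<^sub>R kk)) | t. True} - {cls Id2}"

definition K_sym :: "cmat set set" where
  "K_sym = {P \<in> L41. \<exists>gs\<in>P. \<exists>x1\<in>cls Id2. \<exists>x2\<in>cls Id2. x1 \<noteq> x2 \<and>
      (\<forall>x\<in>cls Id2. sr_dist gs x1 = sr_dist gs x2 \<and> sr_dist gs x2 \<le> sr_dist gs x)}"

end

theory Submission
  imports Defs
begin

text \<open>
  Write \<open>k\<close> for \<open>kk\<close>. If a horizontal curve of length \<open>l\<close> is multiplied on the right by
  \<open>exp (r s k)\<close>, with \<open>s\<close> its arc length, it becomes a curve of length \<open>sqrt (1 + r^2) l / 2\<close> in the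
  round three-sphere. Comparing with the spherical distance of the end points gives, for every \<open>r\<close>,
  a lower bound for \<open>l\<close> in terms of the end points. For
  \<open>geo c u t = exp (t (X + c k)) exp (- t c k)\<close>, with \<open>X\<close> a unit vector of \<open>p\<close>, the choice
  \<open>r = c\<close> turns the curve into a great circle, so \<open>geo c u\<close> is minimizing up to the time
  \<open>2 pi / sqrt (1 + c^2)\<close> at which the great circle reaches the antipode. By the intermediate value
  theorem every point is reached by such an arc. Before the antipode the great circle arc is unique,
  hence so is the minimizer; at the antipode the end point is diagonal, and rotating \<open>X\<close> gives a
  circle of minimizers.

  The class of \<open>g\<close> is the coset \<open>g Z4\<close>, where \<open>Z4\<close> is the cyclic group generated by
  \<open>exp (pi p2)\<close>, and right multiplication by \<open>Z4\<close> is an isometry. So two distinct minimizers in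
  the quotient lift to minimizers from the identity that end either at different points of
  a fibre, which is the condition defining \<open>K_sym\<close>, or at the same point, which then is diagonal.
  Conversely, for a diagonal \<open>g\<close> a fibre point closest to the identity is either diagonal or
  antidiagonal; in the second case its negative is equally close.
\<close>

section \<open>Lipschitz functions and right derivatives\<close>

text \<open>The lower bound has to cover every horizontal curve. Such a curve is only Lipschitz, so
  no differential equation is at hand and the estimate is made by integrating a derivative that
  exists almost everywhere. The arc length is an indefinite integral whose derivative is obtained
  from the right only; hence a fundamental theorem of calculus for right derivatives.

  The twist works because \<open>k\<close> is orthogonal to \<open>p\<close> in the bi-invariant
  metric of the sphere: at speed v the twisted curve moves with v/2 along \<open>p\<close> and r v/2
  along \<open>k\<close>, whatever the direction of the control. The halves come from
  \<open>p1\<close>, \<open>p2\<close> and \<open>kk\<close> being halves of unit quaternions.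

  Conjugation by \<open>exp (r k)\<close> rotates the second entry of a matrix and fixes the first,
  so distances depend only on the first entry of the difference \<open>matrix_inv g ** h\<close>.
  This leaves one real parameter to be found by the intermediate value theorem, and it makes the
  invariance under \<open>Z4\<close> visible on a single complex number.\<close>

lemma lipschitz_has_integral_right_derivative:
  fixes f :: "real \<Rightarrow> 'a::euclidean_space"
  assumes ab: "a \<le> b" and lip: "C-lipschitz_on {a..b} f" and N: "negligible N"
    and der: "\<And>t. t \<in> {a..<b} - N \<Longrightarrow> (f has_vector_derivative f' t) (at t within {t..b})"
  shows "(f' has_integral (f b - f a)) {a..b}"
proof -
  \<comment> \<open>Clamping the argument extends \<open>f\<close> by constants with the same
    Lipschitz bound, so that difference quotients with a step beyond \<open>b\<close> make
    sense.\<close>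
  define F where "F t = f (min b (max a t))" for t
  have C0: "C \<ge> 0" using lip by (rule lipschitz_on_nonneg)
  have FL: "norm (F x - F y) \<le> C * \<bar>x - y\<bar>" for x y
  proof -
    have "norm (F x - F y) \<le> C * dist (min b (max a x)) (min b (max a y))"
      using lipschitz_onD[OF lip, of "min b (max a x)" "min b (max a y)"] ab
      by (auto simp: F_def dist_norm)
    also have "\<dots> \<le> C * \<bar>x - y\<bar>"
      using C0 by (intro mult_left_mono) (auto simp: dist_real_def)
    finally show ?thesis .
  qed
  have "C-lipschitz_on UNIV F"
    using FL C0 by (auto simp: lipschitz_on_def dist_norm)
  then have Fc: "continuous_on UNIV F"
    by (rule lipschitz_on_continuous_on)
  have Fi: "F integrable_on {x..y}" for x y
    by (rule integrable_continuous_real) (rule continuous_on_subset[OF Fc], simp)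
  define h where "h k = 1 / real (Suc k)" for k
  have h0: "h k > 0" for k by (simp add: h_def)
  define q where "q k t = (F (t + h k) - F t) /\<^sub>R h k" for k t
  have shift: "((\<lambda>t. F (t + h k)) has_integral (integral {a + h k..b + h k} F)) {a..b}" for k
  proof -
    have "(F has_integral (integral {a + h k..b + h k} F)) {a + h k..b + h k}"
      using Fi by blast
    then show ?thesis
      using has_integral_cmul
      by (auto dest!: has_integral_affinity[where m=1 and c="h k" and a="a + h k" and b="b + h k", simplified]
          simp: image_diff_atLeastAtMost)
  qed
  \<comment> \<open>The integrals of the forward quotients telescope to averages over intervals of
    length \<open>h k\<close> at the two ends. The one at \<open>b\<close> is exactly
    \<open>f b\<close> because \<open>F\<close> is constant there, so only the average at
    \<open>a\<close> needs a limit.\<close>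
  define I where "I k = integral {a..a + h k} F /\<^sub>R h k" for k
  have I_lim: "I \<longlonglongrightarrow> f a"
  proof (rule Lim_null[THEN iffD2], rule Lim_null_comparison)
    show "eventually (\<lambda>k. norm (I k - f a) \<le> C * h k) sequentially"
    proof (rule always_eventually, rule allI)
      fix k
      have "integral {a..a + h k} (\<lambda>t. F t - f a) = integral {a..a + h k} F - h k *\<^sub>R f a"
        using h0[of k] by (subst integral_diff) (auto intro: Fi)
      then have e: "I k - f a = integral {a..a + h k} (\<lambda>t. F t - f a) /\<^sub>R h k"
        using h0[of k] by (simp add: I_def scaleR_diff_right)
      have "norm (integral {a..a + h k} (\<lambda>t. F t - f a)) \<le> (C * h k) * (a + h k - a)"
      proof (rule integral_bound)
        show "a \<le> a + h k" using h0[of k] by simp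
        show "continuous_on {a..a + h k} (\<lambda>t. F t - f a)"
          by (intro continuous_intros continuous_on_subset[OF Fc]) simp
        fix t assume t: "t \<in> {a..a + h k}"
        have "f a = F a" using ab by (simp add: F_def)
        then have "norm (F t - f a) \<le> C * \<bar>t - a\<bar>" using FL by simp
        also have "\<dots> \<le> C * h k" using t C0 by (intro mult_left_mono) auto
        finally show "norm (F t - f a) \<le> C * h k" .
      qed
      then show "norm (I k - f a) \<le> C * h k"
        using h0[of k] by (simp add: e field_simps)
    qed
    have "(\<lambda>k. C * h k) \<longlonglongrightarrow> C * 0"
      unfolding h_def by (intro tendsto_intros LIMSEQ_Suc[OF lim_1_over_n])
    then show "(\<lambda>k. C * h k) \<longlonglongrightarrow> 0" by simp
  qed
  have qi: "(q k has_integral (f b - I k)) {a..b}" for k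
  proof -
    have 1: "integral {a + h k..b + h k} F + integral {a..a + h k} F = integral {a..b + h k} F"
      using h0[of k] ab Henstock_Kurzweil_Integration.integral_combine[of a "a + h k" "b + h k" F] Fi
      by (simp add: add.commute)
    have 2: "integral {a..b} F + integral {b..b + h k} F = integral {a..b + h k} F"
      using h0[of k] ab Henstock_Kurzweil_Integration.integral_combine[of a b "b + h k" F] Fi by simp
    have "integral {b..b + h k} F = integral {b..b + h k} (\<lambda>_. f b)"
      using ab by (intro integral_cong) (auto simp: F_def)
    then have 3: "integral {b..b + h k} F = h k *\<^sub>R f b" using h0[of k] by simp
    have "(q k has_integral ((integral {a + h k..b + h k} F - integral {a..b} F) /\<^sub>R h k)) {a..b}"
      unfolding q_def using Fi
      by (intro has_integral_cmul has_integral_diff shift) (auto simp: has_integral_integral[symmetric])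
    moreover have "integral {a + h k..b + h k} F - integral {a..b} F
        = h k *\<^sub>R f b - integral {a..a + h k} F"
      using 1 2 3 by (simp add: algebra_simps)
    ultimately show ?thesis
      using h0[of k] by (simp add: I_def scaleR_diff_right)
  qed
  \<comment> \<open>At \<open>b\<close> there is nothing to the right inside the interval, so
    \<open>b\<close> joins the null set.\<close>
  let ?N = "insert b N"
  have Nb: "negligible ?N" using N by simp
  have "(f' has_integral (f b - f a)) ({a..b} - ?N)"
  proof (rule has_integral_dominated_convergence)
    show "(q k has_integral (f b - I k)) ({a..b} - ?N)" for k
      by (rule has_integral_spike_set_eq[THEN iffD2, OF _ _ qi]) (auto intro!: negligible_subset[OF Nb])
    have "(\<lambda>x. C) integrable_on {a..b}" by blast
    then show "(\<lambda>x. C) integrable_on ({a..b} - ?N)"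
      by (rule integrable_spike_set) (auto intro!: negligible_subset[OF Nb])
    show "\<forall>x\<in>{a..b} - ?N. norm (q k x) \<le> C" for k
    proof
      fix x
      have "norm (F (x + h k) - F x) \<le> C * h k"
        using FL[of "x + h k" x] h0[of k] by simp
      moreover have "norm (q k x) = norm (F (x + h k) - F x) / h k"
        using h0[of k] by (simp add: q_def divide_inverse_commute)
      ultimately show "norm (q k x) \<le> C"
        using h0[of k] by (simp add: pos_divide_le_eq)
    qed
    show "(\<lambda>k. f b - I k) \<longlonglongrightarrow> f b - f a"
      by (intro tendsto_intros I_lim)
    show "\<forall>x\<in>{a..b} - ?N. (\<lambda>k. q k x) \<longlonglongrightarrow> f' x"
    proof
      fix x assume x: "x \<in> {a..b} - ?N"
      then have xb: "a \<le> x" "x < b" by auto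
      have "((\<lambda>y. (f y - f x) /\<^sub>R (y - x)) \<longlongrightarrow> f' x) (at x within {x..b})"
      proof (rule Lim_null[THEN iffD2], rule Lim_transform_eventually)
        show "((\<lambda>y. (1 / norm (y - x)) *\<^sub>R (f y - (f x + (y - x) *\<^sub>R f' x))) \<longlongrightarrow> 0) (at x within {x..b})"
          using der[of x] x xb by (simp add: has_vector_derivative_def has_derivative_within)
        show "\<forall>\<^sub>F y in at x within {x..b}. (1 / norm (y - x)) *\<^sub>R (f y - (f x + (y - x) *\<^sub>R f' x))
            = (f y - f x) /\<^sub>R (y - x) - f' x"
          unfolding eventually_at
          by (intro exI[of _ 1]) (auto simp: scaleR_diff_right scaleR_add_right divide_inverse)
      qed
      moreover have "filterlim (\<lambda>k. x + h k) (at x within {x..b}) sequentially"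
      proof (rule filterlim_at[THEN iffD2], intro conjI)
        have "(\<lambda>k. x + h k) \<longlonglongrightarrow> x + 0"
          unfolding h_def by (intro tendsto_intros LIMSEQ_Suc[OF lim_1_over_n])
        then show lim: "(\<lambda>k. x + h k) \<longlonglongrightarrow> x" by simp
        have "eventually (\<lambda>k. x + h k < b) sequentially"
          using lim xb by (auto dest: order_tendstoD)
        then show "eventually (\<lambda>k. x + h k \<in> {x..b} \<and> x + h k \<noteq> x) sequentially"
          by eventually_elim (use h0 in \<open>auto simp: less_imp_le less_imp_neq[THEN not_sym]\<close>)
      qed
      ultimately have l: "(\<lambda>k. (f (x + h k) - f x) /\<^sub>R (x + h k - x)) \<longlonglongrightarrow> f' x"
        by (rule filterlim_compose)
      have "(\<lambda>k. x + h k) \<longlonglongrightarrow> x + 0"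
        unfolding h_def by (intro tendsto_intros LIMSEQ_Suc[OF lim_1_over_n])
      then have "eventually (\<lambda>k. x + h k < b) sequentially"
        using xb by (auto dest: order_tendstoD)
      then have "eventually (\<lambda>k. (f (x + h k) - f x) /\<^sub>R (x + h k - x) = q k x) sequentially"
        by eventually_elim (use h0 xb in \<open>auto simp: q_def F_def less_imp_le max_def add_increasing2\<close>)
      then show "(\<lambda>k. q k x) \<longlonglongrightarrow> f' x"
        using l by (rule Lim_transform_eventually[rotated])
    qed
  qed
  then show ?thesis
    by (rule has_integral_spike_set_eq[THEN iffD1, rotated 2]) (auto intro!: negligible_subset[OF Nb])
qed

text \<open>Lebesgue differentiation enters with averages over cubes having \<open>x\<close> as
  lower corner, in dimension one over intervals [x, x + h]; the derivative it yields is therefore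
  one-sided.\<close>

lemma indefinite_integral_right_derivative:
  fixes f :: "real \<Rightarrow> real"
  assumes "f integrable_on {a..b}"
  obtains N where "negligible N"
    "\<And>t. t \<in> {a..<b} - N \<Longrightarrow>
      ((\<lambda>x. integral {a..x} f) has_vector_derivative f t) (at t within {t..b})"
proof -
  define g where "g t = (if t \<in> {a..b} then f t else 0)" for t
  have "g integrable_on UNIV"
    using assms integrable_restrict_UNIV[of "{a..b}" f] unfolding g_def by blast
  then have gi: "g integrable_on cbox x y" for x y
    by (rule integrable_on_subcbox) simp
  obtain N where N: "negligible N" and lim:
    "\<And>x e. \<lbrakk>x \<notin> N; 0 < e\<rbrakk> \<Longrightarrow> \<exists>d>0. \<forall>h. 0 < h \<and> h < d \<longrightarrow>
        norm (integral (cbox x (x + h *\<^sub>R One)) g /\<^sub>R h ^ DIM(real) - g x) < e"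
    using integrable_ccontinuous_explicit[of g, OF gi] by metis
  show ?thesis
  proof (rule that[OF N])
    fix t assume t: "t \<in> {a..<b} - N"
    show "((\<lambda>x. integral {a..x} f) has_vector_derivative f t) (at t within {t..b})"
      unfolding has_vector_derivative_def has_derivative_at_within tendsto_iff eventually_at
    proof (intro allI impI conjI)
      show "bounded_linear (\<lambda>x. x *\<^sub>R f t)" by (rule bounded_linear_scaleR_left)
      fix e :: real assume "e > 0"
      then obtain d where d: "d > 0" and
        dd: "\<And>h. 0 < h \<Longrightarrow> h < d \<Longrightarrow> norm (integral {t..t+h} g / h - g t) < e"
        using lim[of t e] t by (auto simp: divide_inverse_commute)
      show "\<exists>d>0. \<forall>x\<in>{t..b}. x \<noteq> t \<and> dist x t < d \<longrightarrow>
             dist ((integral {a..x} f - integral {a..t} f - (x - t) *\<^sub>R f t) /\<^sub>R norm (x - t)) 0 < e"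
      proof (intro exI[of _ d] conjI ballI impI d)
        fix x assume x: "x \<in> {t..b}" and "x \<noteq> t \<and> dist x t < d"
        then have xt: "x - t > 0" "x - t < d" by (auto simp: dist_real_def)
        have "integral {t..x} g = integral {t..x} f"
          using x t by (intro integral_cong) (auto simp: g_def)
        moreover have "integral {a..t} f + integral {t..x} f = integral {a..x} f"
          using t x by (intro Henstock_Kurzweil_Integration.integral_combine
              integrable_on_subinterval[OF assms]) auto
        ultimately have "integral {a..x} f - integral {a..t} f - (x - t) *\<^sub>R f t
           = integral {t..x} g - (x - t) * f t" by simp
        moreover have "g t = f t" using t by (auto simp: g_def)
        ultimately show "dist ((integral {a..x} f - integral {a..t} f - (x - t) *\<^sub>R f t) /\<^sub>R norm (x - t)) 0 < e"
          using dd[of "x - t"] xt by (simp add: field_simps)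
      qed
    qed
  qed
qed

text \<open>The quaternions as complex matrices. They are closed under sums, real multiples and
  products, so group elements, velocities and elements of \<open>p\<close> can all be written in
  this form.\<close>

definition su :: "complex \<Rightarrow> complex \<Rightarrow> cmat" where
  "su a b = mat2 a b (- cnj b) (cnj a)"

section \<open>The group and the equivalence classes\<close>

lemma matrix_inv_eqI:
  fixes A B :: "'a::semiring_1^'n^'n"
  assumes "A ** B = mat 1" "B ** A = mat 1"
  shows "matrix_inv A = B"
proof -
  have "A ** matrix_inv A = mat 1"
    unfolding matrix_inv_def by (rule someI2[of _ B]) (use assms in auto)
  then have "B ** A ** matrix_inv A = B" by (simp add: matrix_mul_assoc[symmetric])
  then show ?thesis by (simp add: assms)
qed

lemma mat2_nth [simp]: "mat2 a b c d $ 1 $ 1 = a" "mat2 a b c d $ 1 $ 2 = b"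
    "mat2 a b c d $ 2 $ 1 = c" "mat2 a b c d $ 2 $ 2 = d"
  by (simp_all add: mat2_def)

lemma cmat_eqI:
  fixes X Y :: cmat
  assumes "X $ 1 $ 1 = Y $ 1 $ 1" "X $ 1 $ 2 = Y $ 1 $ 2" "X $ 2 $ 1 = Y $ 2 $ 1" "X $ 2 $ 2 = Y $ 2 $ 2"
  shows "X = Y"
  using assms by (simp add: vec_eq_iff forall_2)

lemma su_nth [simp]: "su a b $ 1 $ 1 = a" "su a b $ 1 $ 2 = b"
    "su a b $ 2 $ 1 = - cnj b" "su a b $ 2 $ 2 = cnj a"
  by (simp_all add: su_def)

lemma su_eq_iff [simp]: "su a b = su c d \<longleftrightarrow> a = c \<and> b = d"
  by (metis su_nth(1,2))

lemma su_mult: "su a b ** su c d = su (a * c - b * cnj d) (a * d + b * cnj c)"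
  by (rule cmat_eqI) (simp_all add: matrix_matrix_mult_def sum_2)

lemma su_add: "su a b + su c d = su (a + c) (b + d)"
  by (rule cmat_eqI) simp_all

lemma su_scaleR: "r *\<^sub>R su a b = su (of_real r * a) (of_real r * b)"
  by (rule cmat_eqI) (simp_all add: scaleR_conv_of_real[where 'a=complex])

lemma mat_1_eq_su: "mat 1 = su 1 0"
  by (rule cmat_eqI) (simp_all add: mat_def)

lemma Id2_eq_su: "Id2 = su 1 0"
  by (simp add: Id2_def mat_1_eq_su)

lemma su_in_SU2_iff: "su a b \<in> SU2 \<longleftrightarrow> (cmod a)\<^sup>2 + (cmod b)\<^sup>2 = 1"
  unfolding SU2_def su_def[symmetric] by auto

lemma SU2E:
  assumes "g \<in> SU2"
  obtains a b where "g = su a b" "(cmod a)\<^sup>2 + (cmod b)\<^sup>2 = 1"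
  using assms unfolding SU2_def su_def[symmetric] by blast

lemma unit_pair_complex: "(cmod a)\<^sup>2 + (cmod b)\<^sup>2 = 1 \<longleftrightarrow> a * cnj a + b * cnj b = 1"
  by (metis complex_norm_square of_real_1 of_real_add of_real_eq_iff)

lemma matrix_inv_su:
  assumes "(cmod a)\<^sup>2 + (cmod b)\<^sup>2 = 1"
  shows "matrix_inv (su a b) = su (cnj a) (- b)"
proof (rule matrix_inv_eqI)
  have *: "a * cnj a + b * cnj b = 1" using assms by (simp add: unit_pair_complex)
  show "su a b ** su (cnj a) (- b) = mat 1" using * by (simp add: su_mult mat_1_eq_su)
  show "su (cnj a) (- b) ** su a b = mat 1" using * by (simp add: su_mult mat_1_eq_su mult.commute)
qed

lemma matrix_inv_SU2:
  assumes "g \<in> SU2"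
  shows "matrix_inv g \<in> SU2" "matrix_inv g ** g = mat 1" "g ** matrix_inv g = mat 1"
proof -
  obtain a b where g: "g = su a b" and ab: "(cmod a)\<^sup>2 + (cmod b)\<^sup>2 = 1" using assms by (rule SU2E)
  have *: "a * cnj a + b * cnj b = 1" using ab by (simp add: unit_pair_complex)
  show "matrix_inv g \<in> SU2" using ab by (simp add: g matrix_inv_su su_in_SU2_iff)
  show "matrix_inv g ** g = mat 1" "g ** matrix_inv g = mat 1"
    using * ab by (simp_all add: g matrix_inv_su su_mult mat_1_eq_su mult.commute)
qed

lemma SU2_mult: "g \<in> SU2 \<Longrightarrow> h \<in> SU2 \<Longrightarrow> g ** h \<in> SU2"
proof (elim SU2E)
  fix a b c d
  assume g: "g = su a b" "h = su c d" and n: "(cmod a)\<^sup>2 + (cmod b)\<^sup>2 = 1" "(cmod c)\<^sup>2 + (cmod d)\<^sup>2 = 1"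
  have "(a * c - b * cnj d) * cnj (a * c - b * cnj d) + (a * d + b * cnj c) * cnj (a * d + b * cnj c)
      = (a * cnj a + b * cnj b) * (c * cnj c + d * cnj d)" by (simp add: algebra_simps)
  then show ?thesis using n by (simp only: g su_mult su_in_SU2_iff unit_pair_complex) simp
qed

lemma Id2_in_SU2: "Id2 \<in> SU2" by (simp add: Id2_eq_su su_in_SU2_iff)

lemma matrix_inv_mult_SU2:
  assumes "g \<in> SU2" "h \<in> SU2"
  shows "matrix_inv (g ** h) = matrix_inv h ** matrix_inv g"
proof (rule matrix_inv_eqI)
  have "(g ** h) ** (matrix_inv h ** matrix_inv g) = g ** (h ** matrix_inv h) ** matrix_inv g"
    by (simp add: matrix_mul_assoc)
  then show "(g ** h) ** (matrix_inv h ** matrix_inv g) = mat 1"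
    by (simp add: matrix_inv_SU2 assms)
  have "(matrix_inv h ** matrix_inv g) ** (g ** h) = matrix_inv h ** (matrix_inv g ** g) ** h"
    by (simp add: matrix_mul_assoc)
  then show "(matrix_inv h ** matrix_inv g) ** (g ** h) = mat 1"
    by (simp add: matrix_inv_SU2 assms)
qed

section \<open>Matrix exponentials and Euler angles\<close>

lemma mpow_scaleR: "mpow (r *\<^sub>R J) n = r ^ n *\<^sub>R mpow J n"
  by (induction n) (simp_all add: matrix_scalar_ac scalar_matrix_assoc[symmetric] mult.commute)

lemma mpow_imaginary_unit:
  assumes "J ** J = - mat 1"
  shows "mpow J n = (if even n then (-1) ^ (n div 2) *\<^sub>R mat 1 else (-1) ^ ((n - 1) div 2) *\<^sub>R J)"
proof (induction n)
  case (Suc n)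
  show ?case
  proof (cases "even n")
    case True
    then show ?thesis using Suc by (simp add: matrix_scalar_ac scalar_matrix_assoc[symmetric])
  next
    case False
    then obtain k where "n = Suc (2 * k)" by (metis oddE Suc_eq_plus1)
    then show ?thesis using Suc assms by (simp add: matrix_scalar_ac scalar_matrix_assoc[symmetric])
  qed
qed simp

text \<open>\<open>J\<close> behaves like the imaginary unit, so the series splits into cosine and
  sine. \<open>p1\<close>, \<open>p2\<close> and \<open>kk\<close> are halves of such elements,
  hence the half angles in the next three lemmas.\<close>

lemma mexp_imaginary_unit:
  assumes "J ** J = - mat 1"
  shows "mexp (r *\<^sub>R J) = cos r *\<^sub>R mat 1 + sin r *\<^sub>R J"
proof -
  have "(1 / fact n) *\<^sub>R mpow (r *\<^sub>R J) n
      = (cos_coeff n *\<^sub>R r ^ n) *\<^sub>R mat 1 + (sin_coeff n *\<^sub>R r ^ n) *\<^sub>R J" for n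
    by (simp add: mpow_scaleR mpow_imaginary_unit[OF assms] cos_coeff_def sin_coeff_def mult.commute)
  moreover have "(\<lambda>n. (cos_coeff n *\<^sub>R r ^ n) *\<^sub>R mat 1 + (sin_coeff n *\<^sub>R r ^ n) *\<^sub>R J)
      sums (cos r *\<^sub>R mat 1 + sin r *\<^sub>R J)"
    by (intro sums_add bounded_linear.sums[OF bounded_linear_scaleR_left] cos_converges sin_converges)
  ultimately show ?thesis unfolding mexp_def by (simp add: sums_iff)
qed

lemma mexp_p1: "mexp (r *\<^sub>R p1) = su (of_real (cos (r/2))) (of_real (sin (r/2)))"
proof -
  have e: "r *\<^sub>R p1 = (r/2) *\<^sub>R su 0 1"
    by (rule cmat_eqI) (simp_all add: p1_def scaleR_conv_of_real[where 'a=complex])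
  have s: "su 0 1 ** su 0 1 = - mat 1"
    by (rule cmat_eqI) (simp_all add: su_mult mat_1_eq_su)
  show ?thesis
    unfolding e mexp_imaginary_unit[OF s]
    by (simp add: mat_1_eq_su su_scaleR su_add complex_eq_iff mult.commute)
qed

lemma mexp_p2: "mexp (r *\<^sub>R p2) = su (of_real (cos (r/2))) (\<i> * of_real (sin (r/2)))"
proof -
  have e: "r *\<^sub>R p2 = (r/2) *\<^sub>R su 0 \<i>"
    by (rule cmat_eqI) (simp_all add: p2_def scaleR_conv_of_real[where 'a=complex])
  have s: "su 0 \<i> ** su 0 \<i> = - mat 1"
    by (rule cmat_eqI) (simp_all add: su_mult mat_1_eq_su)
  show ?thesis
    unfolding e mexp_imaginary_unit[OF s]
    by (simp add: mat_1_eq_su su_scaleR su_add complex_eq_iff mult.commute)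
qed

lemma mexp_kk: "mexp (r *\<^sub>R kk) = su (cis (r/2)) 0"
proof -
  have e: "r *\<^sub>R kk = (r/2) *\<^sub>R su \<i> 0"
    by (rule cmat_eqI) (simp_all add: kk_def scaleR_conv_of_real[where 'a=complex])
  have s: "su \<i> 0 ** su \<i> 0 = - mat 1"
    by (rule cmat_eqI) (simp_all add: su_mult mat_1_eq_su)
  show ?thesis
    unfolding e mexp_imaginary_unit[OF s]
    by (simp add: mat_1_eq_su su_scaleR su_add complex_eq_iff mult.commute)
qed

lemma Erep_eq:
  "Erep b a c = su (Complex (cos (a/2) * cos ((c - b)/2)) (sin (a/2) * sin ((c + b)/2)))
                   (Complex (sin (a/2) * cos ((c + b)/2)) (cos (a/2) * sin ((c - b)/2)))"
  unfolding Erep_def mexp_p1 mexp_p2 su_mult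
  by (simp add: complex_eq_iff add_divide_distrib diff_divide_distrib cos_add sin_add cos_diff sin_diff algebra_simps)

text \<open>Regrouped according to \<open>Erep_eq\<close>, the four real coordinates form two
  complex numbers with moduli cos (a/2), sin (a/2) and arguments (c - b)/2, (c + b)/2; these
  determine the angles.\<close>

lemma Euler_angles:
  assumes "g \<in> SU2"
  obtains a b c where "a \<in> {0..pi}" "b \<in> {0..<2*pi}" "g = Erep b a c"
proof -
  obtain \<alpha> \<beta> where g: "g = su \<alpha> \<beta>" and n: "(cmod \<alpha>)\<^sup>2 + (cmod \<beta>)\<^sup>2 = 1" using assms by (rule SU2E)
  define u where "u = Complex (Re \<alpha>) (Im \<beta>)"
  define v where "v = Complex (Re \<beta>) (Im \<alpha>)"
  have uv: "(cmod u)\<^sup>2 + (cmod v)\<^sup>2 = 1" using n by (simp add: u_def v_def cmod_power2)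
  have "\<exists>x. 0 \<le> x \<and> x \<le> pi/2 \<and> cmod u = cos x \<and> cmod v = sin x"
    using sincos_total_pi_half[of "cmod u" "cmod v"] uv by auto
  then obtain x where x: "0 \<le> x" "x \<le> pi/2" "cmod u = cos x" "cmod v = sin x" by blast
  define d where "d = Arg v - Arg u"
  \<comment> \<open>Reducing \<open>b\<close> modulo 2 pi is harmless: \<open>c\<close> is chosen
    below to keep (c + b)/2 = Arg v, and then (c - b)/2 differs from Arg u by a multiple of 2
    pi.\<close>
  define b where "b = d - 2 * pi * of_int \<lfloor>d / (2*pi)\<rfloor>"
  have fl: "of_int \<lfloor>d / (2*pi)\<rfloor> \<le> d / (2*pi)" "d / (2*pi) < of_int \<lfloor>d / (2*pi)\<rfloor> + 1"
    by linarith+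
  have p: "2 * pi > 0" by simp
  have "of_int \<lfloor>d / (2*pi)\<rfloor> * (2*pi) \<le> d" "d < (of_int \<lfloor>d / (2*pi)\<rfloor> + 1) * (2*pi)"
    using fl pos_le_divide_eq[OF p] pos_divide_less_eq[OF p] by blast+
  then have b: "b \<in> {0..<2*pi}" by (auto simp: b_def algebra_simps)
  have "sin (Arg v - b) = sin (Arg u) \<and> cos (Arg v - b) = cos (Arg u)"
    unfolding sin_cos_eq_iff by (rule exI[of _ "\<lfloor>d / (2*pi)\<rfloor>"]) (simp add: b_def d_def)
  then have cs: "cos (Arg v - b) = cos (Arg u)" "sin (Arg v - b) = sin (Arg u)" by auto
  define c where "c = 2 * Arg v - b"
  have cb: "(c - b)/2 = Arg v - b" "(c + b)/2 = Arg v" by (simp_all add: c_def)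
  have ru: "u = rcis (cmod u) (Arg u)" and rv: "v = rcis (cmod v) (Arg v)"
    by (simp_all add: rcis_cmod_Arg)
  have "Re \<alpha> = cos x * cos (Arg u)" "Im \<beta> = cos x * sin (Arg u)"
    using arg_cong[OF ru, of Re] arg_cong[OF ru, of Im] x by (simp_all add: u_def)
  moreover have "Re \<beta> = sin x * cos (Arg v)" "Im \<alpha> = sin x * sin (Arg v)"
    using arg_cong[OF rv, of Re] arg_cong[OF rv, of Im] x by (simp_all add: v_def)
  ultimately have "g = Erep b (2 * x) c"
    unfolding Erep_eq cb cs by (simp add: g complex_eq_iff)
  then show ?thesis using that[of "2 * x" b c] b x by auto
qed

section \<open>The cyclic group of order four and its cosets\<close>

definition Z4 :: "cmat set" where
  "Z4 = {su 1 0, su 0 \<i>, su (-1) 0, su 0 (-\<i>)}"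

lemma mexp_p2_multiple_pi: "mexp ((of_int n * pi) *\<^sub>R p2) \<in> Z4"
proof -
  have "\<exists>m. n = 4 * m \<or> n = 4 * m + 1 \<or> n = 4 * m + 2 \<or> n = 4 * m + 3" by presburger
  then obtain m where m: "n = 4 * m \<or> n = 4 * m + 1 \<or> n = 4 * m + 2 \<or> n = 4 * m + 3" by blast
  have p: "sin (x + of_int m * (2 * pi)) = sin x" "cos (x + of_int m * (2 * pi)) = cos x" for x
    using sin.plus_of_int[of x m] cos.plus_of_int[of x m] by simp_all
  have e: "mexp ((of_int (4 * m + j) * pi) *\<^sub>R p2)
      = su (of_real (cos (of_int j * pi / 2))) (\<i> * of_real (sin (of_int j * pi / 2)))" for j
  proof -
    have "of_int (4 * m + j) * pi / 2 = of_int j * pi / 2 + of_int m * (2 * pi)"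
      by (simp add: field_simps)
    then show ?thesis unfolding mexp_p2 by (simp only: p)
  qed
  have c32: "cos (3 * pi / 2) = 0" "sin (3 * pi / 2) = -1"
    using cos_3over2_pi sin_3over2_pi by (simp_all add: field_simps)
  from m show ?thesis
    using e[of 0] e[of 1] e[of 2] e[of 3] by (elim disjE) (simp_all add: Z4_def c32)
qed

lemma Z4_mexp: "z \<in> Z4 \<Longrightarrow> \<exists>n::int. z = mexp ((of_int n * pi) *\<^sub>R p2)"
proof -
  assume "z \<in> Z4"
  moreover have "su 1 0 = mexp ((of_int 0 * pi) *\<^sub>R p2)" "su 0 \<i> = mexp ((of_int 1 * pi) *\<^sub>R p2)"
    "su (-1) 0 = mexp ((of_int 2 * pi) *\<^sub>R p2)" "su 0 (-\<i>) = mexp ((of_int (-1) * pi) *\<^sub>R p2)"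
    by (simp_all only: mexp_p2) simp_all
  ultimately show ?thesis unfolding Z4_def by blast
qed

lemma mexp_p2_add: "mexp ((r + s) *\<^sub>R p2) = mexp (r *\<^sub>R p2) ** mexp (s *\<^sub>R p2)"
  unfolding mexp_p2 by (simp add: su_mult add_divide_distrib cos_add sin_add algebra_simps)

lemma Erep_shift: "Erep b a (c + r) = Erep b a c ** mexp (r *\<^sub>R p2)"
  by (simp add: Erep_def mexp_p2_add matrix_mul_assoc)

lemma Z4_subset_SU2: "Z4 \<subseteq> SU2"
  by (auto simp: Z4_def su_in_SU2_iff)

text \<open>The angle \<open>c\<close> is the parameter of the last factor of \<open>Erep\<close>,
  so shifting it by multiples of pi is right multiplication by powers of \<open>exp (pi p2)\<close>.
  Conversely, \<open>Euler_angles\<close> supplies a representation of \<open>g\<close> to be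
  shifted.\<close>

lemma cls_eq:
  assumes g: "g \<in> SU2"
  shows "cls g = (\<lambda>z. g ** z) ` Z4"
proof
  show "cls g \<subseteq> (\<lambda>z. g ** z) ` Z4"
  proof
    fix h assume "h \<in> cls g"
    then obtain a b c1 c2 n where h: "g = Erep b a c1" "h = Erep b a c2" "c1 - c2 = of_int n * pi"
      unfolding cls_def approx_rel_def by auto
    then have "c2 = c1 + of_int (- n) * pi" by simp
    then have "h = g ** mexp ((of_int (- n) * pi) *\<^sub>R p2)" using h Erep_shift by metis
    then show "h \<in> (\<lambda>z. g ** z) ` Z4" using mexp_p2_multiple_pi by blast
  qed
  show "(\<lambda>z. g ** z) ` Z4 \<subseteq> cls g"
  proof
    fix h assume "h \<in> (\<lambda>z. g ** z) ` Z4"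
    then obtain n :: int where h: "h = g ** mexp ((of_int n * pi) *\<^sub>R p2)" using Z4_mexp by blast
    have hS: "h \<in> SU2" unfolding h using g Z4_subset_SU2 mexp_p2_multiple_pi SU2_mult by blast
    obtain a b c where e: "a \<in> {0..pi}" "b \<in> {0..<2*pi}" "g = Erep b a c" using g by (rule Euler_angles)
    have "h = Erep b a (c + of_int n * pi)" by (simp add: h e Erep_shift)
    moreover have "c - (c + of_int n * pi) = of_int (- n) * pi" by simp
    ultimately show "h \<in> cls g" unfolding cls_def approx_rel_def using g hS e by blast
  qed
qed

lemma Z4_mult: "z \<in> Z4 \<Longrightarrow> w \<in> Z4 \<Longrightarrow> z ** w \<in> Z4"
  by (auto simp: Z4_def su_mult)

lemma Z4_inv: "z \<in> Z4 \<Longrightarrow> matrix_inv z \<in> Z4"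
  by (auto simp: Z4_def matrix_inv_su)

lemma Id2_in_Z4: "Id2 \<in> Z4"
  by (simp add: Z4_def Id2_eq_su)

lemma cls_Id2: "cls Id2 = Z4"
  using cls_eq[OF Id2_in_SU2] by (simp add: Id2_def)

lemma SU2_inv_mult_cancel: "g \<in> SU2 \<Longrightarrow> matrix_inv g ** (g ** x) = x"
  "g \<in> SU2 \<Longrightarrow> g ** (matrix_inv g ** x) = x"
  "g \<in> SU2 \<Longrightarrow> x ** g ** matrix_inv g = x"
  "g \<in> SU2 \<Longrightarrow> x ** matrix_inv g ** g = x"
  by (simp_all add: matrix_mul_assoc matrix_inv_SU2) (simp_all add: matrix_mul_assoc[symmetric] matrix_inv_SU2)

lemma cls_self: "g \<in> SU2 \<Longrightarrow> g \<in> cls g"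
  using Id2_in_Z4 by (force simp: cls_eq Id2_def)

lemma cls_right_Z4:
  assumes "g \<in> SU2" "z \<in> Z4"
  shows "cls (g ** z) = cls g"
proof -
  have "g ** z \<in> SU2" using assms SU2_mult Z4_subset_SU2 by blast
  moreover have "(\<lambda>w. z ** w) ` Z4 = Z4"
  proof
    show "(\<lambda>w. z ** w) ` Z4 \<subseteq> Z4" using assms Z4_mult by blast
    show "Z4 \<subseteq> (\<lambda>w. z ** w) ` Z4"
    proof
      fix w assume "w \<in> Z4"
      then show "w \<in> (\<lambda>w. z ** w) ` Z4"
        using assms Z4_subset_SU2 Z4_mult[OF Z4_inv[OF assms(2)]]
        by (intro image_eqI[of _ _ "matrix_inv z ** w"]) (auto simp: SU2_inv_mult_cancel)
    qed
  qed
  then have "(\<lambda>w. g ** w) ` Z4 = (\<lambda>w. g ** w) ` (\<lambda>w. z ** w) ` Z4" by simp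
  ultimately show ?thesis using assms by (simp add: cls_eq image_image matrix_mul_assoc)
qed

lemma cls_eqD:
  assumes "cls g = cls h" "g \<in> SU2" "h \<in> SU2"
  obtains z where "z \<in> Z4" "h = g ** z"
  using assms cls_self[of h] by (auto simp: cls_eq)

section \<open>Horizontal curves\<close>

lemma AE_lebesgue_iff_negligible:
  "(AE t in lebesgue. P t) \<longleftrightarrow> (\<exists>N. negligible N \<and> (\<forall>t. t \<notin> N \<longrightarrow> P t))"
  unfolding eventually_ae_filter negligible_iff_null_sets by auto

lemma su_0_mult_right: "su a b ** su 0 w = su (- b * cnj w) (a * w)"
  by (simp add: su_mult)

lemma in_p_su_iff: "in_p (su x y) \<longleftrightarrow> x = 0"
proof
  assume "in_p (su x y)"
  then obtain r s where "su x y = r *\<^sub>R p1 + s *\<^sub>R p2" unfolding in_p_def by blast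
  then have "su x y $ 1 $ 1 = (r *\<^sub>R p1 + s *\<^sub>R p2) $ 1 $ 1" by simp
  then show "x = 0" by (simp add: p1_def p2_def)
next
  assume "x = 0"
  have "su x y = (2 * Re y) *\<^sub>R p1 + (2 * Im y) *\<^sub>R p2"
    by (rule cmat_eqI) (simp_all add: p1_def p2_def \<open>x = 0\<close> complex_eq_iff)
  then show "in_p (su x y)" unfolding in_p_def by blast
qed

text \<open>A unit vector of \<open>p\<close> has an upper right entry of modulus 1/2; this is the
  factor 2 in the length integrals.\<close>

lemma sqrt_ip_p_su: "sqrt (ip_p (su x y) (su x y)) = 2 * cmod y"
proof -
  have "ip_p (su x y) (su x y) = (2 * cmod y)\<^sup>2"
    unfolding power_mult_distrib cmod_power2 by (simp add: ip_p_def pc1_def pc2_def power2_eq_square)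
  then show ?thesis by (simp only: real_sqrt_abs) simp
qed

definition hspeed :: "(real \<Rightarrow> cmat) \<Rightarrow> real \<Rightarrow> real \<Rightarrow> real \<Rightarrow> real" where
  "hspeed \<gamma> a b t = sqrt (sr_metric (\<gamma> t)
      (vector_derivative \<gamma> (at t within {a..b})) (vector_derivative \<gamma> (at t within {a..b})))"

lemma hlength_hspeed: "hlength \<gamma> a b = integral {a..b} (hspeed \<gamma> a b)"
  by (simp add: hlength_def hspeed_def[abs_def])

lemma vector_derivative_Icc:
  fixes f :: "real \<Rightarrow> 'a::real_normed_vector"
  assumes "a < b" "t \<in> {a..b}" "(f has_vector_derivative D) (at t within {a..b})"
  shows "vector_derivative f (at t within {a..b}) = D"
  using assms vector_derivative_within_cbox[of a b t f D] by simp

lemma hspeed_eq: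
  assumes "a < b" "t \<in> {a..b}" "\<gamma> t \<in> SU2"
    and "(\<gamma> has_vector_derivative \<gamma> t ** su 0 w) (at t within {a..b})"
  shows "hspeed \<gamma> a b t = 2 * cmod w"
  unfolding hspeed_def sr_metric_def vector_derivative_Icc[OF assms(1,2,4)]
    SU2_inv_mult_cancel[OF assms(3)] by (rule sqrt_ip_p_su)

lemma bounded_linear_entry: "bounded_linear (\<lambda>X::cmat. X $ i $ j)"
  using bounded_linear_compose[OF bounded_linear_vec_nth bounded_linear_vec_nth] by blast

text \<open>The shape \<open>su\<close> is a real-linear condition on the entries and is inherited
  by velocities, so a velocity is determined by its first row.\<close>

lemma SU2_vector_derivative:
  assumes ab: "a < b" and t: "t \<in> {a..b}" and SU2: "\<forall>t\<in>{a..b}. \<gamma> t \<in> SU2"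
    and der: "(\<gamma> has_vector_derivative D) (at t within {a..b})"
  shows "D = su (D $ 1 $ 1) (D $ 1 $ 2)"
proof (rule cmat_eqI)
  have e: "((\<lambda>t. \<gamma> t $ i $ j) has_vector_derivative D $ i $ j) (at t within {a..b})" for i j
    by (rule bounded_linear.has_vector_derivative[OF bounded_linear_entry der])
  have *: "x = y" if "(f has_vector_derivative x) (at t within {a..b})"
      "(g has_vector_derivative y) (at t within {a..b})" "\<And>t. t \<in> {a..b} \<Longrightarrow> f t = g t"
    for f g :: "real \<Rightarrow> complex" and x y
  proof -
    have "(g has_vector_derivative x) (at t within {a..b})"
      by (rule has_vector_derivative_transform[OF t _ that(1)]) (simp add: that(3))
    then show ?thesis using that(2) vector_derivative_Icc[OF ab t] by metis
  qed
  have f: "\<gamma> t $ 2 $ 1 = - cnj (\<gamma> t $ 1 $ 2) \<and> \<gamma> t $ 2 $ 2 = cnj (\<gamma> t $ 1 $ 1)" if "t \<in> {a..b}" for t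
    using SU2 that by (metis SU2E su_nth)
  have "D $ 2 $ 1 = - cnj (D $ 1 $ 2)"
    by (rule *[OF e has_vector_derivative_minus[OF has_vector_derivative_cnj[OF e]]]) (simp add: f)
  then show "D $ 2 $ 1 = su (D $ 1 $ 1) (D $ 1 $ 2) $ 2 $ 1" by simp
  have "D $ 2 $ 2 = cnj (D $ 1 $ 1)"
    by (rule *[OF e has_vector_derivative_cnj[OF e]]) (simp add: f)
  then show "D $ 2 $ 2 = su (D $ 1 $ 1) (D $ 1 $ 2) $ 2 $ 2" by simp
qed simp_all

lemma horizontalI:
  assumes "a \<le> b" "\<And>t. t \<in> {a..b} \<Longrightarrow> \<gamma> t \<in> SU2" "C-lipschitz_on {a..b} \<gamma>" "negligible N"
    and der: "\<And>t. t \<in> {a..b} - N \<Longrightarrow> (\<gamma> has_vector_derivative \<gamma> t ** su 0 (W t)) (at t within {a..b})"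
  shows "horizontal \<gamma> a b"
proof -
  have "AE t in lebesgue. t \<in> {a..b} \<longrightarrow>
        \<gamma> differentiable (at t within {a..b}) \<and>
        in_p (matrix_inv (\<gamma> t) ** vector_derivative \<gamma> (at t within {a..b}))"
  proof (cases "a = b")
    case True
    then show ?thesis unfolding AE_lebesgue_iff_negligible by (intro exI[of _ "{a}"]) auto
  next
    case False
    with assms have ab: "a < b" by simp
    show ?thesis unfolding AE_lebesgue_iff_negligible
    proof (intro exI[of _ N] conjI allI impI assms)
      fix t assume t: "t \<notin> N" "t \<in> {a..b}"
      then have d: "(\<gamma> has_vector_derivative \<gamma> t ** su 0 (W t)) (at t within {a..b})" by (simp add: der)
      show "\<gamma> differentiable (at t within {a..b})"
        using d by (rule differentiableI_vector)
      show "in_p (matrix_inv (\<gamma> t) ** vector_derivative \<gamma> (at t within {a..b}))"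
        using assms(2) t by (simp add: vector_derivative_Icc[OF ab t(2) d] SU2_inv_mult_cancel in_p_su_iff)
    qed
  qed
  then show ?thesis using assms unfolding horizontal_def by blast
qed

lemma horizontalD:
  assumes "horizontal \<gamma> a b"
  shows "a \<le> b" "\<And>t. t \<in> {a..b} \<Longrightarrow> \<gamma> t \<in> SU2" "\<exists>C. C-lipschitz_on {a..b} \<gamma>"
  using assms unfolding horizontal_def by blast+

lemma norm_vector_derivative_le_lipschitz:
  fixes f :: "real \<Rightarrow> 'a::real_normed_vector"
  assumes ab: "a < b" and t: "t \<in> {a..b}" and lip: "C-lipschitz_on {a..b} f"
    and der: "(f has_vector_derivative D) (at t within {a..b})"
  shows "norm D \<le> C"
proof (rule field_le_epsilon)
  fix e :: real assume "e > 0"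
  then obtain d where d: "d > 0" and dd: "\<And>y. y \<in> {a..b} \<Longrightarrow> norm (y - t) < d \<Longrightarrow>
      norm (f y - f t - (y - t) *\<^sub>R D) \<le> e * norm (y - t)"
    using der unfolding has_vector_derivative_def has_derivative_within_alt by blast
  obtain y where y: "y \<in> {a..b}" "y \<noteq> t" "norm (y - t) < d"
  proof (cases "t < b")
    case True
    then show ?thesis using that[of "min b (t + d/2)"] t d by (auto simp: min_def)
  next
    case False
    then show ?thesis using that[of "max a (t - d/2)"] t d ab by (auto simp: max_def)
  qed
  have "norm ((y - t) *\<^sub>R D) \<le> norm (f y - f t) + norm (f y - f t - (y - t) *\<^sub>R D)"
    by (metis norm_triangle_sub norm_minus_commute)
  also have "\<dots> \<le> C * norm (y - t) + e * norm (y - t)"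
    using dd[OF y(1,3)] lipschitz_onD[OF lip y(1) t] by (intro add_mono) (auto simp: dist_norm)
  finally have "norm (y - t) * norm D \<le> norm (y - t) * (C + e)" by (simp add: algebra_simps del: scaleR_left_diff_distrib)
  then show "norm D \<le> C + e" using y by simp
qed

text \<open>Normal form of a horizontal curve: a control \<open>W\<close>, bounded at every point,
  drives it almost everywhere. The integrability of the speed is derived here, since
  \<open>horizontal\<close> only asks for a Lipschitz curve.\<close>

lemma horizontal_velocity:
  assumes hor: "horizontal \<gamma> a b" and ab: "a < b"
  obtains N W K where "negligible N"
    "\<And>t. t \<in> {a..b} - N \<Longrightarrow> (\<gamma> has_vector_derivative \<gamma> t ** su 0 (W t)) (at t within {a..b})"
    "\<And>t. cmod (W t) \<le> K" "(\<lambda>t. 2 * cmod (W t)) integrable_on {a..b}"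
    "hlength \<gamma> a b = integral {a..b} (\<lambda>t. 2 * cmod (W t))"
proof -
  note h = horizontalD[OF hor]
  from h obtain C where C: "C-lipschitz_on {a..b} \<gamma>" by blast
  obtain N where N: "negligible N" and NP: "\<And>t. t \<in> {a..b} - N \<Longrightarrow> \<gamma> differentiable (at t within {a..b}) \<and>
        in_p (matrix_inv (\<gamma> t) ** vector_derivative \<gamma> (at t within {a..b}))"
    using hor unfolding horizontal_def AE_lebesgue_iff_negligible by blast
  \<comment> \<open>The value 0 off the good set makes the bound on \<open>W\<close> hold at every
    point.\<close>
  define D where "D t = (if t \<in> {a..b} - N then vector_derivative \<gamma> (at t within {a..b}) else 0)" for t
  have D: "(\<gamma> has_vector_derivative D t) (at t within {a..b})" if "t \<in> {a..b} - N" for t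
    using NP[OF that] that by (simp add: D_def vector_derivative_works)
  define W where "W t = (matrix_inv (\<gamma> t) ** D t) $ 1 $ 2" for t
  have W0: "W t = 0 \<and> D t = 0" if "t \<notin> {a..b} - N" for t
  proof -
    have "D t = 0" using that unfolding D_def by (rule if_not_P)
    then show ?thesis by (simp add: W_def matrix_matrix_mult_def)
  qed
  have DW: "D t = \<gamma> t ** su 0 (W t)" if t: "t \<in> {a..b} - N" for t
  proof -
    have g: "\<gamma> t \<in> SU2" using h t by auto
    obtain x y where xy: "\<gamma> t = su x y" "(cmod x)\<^sup>2 + (cmod y)\<^sup>2 = 1" using g by (rule SU2E)
    have "D t = su (D t $ 1 $ 1) (D t $ 1 $ 2)"
      using SU2_vector_derivative[OF ab _ _ D[OF t]] h t by blast
    then obtain c d where cd: "D t = su c d" by blast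
    obtain z w where zw: "matrix_inv (\<gamma> t) ** D t = su z w"
      using xy cd by (simp add: matrix_inv_su su_mult)
    then have "in_p (su z w)" using NP[OF t] t by (simp add: D_def)
    then have "matrix_inv (\<gamma> t) ** D t = su 0 (W t)"
      using zw by (simp add: in_p_su_iff W_def)
    then have "\<gamma> t ** su 0 (W t) = \<gamma> t ** (matrix_inv (\<gamma> t) ** D t)" by simp
    then show ?thesis using SU2_inv_mult_cancel(2)[OF g] by simp
  qed
  \<comment> \<open>The matrix norm counts both rows, hence the factor sqrt 2.\<close>
  have normD: "sqrt 2 * cmod (W t) = norm (D t)" for t
  proof (cases "t \<in> {a..b} - N")
    case True
    then obtain x y where xy: "\<gamma> t = su x y" "(cmod x)\<^sup>2 + (cmod y)\<^sup>2 = 1" using h by (metis SU2E DiffD1)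
    have "norm (su p q) = sqrt (2 * ((cmod p)\<^sup>2 + (cmod q)\<^sup>2))" for p q
      by (simp add: norm_vec_def L2_set_def sum_2)
    then have "norm (D t) = sqrt (2 * ((cmod (W t))\<^sup>2 * ((cmod x)\<^sup>2 + (cmod y)\<^sup>2)))"
      by (simp add: DW[OF True] xy(1) su_0_mult_right norm_mult power_mult_distrib algebra_simps)
    then show ?thesis by (simp add: xy real_sqrt_mult)
  next
    case False
    then show ?thesis using W0 by simp
  qed
  have C0: "C \<ge> 0" using C by (rule lipschitz_on_nonneg)
  have nDC: "norm (D t) \<le> C" for t
    using norm_vector_derivative_le_lipschitz[OF ab _ C D] W0[of t] C0 by (cases "t \<in> {a..b} - N") auto
  \<comment> \<open>This yields measurability of the velocity; with the Lipschitz bound its norm,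
    and so the speed, becomes integrable.\<close>
  have "(D has_integral (\<gamma> b - \<gamma> a)) {a..b}"
  proof (rule lipschitz_has_integral_right_derivative[OF h(1) C N])
    fix t assume "t \<in> {a..<b} - N"
    then show "(\<gamma> has_vector_derivative D t) (at t within {t..b})"
      by (intro has_vector_derivative_within_subset[OF D]) auto
  qed
  then have "D \<in> borel_measurable (lebesgue_on {a..b})"
    by (intro integrable_imp_measurable) blast
  then have "D absolutely_integrable_on {a..b}"
    by (rule measurable_bounded_by_integrable_imp_absolutely_integrable[where g = "\<lambda>_. C"]) (use nDC in auto)
  then have "(\<lambda>t. norm (D t)) integrable_on {a..b}"
    by (simp add: absolutely_integrable_on_def)
  then have "(\<lambda>t. sqrt 2 *\<^sub>R norm (D t)) integrable_on {a..b}" by (rule integrable_cmul)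
  moreover have "sqrt 2 *\<^sub>R norm (D t) = 2 * cmod (W t)" for t
    by (simp add: normD[symmetric])
  ultimately have int: "(\<lambda>t. 2 * cmod (W t)) integrable_on {a..b}" by (simp only:)
  have Wder: "(\<gamma> has_vector_derivative \<gamma> t ** su 0 (W t)) (at t within {a..b})" if "t \<in> {a..b} - N" for t
    using D[OF that] DW[OF that] by simp
  have "hlength \<gamma> a b = integral {a..b} (\<lambda>t. 2 * cmod (W t))"
    unfolding hlength_hspeed
    by (rule integral_spike[OF N]) (use hspeed_eq[OF ab _ _ Wder] h in auto)
  moreover have "cmod (W t) \<le> C" for t
  proof -
    have "1 * cmod (W t) \<le> sqrt 2 * cmod (W t)" by (intro mult_right_mono) auto
    then show ?thesis using normD[of t] nDC[of t] by simp
  qed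
  ultimately show ?thesis using that N Wder int by blast
qed

lemma hlength_eq:
  assumes ab: "a \<le> b" and SU2: "\<And>t. t \<in> {a..b} \<Longrightarrow> \<gamma> t \<in> SU2" and N: "negligible N"
    and der: "\<And>t. t \<in> {a..b} - N \<Longrightarrow> (\<gamma> has_vector_derivative \<gamma> t ** su 0 (W t)) (at t within {a..b})"
  shows "hlength \<gamma> a b = integral {a..b} (\<lambda>t. 2 * cmod (W t))"
proof (cases "a = b")
  case False
  then have "a < b" using ab by simp
  then show ?thesis
    unfolding hlength_hspeed
    by (intro integral_spike[OF N]) (use hspeed_eq[OF _ _ _ der] SU2 in auto)
qed (simp add: hlength_def)

lemma hlength_nonneg: "horizontal \<gamma> a b \<Longrightarrow> 0 \<le> hlength \<gamma> a b"
proof (cases "a < b")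
  case True
  assume "horizontal \<gamma> a b"
  then show ?thesis using True by (rule horizontal_velocity) (auto intro!: integral_nonneg)
next
  case False
  assume "horizontal \<gamma> a b"
  then have "a = b" using False horizontalD(1) by fastforce
  then show ?thesis by (simp add: hlength_def)
qed

lemma bounded_linear_matrix_mult: "bounded_linear (\<lambda>X::cmat. P ** X ** Q)"
proof -
  have "linear (\<lambda>X::cmat. P ** X ** Q)"
    by (rule linearI)
      (simp_all add: matrix_matrix_mult_def vec_eq_iff sum_2 algebra_simps)
  then show ?thesis by (rule linear_conv_bounded_linear[THEN iffD1])
qed

lemma lipschitz_on_bounded_linear:
  assumes "bounded_linear f" "C-lipschitz_on S g"
  shows "\<exists>C. C-lipschitz_on S (\<lambda>x. f (g x))"
proof -
  obtain B where B: "B \<ge> 0" "\<And>x. norm (f x) \<le> norm x * B"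
    using bounded_linear.nonneg_bounded[OF assms(1)] by auto
  have "(C * B)-lipschitz_on S (\<lambda>x. f (g x))"
  proof (rule lipschitz_onI)
    fix x y assume xy: "x \<in> S" "y \<in> S"
    have "norm (f (g x) - f (g y)) \<le> norm (g x - g y) * B"
      using B(2)[of "g x - g y"] by (simp add: linear_diff[OF bounded_linear.linear[OF assms(1)]])
    also have "\<dots> \<le> (C * dist x y) * B"
      using lipschitz_onD[OF assms(2) xy] B(1) by (intro mult_right_mono) (auto simp: dist_norm)
    finally show "dist (f (g x)) (f (g y)) \<le> C * B * dist x y" by (simp add: dist_norm mult_ac)
  qed (use B(1) lipschitz_on_nonneg[OF assms(2)] in simp)
  then show ?thesis ..
qed

text \<open>Conjugation by \<open>Z4\<close> maps \<open>p\<close> to itself isometrically. For this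
  reason right translations by \<open>Z4\<close> preserve lengths, although the metric is built from
  left translations.\<close>

lemma Z4_conj_p:
  assumes "z \<in> Z4"
  obtains w' where "su 0 w ** z = z ** su 0 w'" "cmod w' = cmod w"
proof -
  have "\<exists>w'. su 0 w ** z = z ** su 0 w' \<and> cmod w' = cmod w"
    using assms unfolding Z4_def
    by (auto simp: su_mult intro: exI[of _ w] exI[of _ "- cnj w"] complex_cnj_minus)
  then show ?thesis using that by blast
qed

lemma horizontal_translate:
  assumes hor: "horizontal \<gamma> a b" and P: "P \<in> SU2" and z: "z \<in> Z4"
  shows "horizontal (\<lambda>t. P ** \<gamma> t ** z) a b" "hlength (\<lambda>t. P ** \<gamma> t ** z) a b = hlength \<gamma> a b"
proof -
  note h = horizontalD[OF hor]
  have SU2': "P ** \<gamma> t ** z \<in> SU2" if "t \<in> {a..b}" for t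
    using h(2)[OF that] P z Z4_subset_SU2 SU2_mult by blast
  from h obtain C where "C-lipschitz_on {a..b} \<gamma>" by blast
  then obtain C' where C': "C'-lipschitz_on {a..b} (\<lambda>t. P ** \<gamma> t ** z)"
    using lipschitz_on_bounded_linear[OF bounded_linear_matrix_mult] by blast
  have "horizontal (\<lambda>t. P ** \<gamma> t ** z) a b \<and> hlength (\<lambda>t. P ** \<gamma> t ** z) a b = hlength \<gamma> a b"
  proof (cases "a = b")
    case True
    then show ?thesis using horizontalI[OF h(1) SU2' C', of "{a}"] by (simp add: hlength_def)
  next
    case False
    then have ab: "a < b" using h by simp
    obtain N W K where N: "negligible N" and
      W: "\<And>t. t \<in> {a..b} - N \<Longrightarrow> (\<gamma> has_vector_derivative \<gamma> t ** su 0 (W t)) (at t within {a..b})" and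
      "\<And>t. cmod (W t) \<le> K" "(\<lambda>t. 2 * cmod (W t)) integrable_on {a..b}" and
      len: "hlength \<gamma> a b = integral {a..b} (\<lambda>t. 2 * cmod (W t))"
    using hor ab by (rule horizontal_velocity) (rule that)
    define W' where "W' t = (SOME w'. su 0 (W t) ** z = z ** su 0 w' \<and> cmod w' = cmod (W t))" for t
    have "\<exists>w'. su 0 (W t) ** z = z ** su 0 w' \<and> cmod w' = cmod (W t)" for t
      using Z4_conj_p[OF z] by metis
    from someI_ex[OF this]
    have W': "su 0 (W t) ** z = z ** su 0 (W' t)" "cmod (W' t) = cmod (W t)" for t
      unfolding W'_def by blast+
    have der: "((\<lambda>t. P ** \<gamma> t ** z) has_vector_derivative (P ** \<gamma> t ** z) ** su 0 (W' t)) (at t within {a..b})"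
      if "t \<in> {a..b} - N" for t
    proof -
      have "((\<lambda>t. P ** \<gamma> t ** z) has_vector_derivative P ** (\<gamma> t ** su 0 (W t)) ** z) (at t within {a..b})"
        by (rule bounded_linear.has_vector_derivative[OF bounded_linear_matrix_mult W[OF that]])
      moreover have "P ** (\<gamma> t ** su 0 (W t)) ** z = (P ** \<gamma> t) ** (su 0 (W t) ** z)"
        by (simp only: matrix_mul_assoc)
      ultimately show ?thesis by (simp only: W' matrix_mul_assoc)
    qed
    show ?thesis
      using horizontalI[OF h(1) SU2' C' N der] hlength_eq[OF h(1) SU2' N der] len by (simp add: W')
  qed
  then show "horizontal (\<lambda>t. P ** \<gamma> t ** z) a b" "hlength (\<lambda>t. P ** \<gamma> t ** z) a b = hlength \<gamma> a b"
    by auto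
qed

lemma horizontal_restrict:
  assumes hor: "horizontal \<gamma> a b" and cd: "a \<le> c" "c \<le> d" "d \<le> b"
  shows "horizontal \<gamma> c d"
proof (cases "a < b")
  case True
  note h = horizontalD[OF hor]
  from h obtain C where C: "C-lipschitz_on {a..b} \<gamma>" by blast
  obtain N W K where N: "negligible N" and
      W: "\<And>t. t \<in> {a..b} - N \<Longrightarrow> (\<gamma> has_vector_derivative \<gamma> t ** su 0 (W t)) (at t within {a..b})" and
      "\<And>t. cmod (W t) \<le> K" "(\<lambda>t. 2 * cmod (W t)) integrable_on {a..b}" and
      len: "hlength \<gamma> a b = integral {a..b} (\<lambda>t. 2 * cmod (W t))"
    using hor True by (rule horizontal_velocity) (rule that)
  show ?thesis
  proof (rule horizontalI[OF cd(2) _ _ N])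
    show "C-lipschitz_on {c..d} \<gamma>" using C cd by (auto intro: lipschitz_on_subset)
    show "\<gamma> t \<in> SU2" if "t \<in> {c..d}" for t using that cd h by auto
    show "(\<gamma> has_vector_derivative \<gamma> t ** su 0 (W t)) (at t within {c..d})" if "t \<in> {c..d} - N" for t
      using that cd by (intro has_vector_derivative_within_subset[OF W]) auto
  qed
next
  case False
  then show ?thesis using assms horizontalD(1)[OF hor] by (metis order_antisym not_le order_trans)
qed

section \<open>The spherical lower bound for the length\<close>

lemma lipschitz_on_mult_unit_bounded:
  fixes f g :: "'a::metric_space \<Rightarrow> 'b::real_normed_algebra"
  assumes f: "C-lipschitz_on S f" and g: "D-lipschitz_on S g"
    and bd: "\<And>x. x \<in> S \<Longrightarrow> norm (f x) \<le> 1" "\<And>x. x \<in> S \<Longrightarrow> norm (g x) \<le> 1"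
  shows "(C + D)-lipschitz_on S (\<lambda>x. f x * g x)"
proof (rule lipschitz_onI)
  fix x y assume xy: "x \<in> S" "y \<in> S"
  have "f x * g x - f y * g y = (f x - f y) * g x + f y * (g x - g y)" by (simp add: algebra_simps)
  then have "norm (f x * g x - f y * g y) \<le> norm (f x - f y) * norm (g x) + norm (f y) * norm (g x - g y)"
    by (metis norm_triangle_le add_mono norm_mult_ineq)
  also have "\<dots> \<le> norm (f x - f y) * 1 + 1 * norm (g x - g y)"
    by (intro add_mono mult_mono) (use bd xy in auto)
  also have "\<dots> \<le> C * dist x y + D * dist x y"
    using lipschitz_onD[OF f xy] lipschitz_onD[OF g xy] by (simp add: dist_norm)
  finally show "dist (f x * g x) (f y * g y) \<le> (C + D) * dist x y" by (simp add: dist_norm algebra_simps)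
qed (use lipschitz_on_nonneg[OF f] lipschitz_on_nonneg[OF g] in simp)

lemma lipschitz_on_comp_bounded_derivative:
  fixes h :: "real \<Rightarrow> real"
  assumes f: "C-lipschitz_on S f" and fT: "\<And>x. x \<in> S \<Longrightarrow> f x \<in> T" and T: "convex T"
    and h: "\<And>y. y \<in> T \<Longrightarrow> (h has_real_derivative h' y) (at y within T)"
      "\<And>y. y \<in> T \<Longrightarrow> \<bar>h' y\<bar> \<le> D"
    and D: "0 \<le> D"
  shows "(D * C)-lipschitz_on S (\<lambda>x. h (f x))"
proof (rule lipschitz_onI)
  fix x y assume xy: "x \<in> S" "y \<in> S"
  have "norm (h (f x) - h (f y)) \<le> D * norm (f x - f y)"
    by (rule field_differentiable_bound[OF T h(1)]) (use h fT xy in auto)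
  also have "\<dots> \<le> D * (C * dist x y)"
    using lipschitz_onD[OF f xy] D by (intro mult_left_mono) (auto simp: dist_norm)
  finally show "dist (h (f x)) (h (f y)) \<le> D * C * dist x y" by (simp add: dist_norm mult_ac)
qed (use D lipschitz_on_nonneg[OF f] in simp)

lemma lipschitz_on_linear_image:
  assumes "bounded_linear f" "C-lipschitz_on S g" "\<And>x. norm (f x) \<le> norm x"
  shows "C-lipschitz_on S (\<lambda>x. f (g x))"
proof (rule lipschitz_onI)
  fix x y assume xy: "x \<in> S" "y \<in> S"
  have "dist (f (g x)) (f (g y)) = norm (f (g x - g y))"
    by (simp add: dist_norm linear_diff[OF bounded_linear.linear[OF assms(1)]])
  also have "\<dots> \<le> C * dist x y"
    using assms(3)[of "g x - g y"] lipschitz_onD[OF assms(2) xy] by (simp add: dist_norm)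
  finally show "dist (f (g x)) (f (g y)) \<le> C * dist x y" .
qed (rule lipschitz_on_nonneg[OF assms(2)])

lemma lipschitz_on_indefinite_integral:
  fixes v :: "real \<Rightarrow> real"
  assumes "v integrable_on {a..b}" "\<And>t. 0 \<le> v t" "\<And>t. v t \<le> K"
  shows "K-lipschitz_on {a..b} (\<lambda>t. integral {a..t} v)"
proof -
  have *: "\<bar>integral {a..x} v - integral {a..y} v\<bar> \<le> K * \<bar>x - y\<bar>" if "x \<in> {a..b}" "y \<in> {a..b}" "x \<le> y" for x y
  proof -
    have i: "v integrable_on {x..y}" using assms(1) that by (auto intro: integrable_on_subinterval)
    have "integral {a..x} v + integral {x..y} v = integral {a..y} v"
      using that by (intro Henstock_Kurzweil_Integration.integral_combine
            integrable_on_subinterval[OF assms(1)]) auto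
    moreover have "integral {x..y} v \<le> integral {x..y} (\<lambda>_. K)"
      by (rule integral_le[OF i]) (use assms in auto)
    moreover have "0 \<le> integral {x..y} v"
      by (rule integral_nonneg[OF i]) (use assms in auto)
    ultimately show ?thesis using that by (simp add: mult.commute)
  qed
  have K: "0 \<le> K" using assms(2,3) order_trans by blast
  show ?thesis
  proof (rule lipschitz_onI[OF _ K])
    fix x y assume "x \<in> {a..b}" "y \<in> {a..b}"
    then show "dist (integral {a..x} v) (integral {a..y} v) \<le> K * dist x y"
      using *[of x y] *[of y x] by (cases "x \<le> y") (auto simp: dist_real_def abs_minus_commute)
  qed
qed

text \<open>Here \<open>q\<close> is the cosine of the spherical distance of the twisted point from
  the identity and \<open>p\<close> its rate of change. With y the imaginary part of the twisted
  first entry, 1 - q^2 equals \<open>(cmod B)^2\<close> + y^2, and Cauchy-Schwarz bounds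
  \<open>p\<close> by \<open>sqrt (1 + r^2) * cmod W\<close> times the root of that. A factor
  \<open>c < 1\<close> only shrinks the quotient.\<close>

lemma arccos_scaled_derivative_bound:
  fixes r :: real
  assumes c: "0 \<le> c" "c < 1" and AB: "(cmod A)\<^sup>2 + (cmod B)\<^sup>2 = 1"
    and p: "p = Re ((- B * cnj W) * cis \<theta>) - r * cmod W * Im (A * cis \<theta>)"
    and q: "q = Re (A * cis \<theta>)"
  shows "- (c * p) / sqrt (1 - (c * q)\<^sup>2) \<le> sqrt (1 + r\<^sup>2) * cmod W"
proof -
  define y where "y = Im (A * cis \<theta>)"
  have "q\<^sup>2 + y\<^sup>2 = (cmod (A * cis \<theta>))\<^sup>2" unfolding cmod_power2 q y_def ..
  then have qy: "1 - q\<^sup>2 = (cmod B)\<^sup>2 + y\<^sup>2" using AB by (simp add: norm_mult)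
  have q1: "q\<^sup>2 \<le> 1" using qy by (metis diff_ge_0_iff_ge sum_power2_ge_zero)
  have "\<bar>Re ((- B * cnj W) * cis \<theta>)\<bar> \<le> cmod B * cmod W"
    using abs_Re_le_cmod[of "(- B * cnj W) * cis \<theta>"] by (simp add: norm_mult)
  then have "\<bar>p\<bar> \<le> cmod B * cmod W + \<bar>r * cmod W * y\<bar>"
    unfolding p y_def[symmetric] by linarith
  also have "\<dots> = cmod W * (1 * cmod B + \<bar>r\<bar> * \<bar>y\<bar>)" by (simp add: abs_mult algebra_simps)
  also have "\<dots> \<le> cmod W * (sqrt (1 + r\<^sup>2) * sqrt (1 - q\<^sup>2))"
  proof (rule mult_left_mono)
    have "(1 * cmod B + \<bar>r\<bar> * \<bar>y\<bar>)\<^sup>2 \<le> (1 + r\<^sup>2) * ((cmod B)\<^sup>2 + y\<^sup>2)"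
      using sum_squares_ge_zero[of "\<bar>y\<bar> - \<bar>r\<bar> * cmod B" 0]
      by (simp add: power2_eq_square algebra_simps)
    then show "1 * cmod B + \<bar>r\<bar> * \<bar>y\<bar> \<le> sqrt (1 + r\<^sup>2) * sqrt (1 - q\<^sup>2)"
      unfolding qy real_sqrt_mult[symmetric] by (rule real_le_rsqrt)
  qed simp
  finally have pb: "\<bar>p\<bar> \<le> sqrt (1 + r\<^sup>2) * cmod W * sqrt (1 - q\<^sup>2)" by (simp add: mult_ac)
  have cq: "(c * q)\<^sup>2 \<le> q\<^sup>2" unfolding power_mult_distrib
    using c by (intro mult_left_le_one_le) (auto simp: power_le_one)
  have cc: "(c * q)\<^sup>2 < 1"
  proof -
    have "(c * q)\<^sup>2 \<le> c\<^sup>2" unfolding power_mult_distrib using q1 by (intro mult_right_le_one_le) auto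
    also have "c\<^sup>2 < 1" using c by (simp add: power_less_one_iff abs_square_less_1)
    finally show ?thesis .
  qed
  have "- (c * p) \<le> c * \<bar>p\<bar>" using c by (metis abs_ge_minus_self mult_left_mono mult_minus_right)
  also have "\<dots> \<le> 1 * \<bar>p\<bar>" using c by (intro mult_right_mono) auto
  also have "\<dots> \<le> sqrt (1 + r\<^sup>2) * cmod W * sqrt (1 - q\<^sup>2)" using pb by simp
  also have "\<dots> \<le> sqrt (1 + r\<^sup>2) * cmod W * sqrt (1 - (c * q)\<^sup>2)"
    using cq by (intro mult_left_mono) auto
  finally show ?thesis using cc by (subst pos_divide_le_eq) auto
qed

text \<open>Twisting a horizontal curve by the one-parameter group of \<open>k\<close>, run at \<open>r\<close> times the speed
  of the curve, gives a curve of length \<open>sqrt (1 + r^2) * l / 2\<close> in the round three-sphere; the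
  left hand side is the spherical distance between the end points of the twisted curve.\<close>

lemma horizontal_arccos_le_from_Id2:
  assumes hor: "horizontal \<gamma> a b" and ab: "a < b" and start: "\<gamma> a = Id2" and l: "l = hlength \<gamma> a b"
  shows "arccos (Re (\<gamma> b $ 1 $ 1 * cis (r * l / 2))) \<le> sqrt (1 + r\<^sup>2) * l / 2"
proof -
  note h = horizontalD[OF hor]
  obtain N W K where N: "negligible N" and
    W: "\<And>t. t \<in> {a..b} - N \<Longrightarrow> (\<gamma> has_vector_derivative \<gamma> t ** su 0 (W t)) (at t within {a..b})" and
    K: "\<And>t. cmod (W t) \<le> K" and int: "(\<lambda>t. 2 * cmod (W t)) integrable_on {a..b}" and
    len: "hlength \<gamma> a b = integral {a..b} (\<lambda>t. 2 * cmod (W t))"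
    using hor ab by (rule horizontal_velocity) (rule that)
  define A where "A t = \<gamma> t $ 1 $ 1" for t
  define B where "B t = \<gamma> t $ 1 $ 2" for t
  have \<gamma>: "\<gamma> t = su (A t) (B t)" and AB: "(cmod (A t))\<^sup>2 + (cmod (B t))\<^sup>2 = 1" if "t \<in> {a..b}" for t
    using h(2)[OF that] by (auto simp: A_def B_def elim!: SU2E)
  define s where "s t = integral {a..t} (\<lambda>t. 2 * cmod (W t))" for t
  obtain N2 where N2: "negligible N2" and s': "\<And>t. t \<in> {a..<b} - N2 \<Longrightarrow>
      (s has_vector_derivative 2 * cmod (W t)) (at t within {t..b})"
    using indefinite_integral_right_derivative[OF int] unfolding s_def by blast
  have sL: "(2 * K)-lipschitz_on {a..b} s"
    unfolding s_def by (rule lipschitz_on_indefinite_integral[OF int]) (use K in auto)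
  obtain C where C: "C-lipschitz_on {a..b} \<gamma>" using h by blast
  have AL: "C-lipschitz_on {a..b} A"
    unfolding A_def by (rule lipschitz_on_linear_image[OF bounded_linear_entry C])
      (rule order_trans[OF Finite_Cartesian_Product.norm_nth_le Finite_Cartesian_Product.norm_nth_le])
  have ReL: "C-lipschitz_on {a..b} (\<lambda>t. Re (A t))"
    by (rule lipschitz_on_linear_image[OF bounded_linear_Re AL]) (simp add: abs_Re_le_cmod)
  have ImL: "C-lipschitz_on {a..b} (\<lambda>t. Im (A t))"
    by (rule lipschitz_on_linear_image[OF bounded_linear_Im AL]) (simp add: abs_Im_le_cmod)
  \<comment> \<open>The real part of the first entry of the twisted curve, that is, the cosine of
    its spherical distance from the identity.\<close>
  define \<phi> where "\<phi> t = Re (A t) * cos (r * s t / 2) - Im (A t) * sin (r * s t / 2)" for t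
  have \<phi>: "\<phi> t = Re (A t * cis (r * s t / 2))" for t by (simp add: \<phi>_def)
  have A1: "cmod (A t) \<le> 1" if "t \<in> {a..b}" for t
    using AB[OF that] by (metis abs_square_le_1 abs_norm_cancel le_add_same_cancel1 zero_le_power2)
  have \<phi>1: "\<bar>\<phi> t\<bar> \<le> 1" if "t \<in> {a..b}" for t
    using abs_Re_le_cmod[of "A t * cis (r * s t / 2)"] A1[OF that] by (simp add: \<phi> norm_mult)
  have "\<exists>C. C-lipschitz_on {a..b} (\<lambda>t. cos (r * s t / 2))" "\<exists>C. C-lipschitz_on {a..b} (\<lambda>t. sin (r * s t / 2))"
  proof -
    have 1: "\<bar>r / 2 * sin y\<bar> \<le> \<bar>r / 2\<bar>" "\<bar>r / 2 * cos y\<bar> \<le> \<bar>r / 2\<bar>" for y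
      unfolding abs_mult by (intro mult_left_le; simp)+
    show "\<exists>C. C-lipschitz_on {a..b} (\<lambda>t. cos (r * s t / 2))"
      by (rule exI, rule lipschitz_on_comp_bounded_derivative[OF sL, where T=UNIV
            and h="\<lambda>y. cos (r * y / 2)" and h'="\<lambda>y. - (r/2 * sin (r * y / 2))" and D="\<bar>r/2\<bar>"])
        (use 1(1) in \<open>auto intro!: derivative_eq_intros\<close>)
    show "\<exists>C. C-lipschitz_on {a..b} (\<lambda>t. sin (r * s t / 2))"
      by (rule exI, rule lipschitz_on_comp_bounded_derivative[OF sL, where T=UNIV
            and h="\<lambda>y. sin (r * y / 2)" and h'="\<lambda>y. r/2 * cos (r * y / 2)" and D="\<bar>r/2\<bar>"])
        (use 1(2) in \<open>auto intro!: derivative_eq_intros\<close>)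
  qed
  then obtain C1 C2 where C12: "C1-lipschitz_on {a..b} (\<lambda>t. cos (r * s t / 2))"
      "C2-lipschitz_on {a..b} (\<lambda>t. sin (r * s t / 2))" by blast
  have reim: "\<bar>Re (A t)\<bar> \<le> 1" "\<bar>Im (A t)\<bar> \<le> 1" if "t \<in> {a..b}" for t
    using A1[OF that] abs_Re_le_cmod[of "A t"] abs_Im_le_cmod[of "A t"] by auto
  obtain L where \<phi>L: "L-lipschitz_on {a..b} \<phi>"
    unfolding \<phi>_def[abs_def]
    using lipschitz_on_diff[OF lipschitz_on_mult_unit_bounded[OF ReL C12(1)] lipschitz_on_mult_unit_bounded[OF ImL C12(2)]]
      reim by simp
  \<comment> \<open>The function arccos is not Lipschitz at 1, which is the value of
    \<open>\<phi>\<close> at the start. Scaling by \<open>c < 1\<close> keeps the argument away from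
    the end points of [-1, 1]; the limit \<open>c\<close> to 1 is taken at the end.\<close>
  have main: "arccos (c * \<phi> b) \<le> arccos c + sqrt (1 + r\<^sup>2) * l / 2" if c: "0 \<le> c" "c < 1" for c
  proof -
    define M where "M = sqrt (1 + r\<^sup>2) / 2"
    define F where "F t = arccos (c * \<phi> t) - M * s t" for t
    define p where "p t = Re ((- B t * cnj (W t)) * cis (r * s t / 2)) - r * cmod (W t) * Im (A t * cis (r * s t / 2))" for t
    define F' where "F' t = - (c * p t) / sqrt (1 - (c * \<phi> t)\<^sup>2) - M * (2 * cmod (W t))" for t
    have cL: "(c * L)-lipschitz_on {a..b} (\<lambda>t. c * \<phi> t)"
      using lipschitz_on_cmult_real[OF \<phi>L, of c] c by simp
    have c\<phi>: "c * \<phi> t \<in> {-c..c}" if "t \<in> {a..b}" for t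
    proof -
      have "\<bar>c * \<phi> t\<bar> \<le> c" unfolding abs_mult using \<phi>1[OF that] c by (simp add: mult_left_le)
      then show ?thesis by auto
    qed
    have c2: "c\<^sup>2 < 1" using c by (simp add: abs_square_less_1)
    have "(1 / sqrt (1 - c\<^sup>2) * (c * L))-lipschitz_on {a..b} (\<lambda>t. arccos (c * \<phi> t))"
    proof (rule lipschitz_on_comp_bounded_derivative[OF cL c\<phi>, where h' = "\<lambda>y. inverse (- sqrt (1 - y\<^sup>2))"])
      fix y assume y: "y \<in> {-c..c}"
      then show "(arccos has_real_derivative inverse (- sqrt (1 - y\<^sup>2))) (at y within {- c..c})"
        using c by (intro has_field_derivative_at_within[OF DERIV_arccos]) auto
      have "y\<^sup>2 \<le> c\<^sup>2" using y by (intro abs_le_square_iff[THEN iffD1]) auto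
      then have "1 / sqrt (1 - y\<^sup>2) \<le> 1 / sqrt (1 - c\<^sup>2)"
        using c2 by (intro divide_left_mono) auto
      then show "\<bar>inverse (- sqrt (1 - y\<^sup>2))\<bar> \<le> 1 / sqrt (1 - c\<^sup>2)"
        using \<open>y\<^sup>2 \<le> c\<^sup>2\<close> c2 by (simp add: divide_inverse)
    qed (use c2 in auto)
    moreover have "(M * (2 * K))-lipschitz_on {a..b} (\<lambda>t. M * s t)"
      using lipschitz_on_cmult_real[OF sL, of M] by (simp add: M_def)
    ultimately obtain L' where "L'-lipschitz_on {a..b} F"
      unfolding F_def[abs_def] using lipschitz_on_diff by blast
    \<comment> \<open>\<open>N\<close> removes the times without a horizontal velocity,
      \<open>N2\<close> those at which the arc length lacks the right derivative.\<close>
    moreover have "(F has_vector_derivative F' t) (at t within {t..b})" if t: "t \<in> {a..<b} - (N \<union> N2)" for t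
    proof -
      have t': "t \<in> {a..b}" using t by auto
      have "((\<lambda>t. \<gamma> t $ 1 $ 1) has_vector_derivative (\<gamma> t ** su 0 (W t)) $ 1 $ 1) (at t within {a..b})"
        by (rule bounded_linear.has_vector_derivative[OF bounded_linear_entry W]) (use t in auto)
      then have "(A has_vector_derivative (- B t * cnj (W t))) (at t within {a..b})"
        unfolding A_def[symmetric] \<gamma>[OF t'] su_0_mult_right su_nth .
      then have A': "(A has_vector_derivative (- B t * cnj (W t))) (at t within {t..b})"
        by (rule has_vector_derivative_within_subset) (use t in auto)
      note Re' = bounded_linear.has_vector_derivative[OF bounded_linear_Re A']
      note Im' = bounded_linear.has_vector_derivative[OF bounded_linear_Im A']
      have "(s has_vector_derivative 2 * cmod (W t)) (at t within {t..b})" using t by (intro s') auto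
      note d = Re'[folded has_real_derivative_iff_has_vector_derivative]
          Im'[folded has_real_derivative_iff_has_vector_derivative]
          this[folded has_real_derivative_iff_has_vector_derivative]
      have \<theta>': "((\<lambda>t. r * s t / 2) has_real_derivative r * (2 * cmod (W t)) / 2) (at t within {t..b})"
        by (rule DERIV_cdivide[OF DERIV_cmult[OF d(3)]])
      have "(\<phi> has_real_derivative p t) (at t within {t..b})"
        unfolding \<phi>_def[abs_def]
        by (rule DERIV_cong[OF DERIV_diff[OF DERIV_mult[OF d(1) DERIV_chain2[OF DERIV_cos \<theta>']]
                DERIV_mult[OF d(2) DERIV_chain2[OF DERIV_sin \<theta>']]]])
          (simp add: p_def algebra_simps)
      moreover have "- 1 < c * \<phi> t" "c * \<phi> t < 1" using c\<phi>[OF t'] c by auto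
      ultimately have "((\<lambda>t. arccos (c * \<phi> t)) has_real_derivative
          inverse (- sqrt (1 - (c * \<phi> t)\<^sup>2)) * (c * p t)) (at t within {t..b})"
        by (intro DERIV_chain2[OF DERIV_arccos] DERIV_cmult)
      then have "(F has_real_derivative F' t) (at t within {t..b})"
        unfolding F_def[abs_def]
        by (rule DERIV_cong[OF DERIV_diff[OF _ DERIV_cmult[OF d(3)]]])
          (simp add: F'_def divide_inverse mult.commute)
      then show ?thesis by (simp add: has_real_derivative_iff_has_vector_derivative)
    qed
    ultimately have "(F' has_integral (F b - F a)) {a..b}"
      using h(1) N N2 by (intro lipschitz_has_integral_right_derivative[of a b L' F "N \<union> N2"]) auto
    moreover have "F' t \<le> 0" if "t \<in> {a..b}" for t
      using arccos_scaled_derivative_bound[OF c AB[OF that] p_def \<phi>] by (simp add: F'_def M_def)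
    ultimately have "F b - F a \<le> 0"
      using has_integral_le[of F' "F b - F a" "{a..b}" "\<lambda>_. 0" 0] by simp
    moreover have "s a = 0" "s b = l" by (simp_all add: s_def l len)
    moreover have "\<phi> a = 1" using start \<open>s a = 0\<close> by (simp add: \<phi>_def A_def Id2_eq_su)
    ultimately show ?thesis by (simp add: F_def M_def)
  qed
  define c where "c n = real n / real (Suc n)" for n
  have c: "0 \<le> c n" "c n < 1" for n by (auto simp: c_def)
  have clim: "c \<longlonglongrightarrow> 1" unfolding c_def by (rule LIMSEQ_n_over_Suc_n)
  have \<phi>b: "\<bar>\<phi> b\<bar> \<le> 1" using \<phi>1 ab by simp
  have cn: "c n * \<phi> b \<in> {-1..1}" for n
  proof -
    have "\<bar>c n * \<phi> b\<bar> \<le> 1" unfolding abs_mult using c[of n] \<phi>b by (intro mult_le_one) auto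
    then show ?thesis by auto
  qed
  have "(\<lambda>n. arccos (c n * \<phi> b)) \<longlonglongrightarrow> arccos (1 * \<phi> b)"
    by (rule continuous_on_tendsto_compose[OF continuous_on_arccos' tendsto_mult[OF clim tendsto_const]])
      (use \<phi>b cn in auto)
  moreover have "(\<lambda>n. arccos (c n) + sqrt (1 + r\<^sup>2) * l / 2) \<longlonglongrightarrow> arccos 1 + sqrt (1 + r\<^sup>2) * l / 2"
    by (intro tendsto_add tendsto_const continuous_on_tendsto_compose[OF continuous_on_arccos' clim])
      (use c in \<open>auto intro!: always_eventually simp: less_imp_le order_trans[of _ 0]\<close>)
  ultimately have "arccos (1 * \<phi> b) \<le> arccos 1 + sqrt (1 + r\<^sup>2) * l / 2"
    by (rule LIMSEQ_le) (use main c in auto)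
  moreover have "s b = l" by (simp add: s_def l len)
  ultimately show ?thesis by (simp add: \<phi> A_def)
qed

lemma horizontal_arccos_le:
  assumes hor: "horizontal \<gamma> a b" and l: "l = hlength \<gamma> a b"
  shows "arccos (Re ((matrix_inv (\<gamma> a) ** \<gamma> b) $ 1 $ 1 * cis (r * l / 2))) \<le> sqrt (1 + r\<^sup>2) * l / 2"
proof (cases "a = b")
  case True
  moreover have "\<gamma> b \<in> SU2" using horizontalD[OF hor] by auto
  ultimately show ?thesis using l by (simp add: matrix_inv_SU2 mat_1_eq_su hlength_def)
next
  case False
  then have ab: "a < b" using horizontalD[OF hor] by simp
  have g: "\<gamma> a \<in> SU2" using horizontalD[OF hor] by simp
  note t = horizontal_translate[OF hor matrix_inv_SU2(1)[OF g] Id2_in_Z4]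
  have "matrix_inv (\<gamma> a) ** \<gamma> a ** Id2 = Id2" by (simp add: matrix_inv_SU2[OF g] Id2_def)
  from horizontal_arccos_le_from_Id2[OF t(1) ab this, of l r] t(2) l
  show ?thesis by (simp add: Id2_def)
qed

section \<open>Geodesics\<close>

text \<open>\<open>geoA c t\<close> and \<open>geoB c u t\<close> form the first row of \<open>exp (t (X + c k)) exp (- t c k)\<close>, where
  \<open>X\<close> is the element of \<open>p\<close> with entry \<open>u / 2\<close> in the upper right corner and \<open>cmod u = 1\<close>.\<close>

definition geoA :: "real \<Rightarrow> real \<Rightarrow> complex" where
  "geoA c t = Complex (cos (sqrt (1 + c\<^sup>2) * t / 2)) (c / sqrt (1 + c\<^sup>2) * sin (sqrt (1 + c\<^sup>2) * t / 2)) * cis (- (c * t / 2))"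

definition geoB :: "real \<Rightarrow> complex \<Rightarrow> real \<Rightarrow> complex" where
  "geoB c u t = u * (of_real (sin (sqrt (1 + c\<^sup>2) * t / 2) / sqrt (1 + c\<^sup>2)) * cis (c * t / 2))"

definition geo :: "real \<Rightarrow> complex \<Rightarrow> real \<Rightarrow> cmat" where
  "geo c u t = su (geoA c t) (geoB c u t)"

lemma sqrt_1_plus_square_pos: "sqrt (1 + c\<^sup>2) > 0"
  by (simp add: add_pos_nonneg)

lemma geo_0: "geo c u 0 = Id2"
  by (simp add: geo_def geoA_def geoB_def Id2_eq_su complex_eq_iff)

lemma geoB_norm: "cmod u = 1 \<Longrightarrow> cmod (geoB c u t) = \<bar>sin (sqrt (1 + c\<^sup>2) * t / 2)\<bar> / sqrt (1 + c\<^sup>2)"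
  unfolding geoB_def norm_mult norm_of_real norm_cis abs_divide
  by (simp add: abs_of_pos[OF sqrt_1_plus_square_pos])

lemma geo_SU2:
  assumes "cmod u = 1"
  shows "(cmod (geoA c t))\<^sup>2 + (cmod (geoB c u t))\<^sup>2 = 1" "geo c u t \<in> SU2"
proof -
  define w where "w = sqrt (1 + c\<^sup>2)"
  have w: "w > 0" "w\<^sup>2 = 1 + c\<^sup>2" using sqrt_1_plus_square_pos by (simp_all add: w_def)
  have "(cmod (geoA c t))\<^sup>2 = (cos (w * t / 2))\<^sup>2 + c\<^sup>2 / w\<^sup>2 * (sin (w * t / 2))\<^sup>2"
    by (simp add: geoA_def norm_mult w_def[symmetric] cmod_power2 power_mult_distrib power_divide)
  moreover have "(cmod (geoB c u t))\<^sup>2 = (sin (w * t / 2))\<^sup>2 / w\<^sup>2"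
    using geoB_norm[OF assms, of c t] by (simp add: w_def[symmetric] power_divide)
  moreover have "c\<^sup>2 / w\<^sup>2 * (sin (w * t / 2))\<^sup>2 + (sin (w * t / 2))\<^sup>2 / w\<^sup>2
      = (sin (w * t / 2))\<^sup>2"
  proof -
    have "(1 + c\<^sup>2) / w\<^sup>2 = 1" using w by (metis divide_self power_not_zero less_irrefl)
    moreover have "c\<^sup>2 / w\<^sup>2 * (sin (w * t / 2))\<^sup>2 + (sin (w * t / 2))\<^sup>2 / w\<^sup>2
        = (1 + c\<^sup>2) / w\<^sup>2 * (sin (w * t / 2))\<^sup>2"
      by (simp add: add_divide_distrib distrib_right)
    ultimately show ?thesis by (simp only: mult_1)
  qed
  ultimately show 1: "(cmod (geoA c t))\<^sup>2 + (cmod (geoB c u t))\<^sup>2 = 1"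
    using sin_cos_squared_add[of "w * t / 2"] by linarith
  then show "geo c u t \<in> SU2" by (simp add: geo_def su_in_SU2_iff)
qed

lemma has_vector_derivative_su:
  assumes "(f has_vector_derivative f') (at t within S)" "(g has_vector_derivative g') (at t within S)"
  shows "((\<lambda>t. su (f t) (g t)) has_vector_derivative su f' g') (at t within S)"
proof -
  have "linear (\<lambda>(p, q). su p q)"
    by (rule linearI) (auto simp: su_add su_scaleR scaleR_conv_of_real[where 'a=complex])
  then have "bounded_linear (\<lambda>(p, q). su p q)" by (rule linear_conv_bounded_linear[THEN iffD1])
  from bounded_linear.has_vector_derivative[OF this has_vector_derivative_Pair[OF assms]]
  show ?thesis by simp
qed

lemma complex_has_vector_derivativeI:
  assumes "((\<lambda>t. Re (f t)) has_real_derivative Re f') F" "((\<lambda>t. Im (f t)) has_real_derivative Im f') F"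
  shows "(f has_vector_derivative f') F"
  using assms unfolding has_real_derivative_iff_has_vector_derivative has_vector_derivative_complex_iff by simp

lemma has_vector_derivative_cis_mult:
  "((\<lambda>t. cis (k * t)) has_vector_derivative \<i> * of_real k * cis (k * t)) (at t)"
  by (intro complex_has_vector_derivativeI) (auto intro!: derivative_eq_intros)

text \<open>The control is X conjugated by \<open>exp (t c k)\<close>: a vector of length 1 in
  \<open>p\<close> that rotates with angular velocity \<open>c\<close>.\<close>

lemma geo_velocity:
  assumes "cmod u = 1"
  shows "(geo c u has_vector_derivative geo c u t ** su 0 (u * cis (c * t) / 2)) (at t)"
proof -
  define w where "w = sqrt (1 + c\<^sup>2)"
  have w: "w > 0" "w * w = 1 + c * c"
    using sqrt_1_plus_square_pos by (simp_all add: w_def power2_eq_square)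
  have uu: "u * cnj u = 1" using assms by (metis complex_norm_square of_real_1 power_one)
  define S where "S = sin (w * t / 2)"
  define C where "C = cos (w * t / 2)"
  define E where "E = cis (c / 2 * t)"
  define E' where "E' = cis (- (c / 2) * t)"
  have EE: "cnj (cis (c * t)) * E = E'" "E' * cis (c * t) = E" "E' = cnj E"
    by (simp_all add: E_def E'_def cis_cnj cis_mult)
  have A: "geoA c = (\<lambda>t. Complex (cos (w * t / 2)) (c / w * sin (w * t / 2)) * cis (- (c / 2) * t))"
    by (simp add: geoA_def[abs_def] w_def)
  have B: "geoB c u = (\<lambda>t. u * (of_real (sin (w * t / 2) / w) * cis (c / 2 * t)))"
    by (simp add: geoB_def[abs_def] w_def)
  have P: "((\<lambda>t. Complex (cos (w * t / 2)) (c / w * sin (w * t / 2)))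
      has_vector_derivative Complex (- (w / 2 * S)) (c / 2 * C)) (at t)"
    using w(1) unfolding S_def C_def
    by (intro complex_has_vector_derivativeI) (auto intro!: derivative_eq_intros)
  have Q: "((\<lambda>t. of_real (sin (w * t / 2) / w) :: complex)
      has_vector_derivative of_real (C / 2)) (at t)"
    using w(1) unfolding C_def
    by (intro complex_has_vector_derivativeI) (auto intro!: derivative_eq_intros)
  have A': "(geoA c has_vector_derivative of_real (- S / (2 * w)) * E') (at t)"
    unfolding A
  proof (rule has_vector_derivative_eq_rhs[OF has_vector_derivative_mult[OF P has_vector_derivative_cis_mult]])
    have "Complex C (c / w * S) * (\<i> * of_real (- (c / 2))) + Complex (- (w / 2 * S)) (c / 2 * C) = of_real (- S / (2 * w))"
      using w by (simp add: complex_eq_iff field_simps)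
    then show "Complex (cos (w * t / 2)) (c / w * sin (w * t / 2)) * (\<i> * of_real (- (c / 2)) * cis (- (c / 2) * t))
        + Complex (- (w / 2 * S)) (c / 2 * C) * cis (- (c / 2) * t) = of_real (- S / (2 * w)) * E'"
      unfolding C_def[symmetric] S_def[symmetric] E'_def[symmetric] by (simp only: mult.assoc[symmetric] distrib_right[symmetric])
  qed
  have B': "(geoB c u has_vector_derivative u * (Complex (C / 2) (c / (2 * w) * S) * E)) (at t)"
    unfolding B
  proof (rule has_vector_derivative_eq_rhs[OF
        has_vector_derivative_mult[OF has_vector_derivative_const has_vector_derivative_mult[OF Q has_vector_derivative_cis_mult]]])
    have "of_real (S / w) * (\<i> * of_real (c / 2)) + of_real (C / 2) = Complex (C / 2) (c / (2 * w) * S)"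
      using w by (simp add: complex_eq_iff field_simps)
    then show "u * (of_real (sin (w * t / 2) / w) * (\<i> * of_real (c / 2) * cis (c / 2 * t)) + of_real (C / 2) * cis (c / 2 * t))
        + 0 * (of_real (sin (w * t / 2) / w) * cis (c / 2 * t)) = u * (Complex (C / 2) (c / (2 * w) * S) * E)"
      unfolding C_def[symmetric] S_def[symmetric] E_def[symmetric] mult_zero_left add_0_right
      by (simp only: mult.assoc[symmetric] distrib_right[symmetric])
  qed
  have "geo c u t ** su 0 (u * cis (c * t) / 2)
      = su (- (geoB c u t) * cnj (u * cis (c * t) / 2)) (geoA c t * (u * cis (c * t) / 2))"
    unfolding geo_def su_0_mult_right ..
  also have "- (geoB c u t) * cnj (u * cis (c * t) / 2) = - (u * cnj u) * of_real (S / w) * (cnj (cis (c * t)) * E) / 2"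
    unfolding B S_def[symmetric] E_def[symmetric] by (simp add: mult_ac)
  also have "\<dots> = of_real (- S / (2 * w)) * E'"
    unfolding EE uu by simp
  also have "geoA c t * (u * cis (c * t) / 2) = u * (Complex C (c / w * S) / 2 * (E' * cis (c * t)))"
    unfolding A C_def[symmetric] S_def[symmetric] E'_def[symmetric] by (simp add: mult_ac)
  also have "Complex C (c / w * S) / 2 = Complex (C / 2) (c / (2 * w) * S)"
    using w by (simp add: complex_eq_iff field_simps)
  finally have e: "geo c u t ** su 0 (u * cis (c * t) / 2)
      = su (of_real (- S / (2 * w)) * E') (u * (Complex (C / 2) (c / (2 * w) * S) * E))"
    unfolding EE(2) .
  have "(geo c u has_vector_derivative
      su (of_real (- S / (2 * w)) * E') (u * (Complex (C / 2) (c / (2 * w) * S) * E))) (at t)"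
    using has_vector_derivative_su[OF A' B'] by (simp only: geo_def[abs_def])
  then show ?thesis by (simp only: e)
qed

lemma geo_lipschitz:
  assumes "cmod u = 1"
  shows "1-lipschitz_on S (geo c u)"
proof (rule lipschitz_on_subset[of _ UNIV])
  have "norm (geo c u t ** su 0 (u * cis (c * t) / 2)) \<le> 1" for t
  proof -
    have "(norm (su p q))\<^sup>2 = 2 * ((cmod p)\<^sup>2 + (cmod q)\<^sup>2)" for p q
      by (simp add: norm_vec_def L2_set_def sum_2)
    then have "(norm (geo c u t ** su 0 (u * cis (c * t) / 2)))\<^sup>2
        = ((cmod (geoA c t))\<^sup>2 + (cmod (geoB c u t))\<^sup>2) / 2"
      by (simp add: geo_def su_0_mult_right norm_mult norm_divide assms power_divide)
    also have "\<dots> \<le> 1" using geo_SU2(1)[OF assms] by simp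
    finally show ?thesis by (simp add: abs_square_le_1)
  qed
  then show "1-lipschitz_on UNIV (geo c u)"
    using geo_velocity[OF assms, of c]
    by (intro bounded_derivative_imp_lipschitz[where f' = "\<lambda>t h. h *\<^sub>R (geo c u t ** su 0 (u * cis (c * t) / 2))"])
      (auto simp: has_vector_derivative_def onorm_scaleR_left onorm_id intro!: onorm_le)
qed simp

lemma geo_horizontal:
  assumes u: "cmod u = 1" and ab: "a \<le> b"
  shows "horizontal (geo c u) a b" "hlength (geo c u) a b = b - a"
proof -
  have d: "(geo c u has_vector_derivative geo c u t ** su 0 (u * cis (c * t) / 2)) (at t within {a..b})" for t
    by (rule has_vector_derivative_at_within[OF geo_velocity[OF u]])
  show "horizontal (geo c u) a b"
    by (rule horizontalI[OF ab geo_SU2(2)[OF u] geo_lipschitz[OF u] negligible_empty d])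
  show "hlength (geo c u) a b = b - a"
    using hlength_eq[OF ab geo_SU2(2)[OF u] negligible_empty d] ab u by (simp add: norm_mult norm_divide)
qed

text \<open>The family is closed under restarting at a later time: translated back to the identity,
  a subarc has the same \<open>c\<close> and its initial direction is the control at time
  \<open>s\<close>. This allows local minimality to be checked with formulas for arcs from the
  identity.\<close>

lemma geo_difference:
  assumes u: "cmod u = 1"
  shows "matrix_inv (geo c u s) ** geo c u t = geo c (u * cis (c * s)) (t - s)"
proof -
  define w where "w = sqrt (1 + c\<^sup>2)"
  have w: "w > 0" "w * w = 1 + c * c"
    using sqrt_1_plus_square_pos by (simp_all add: w_def power2_eq_square)
  have uu: "u * cnj u = 1" using u by (metis complex_norm_square of_real_1 power_one)
  define E where "E t = cis (c * t / 2)" for t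
  have cE: "cis (- (c * t / 2)) = cnj (E t)" for t by (simp add: E_def cis_cnj)
  have E1: "E s * cnj (E t) = cnj (E (t - s))"
    by (simp add: E_def cis_cnj cis_mult diff_divide_distrib right_diff_distrib)
  have E2: "E s * E t = cis (c * s) * E (t - s)"
    by (simp add: E_def cis_mult field_simps)
  define P where "P t = Complex (cos (w * t / 2)) (c / w * sin (w * t / 2))" for t
  define Q where "Q t = sin (w * t / 2) / w" for t
  have A: "geoA c t = P t * cnj (E t)" for t
    by (simp only: geoA_def P_def w_def cE)
  have B: "geoB c v t = v * (of_real (Q t) * E t)" for v t
    by (simp only: geoB_def Q_def w_def E_def)
  have arg: "w * (t - s) / 2 = w * t / 2 - w * s / 2" by (simp add: field_simps)
  have "c * c / (w * w) + 1 / (w * w) = (1 + c * c) / (w * w)" by (simp add: add_divide_distrib)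
  also have "\<dots> = 1" using w by (metis divide_self mult_eq_0_iff less_irrefl)
  finally have "c * c / (w * w) + 1 / (w * w) = 1" .
  then have k: "cos x * cos y + c * c / (w * w) * (sin x * sin y) + 1 / (w * w) * (sin x * sin y) = cos (y - x)" for x y
    unfolding cos_diff by (metis (no_types) add.assoc distrib_right mult_1 mult.commute)
  have PQ1: "cnj (P s) * P t + of_real (Q s * Q t) = P (t - s)"
    using k[of "w * s / 2" "w * t / 2"] unfolding P_def Q_def arg
    by (simp add: complex_eq_iff sin_diff algebra_simps add_divide_distrib diff_divide_distrib)
  have PQ2: "cnj (P s) * of_real (Q t) - of_real (Q s) * cnj (P t) = of_real (Q (t - s))"
    unfolding P_def Q_def arg
    by (simp add: complex_eq_iff sin_diff diff_divide_distrib algebra_simps)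
  have "cnj (geoA c s) * geoA c t + geoB c u s * cnj (geoB c u t)
      = (cnj (P s) * P t + (u * cnj u) * of_real (Q s * Q t)) * (E s * cnj (E t))"
    unfolding A B by (simp add: algebra_simps)
  also have "\<dots> = geoA c (t - s)" unfolding uu E1 A using PQ1 by simp
  finally have 1: "cnj (geoA c s) * geoA c t + geoB c u s * cnj (geoB c u t) = geoA c (t - s)" .
  have "cnj (geoA c s) * geoB c u t - geoB c u s * cnj (geoA c t)
      = u * (cnj (P s) * of_real (Q t) - of_real (Q s) * cnj (P t)) * (E s * E t)"
    unfolding A B by (simp add: algebra_simps)
  also have "\<dots> = geoB c (u * cis (c * s)) (t - s)" unfolding PQ2 E2 B by (simp add: mult_ac)
  finally have 2: "cnj (geoA c s) * geoB c u t - geoB c u s * cnj (geoA c t) = geoB c (u * cis (c * s)) (t - s)" .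
  show ?thesis
    unfolding geo_def matrix_inv_su[OF geo_SU2(1)[OF u]] su_mult
    using 1 2 by (simp add: mult.commute)
qed

text \<open>Equality case of the triangle inequality on the unit sphere. The vector y on the right
  has norm \<open>sin \<theta>\<close>, while the two angle bounds and the addition formula give an
  inner product of x and y of at least \<open>sin \<theta>\<close>; hence equality in
  Cauchy-Schwarz.\<close>

lemma spherical_segment_unique:
  fixes x e f :: "'a::real_inner"
  assumes n: "norm x = 1" "norm e = 1" "norm f = 1" and ef: "e \<bullet> f = cos \<theta>"
    and \<theta>: "0 < \<theta>" "\<theta> < pi" and \<tau>: "0 \<le> \<tau>" "\<tau> \<le> \<theta>"
    and xe: "x \<bullet> e \<ge> cos \<tau>" and xf: "x \<bullet> f \<ge> cos (\<theta> - \<tau>)"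
  shows "sin \<theta> *\<^sub>R x = sin (\<theta> - \<tau>) *\<^sub>R e + sin \<tau> *\<^sub>R f"
proof -
  define p where "p = sin (\<theta> - \<tau>)"
  define q where "q = sin \<tau>"
  define y where "y = p *\<^sub>R e + q *\<^sub>R f"
  have pq: "0 \<le> p" "0 \<le> q" unfolding p_def q_def using \<theta> \<tau> by (auto intro!: sin_ge_zero)
  have s\<theta>: "sin \<theta> = p * cos \<tau> + q * cos (\<theta> - \<tau>)"
    using sin_add[of "\<theta> - \<tau>" \<tau>] by (simp add: p_def q_def mult.commute)
  have c\<theta>: "cos \<theta> = cos (\<theta> - \<tau>) * cos \<tau> - p * q"
    using cos_add[of "\<theta> - \<tau>" \<tau>] by (simp add: p_def q_def)
  have i: "x \<bullet> x = 1" "e \<bullet> e = 1" "f \<bullet> f = 1" using n by (simp_all add: dot_square_norm)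
  have "p * cos \<tau> + q * cos (\<theta> - \<tau>) \<le> p * (x \<bullet> e) + q * (x \<bullet> f)"
    using pq xe xf by (intro add_mono mult_left_mono) auto
  then have xy: "sin \<theta> \<le> x \<bullet> y" by (simp add: s\<theta> y_def inner_add_right)
  have pp: "p\<^sup>2 = 1 - (cos (\<theta> - \<tau>))\<^sup>2" "q\<^sup>2 = 1 - (cos \<tau>)\<^sup>2"
    by (simp_all add: p_def q_def sin_squared_eq)
  have "y \<bullet> y = p\<^sup>2 + q\<^sup>2 + 2 * (p * q) * cos \<theta>"
    by (simp add: y_def inner_add_left inner_add_right i ef inner_commute[of f e] power2_eq_square algebra_simps)
  also have "\<dots> = (p * cos \<tau> + q * cos (\<theta> - \<tau>))\<^sup>2"
    unfolding c\<theta> using pp by algebra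
  finally have yy: "y \<bullet> y = (sin \<theta>)\<^sup>2" by (simp only: s\<theta>)
  have "(norm (sin \<theta> *\<^sub>R x - y))\<^sup>2 = 2 * ((sin \<theta>)\<^sup>2 - sin \<theta> * (x \<bullet> y))"
    unfolding power2_norm_eq_inner
    by (simp add: inner_diff_left inner_diff_right yy i inner_commute[of y x] power2_eq_square algebra_simps)
  also have "\<dots> \<le> 0"
    using mult_left_mono[OF xy, of "sin \<theta>"] \<theta> by (simp add: power2_eq_square sin_ge_zero)
  finally have "sin \<theta> *\<^sub>R x - y = 0" by simp
  then show ?thesis by (simp add: y_def p_def q_def)
qed

section \<open>Optimality of the arcs up to the antipode\<close>

lemma cos_le_of_arccos_le:
  assumes "arccos y \<le> x" "\<bar>y\<bar> \<le> 1" "x \<le> pi"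
  shows "cos x \<le> y"
proof -
  have "cos x \<le> cos (arccos y)"
    using assms arccos_lbound[of y] by (intro cos_monotone_0_pi_le) auto
  then show ?thesis using assms by (simp add: cos_arccos_abs)
qed

lemma SU2_entry_Re_cis_le:
  assumes "g \<in> SU2"
  shows "\<bar>Re (g $ 1 $ 1 * cis x)\<bar> \<le> 1"
proof -
  obtain a b where ab: "g = su a b" "(cmod a)\<^sup>2 + (cmod b)\<^sup>2 = 1" using assms by (rule SU2E)
  then have "(cmod a)\<^sup>2 \<le> 1" by (metis le_add_same_cancel1 zero_le_power2)
  then have "cmod a \<le> 1" by (simp add: abs_square_le_1)
  then show ?thesis using abs_Re_le_cmod[of "a * cis x"] by (simp add: ab norm_mult)
qed

lemma geoA_twisted: "geoA c t * cis (c * t / 2)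
    = Complex (cos (sqrt (1 + c\<^sup>2) * t / 2)) (c / sqrt (1 + c\<^sup>2) * sin (sqrt (1 + c\<^sup>2) * t / 2))"
  by (simp add: geoA_def mult.assoc cis_mult)

text \<open>A first entry with real part 1 forces the second to vanish. For t > 0 this can only
  happen at the antipode, where the first entry is \<open>- cis (- (c * t / 2))\<close> with an
  angle of modulus less than pi, so its real part is not 1.\<close>

lemma geoA_eq_1D:
  assumes "Re (geoA c t) = 1" "0 \<le> t" "sqrt (1 + c\<^sup>2) * t \<le> 2 * pi"
  shows "t = 0"
proof (rule ccontr)
  assume "t \<noteq> 0"
  then have t: "t > 0" using assms by simp
  define w where "w = sqrt (1 + c\<^sup>2)"
  have w: "w > 0" using sqrt_1_plus_square_pos by (simp add: w_def)
  have "cmod (geoA c t) \<ge> 1" using assms(1) abs_Re_le_cmod[of "geoA c t"] by simp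
  then have "(cmod (geoA c t))\<^sup>2 \<ge> 1" by simp
  then have "(cmod (geoB c 1 t))\<^sup>2 \<le> 0" using geo_SU2(1)[OF norm_one, of c t] by linarith
  then have "sin (w * t / 2) = 0" using w geoB_norm[of 1 c t] by (simp add: w_def[symmetric])
  moreover have "0 < w * t / 2" "w * t / 2 \<le> pi" using w t assms(3) by (simp_all add: w_def)
  ultimately have wt: "w * t / 2 = pi" using sin_gt_zero[of "w * t / 2"] by force
  have e: "geoA c t = - cis (- (c * t / 2))"
    by (simp add: geoA_def w_def[symmetric] wt complex_eq_iff)
  have "\<bar>c\<bar> < w" unfolding w_def by (simp add: real_less_rsqrt)
  then have "\<bar>c * t / 2\<bar> < pi" using t wt mult_strict_right_mono[of "\<bar>c\<bar>" w "t/2"] by (simp add: abs_mult)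
  then have "cos (c * t / 2) > cos pi"
    using cos_monotone_0_pi[of "\<bar>c * t / 2\<bar>" pi] unfolding cos_abs_real by simp
  then show False using assms(1) by (simp add: e)
qed

text \<open>A competitor of length l is twisted so that its end point agrees in the first entry with
  the end point of the twisted arc, at spherical distance \<open>sqrt (1 + c^2) * T / 2\<close>. The
  bound on \<open>T\<close> keeps this at most pi, where arccos inverts cos.\<close>

lemma geo_time_le_hlength:
  assumes hor: "horizontal \<gamma> a b" and T: "0 \<le> T" "sqrt (1 + c\<^sup>2) * T \<le> 2 * pi"
    and e: "(matrix_inv (\<gamma> a) ** \<gamma> b) $ 1 $ 1 = geoA c T"
  shows "T \<le> hlength \<gamma> a b"
proof -
  define l where "l = hlength \<gamma> a b"
  note h = horizontalD[OF hor]
  define w where "w = sqrt (1 + c\<^sup>2)"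
  have g: "matrix_inv (\<gamma> a) ** \<gamma> b \<in> SU2" using h by (auto intro!: SU2_mult matrix_inv_SU2)
  have l0: "l \<ge> 0" unfolding l_def using hor by (rule hlength_nonneg)
  show ?thesis unfolding l_def[symmetric]
  proof (cases "l = 0")
    case True
    have "arccos (Re ((matrix_inv (\<gamma> a) ** \<gamma> b) $ 1 $ 1 * cis 0)) \<le> 0"
      using horizontal_arccos_le[OF hor l_def, of 0] True by simp
    then have "cos 0 \<le> Re ((matrix_inv (\<gamma> a) ** \<gamma> b) $ 1 $ 1 * cis 0)"
      by (rule cos_le_of_arccos_le[OF _ SU2_entry_Re_cis_le[OF g]]) simp
    then have "1 \<le> Re (geoA c T)" by (simp add: e)
    moreover have "Re (geoA c T) \<le> 1" using SU2_entry_Re_cis_le[OF g, of 0] by (simp add: e)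
    ultimately have "T = 0" using geoA_eq_1D T by force
    then show "T \<le> l" using l0 by simp
  next
    case False
    then have l: "l > 0" using l0 by simp
    define r where "r = c * T / l"
    have rl: "r * l / 2 = c * T / 2" using l by (simp add: r_def)
    have "arccos (cos (w * T / 2)) \<le> sqrt (1 + r\<^sup>2) * l / 2"
      using horizontal_arccos_le[OF hor l_def, of r] unfolding e rl geoA_twisted by (simp add: w_def)
    moreover have "0 \<le> w * T / 2" "w * T / 2 \<le> pi" using T by (simp_all add: w_def)
    ultimately have "w * T \<le> sqrt (1 + r\<^sup>2) * l" by (simp add: arccos_cos)
    then have "(w * T)\<^sup>2 \<le> (sqrt (1 + r\<^sup>2) * l)\<^sup>2"
      using T by (intro power_mono) (auto simp: w_def)
    then have "(1 + c\<^sup>2) * T\<^sup>2 \<le> (1 + r\<^sup>2) * l\<^sup>2" by (simp add: power_mult_distrib w_def)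
    moreover have "(r * l)\<^sup>2 = (c * T)\<^sup>2" using l by (simp add: r_def)
    ultimately have "T\<^sup>2 \<le> l\<^sup>2" by (simp add: power_mult_distrib algebra_simps)
    then show "T \<le> l" using l0 by (rule power2_le_imp_le)
  qed
qed

section \<open>Every point is reached by an arc\<close>

lemma geo_parameter:
  assumes "-1 < \<rho>" "\<rho> < 1" "0 < x"
  obtains c T where "0 < T" "sqrt (1 + c\<^sup>2) * T = 2 * x" "geoA c T = Complex (cos x) (\<rho> * sin x) * cis (- (\<rho> * x))"
    "\<And>u. geoB c u T = u * (of_real (sin x * sqrt (1 - \<rho>\<^sup>2)) * cis (\<rho> * x))"
proof -
  define v where "v = sqrt (1 - \<rho>\<^sup>2)"
  have "\<rho>\<^sup>2 < 1" using assms by (simp add: abs_square_less_1)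
  then have v: "v > 0" "v\<^sup>2 = 1 - \<rho>\<^sup>2" by (simp_all add: v_def)
  \<comment> \<open>These choices invert \<open>\<rho> = c / sqrt (1 + c^2)\<close> and
    \<open>x = sqrt (1 + c^2) * T / 2\<close>.\<close>
  define c where "c = \<rho> / v"
  define T where "T = 2 * x * v"
  have "1 + c\<^sup>2 = (1 / v)\<^sup>2" using v by (simp add: c_def power_divide field_simps)
  then have w: "sqrt (1 + c\<^sup>2) = 1 / v" using v by (simp only: real_sqrt_abs) simp
  show ?thesis
  proof (rule that[of T c])
    show "0 < T" using assms v by (simp add: T_def)
    show "sqrt (1 + c\<^sup>2) * T = 2 * x" using v by (simp add: w T_def)
    show "geoA c T = Complex (cos x) (\<rho> * sin x) * cis (- (\<rho> * x))"
      unfolding geoA_def w using v by (simp add: T_def c_def)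
    show "geoB c u T = u * (of_real (sin x * sqrt (1 - \<rho>\<^sup>2)) * cis (\<rho> * x))" for u
      unfolding geoB_def w v_def[symmetric] using v by (simp add: T_def c_def)
  qed
qed

text \<open>Here \<open>x\<close> is the length of the twisted curve and \<open>\<rho> = c / sqrt (1 + c^2)\<close>. Along the
  curve \<open>sin x * sqrt (1 - \<rho>^2) = r\<close> with \<open>\<rho> \<ge> 0\<close>, the argument of the first entry moves continuously
  from \<open>0\<close> to \<open>pi\<close>.\<close>

lemma geo_angle_exists_upper:
  assumes n: "(cmod \<alpha>)\<^sup>2 + r\<^sup>2 = 1" and r: "0 < r" and im: "0 \<le> Im \<alpha>"
  shows "\<exists>x \<rho>. 0 < x \<and> x \<le> pi \<and> -1 < \<rho> \<and> \<rho> < 1 \<and> sin x * sqrt (1 - \<rho>\<^sup>2) = r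
     \<and> Complex (cos x) (\<rho> * sin x) * cis (- (\<rho> * x)) = \<alpha>"
proof (cases "\<alpha> = 0")
  \<comment> \<open>There is no argument to match here; the point halfway to the antipode on an arc
    with c = 0 serves.\<close>
  case True
  then have "r = 1" using n r by (simp add: power2_eq_1_iff)
  then show ?thesis using True by (intro exI[of _ "pi/2"] exI[of _ 0]) (simp add: complex_eq_iff)
next
  case False
  define R where "R = cmod \<alpha>"
  have R: "R > 0" "R\<^sup>2 = 1 - r\<^sup>2" using False n by (simp_all add: R_def)
  have r1: "r < 1"
  proof -
    have "r\<^sup>2 < 1" using R by (metis diff_gt_0_iff_gt zero_less_power)
    then show ?thesis using r by (simp add: abs_square_less_1)
  qed
  \<comment> \<open>Between \<open>x0\<close> and \<open>pi - x0\<close> the sine is at least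
    \<open>r\<close>, which is where some \<open>\<rho>\<close> gives the second entry the
    prescribed modulus.\<close>
  define x0 where "x0 = arcsin r"
  have x0: "sin x0 = r" "cos x0 = R" using r r1 R by (simp_all add: x0_def cos_arcsin) (metis abs_of_pos real_sqrt_abs)
  have x0b: "0 < x0" "x0 < pi / 2"
    using r r1 arcsin_less_arcsin[of 0 r] arcsin_less_arcsin[of r 1] by (simp_all add: x0_def)
  have sin_ge: "r \<le> sin x" if "x0 \<le> x" "x \<le> pi - x0" for x
  proof (cases "x \<le> pi / 2")
    case True
    then show ?thesis using that x0b sin_monotone_2pi_le[of x0 x] x0 by simp
  next
    case False
    then show ?thesis using that x0b sin_monotone_2pi_le[of x0 "pi - x"] x0 by simp
  qed
  have cos_le: "\<bar>cos x / R\<bar> \<le> 1" if "x0 \<le> x" "x \<le> pi - x0" for x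
  proof -
    have "r\<^sup>2 \<le> (sin x)\<^sup>2" using sin_ge[OF that] r by (intro power_mono) auto
    then have "(cos x)\<^sup>2 \<le> R\<^sup>2" using R sin_cos_squared_add[of x] by linarith
    then have "\<bar>cos x\<bar> \<le> R" using R(1) abs_le_square_iff[of "cos x" R] by simp
    then show ?thesis using R by simp
  qed
  define \<rho> where "\<rho> x = sqrt (1 - (r / sin x)\<^sup>2)" for x
  \<comment> \<open>The argument of the first entry. At both ends \<open>\<rho>\<close> vanishes, so
    the values there are arccos 1 and arccos (-1).\<close>
  define f where "f x = arccos (cos x / R) - \<rho> x * x" for x
  have f0: "f x0 = 0" "f (pi - x0) = pi" using R r by (simp_all add: f_def \<rho>_def x0)
  have arg: "0 \<le> Arg \<alpha>" "Arg \<alpha> \<le> pi" using im False Arg_bounded[of \<alpha>] by (simp_all add: Arg_less_0)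
  have bd: "\<forall>x\<in>{x0..pi - x0}. - 1 \<le> cos x / R \<and> cos x / R \<le> 1" "\<forall>x\<in>{x0..pi - x0}. sin x \<noteq> 0"
    using cos_le sin_ge r unfolding abs_le_iff by fastforce+
  have "continuous_on {x0..pi - x0} f"
    unfolding f_def \<rho>_def
    by (intro continuous_intros) (use R bd in auto)
  then obtain x where x: "x0 \<le> x" "x \<le> pi - x0" and fx: "f x = Arg \<alpha>"
    using IVT'[of f x0 "Arg \<alpha>" "pi - x0"] f0 arg x0b by force
  have s: "sin x \<ge> r" "sin x > 0" using sin_ge[OF x] r by auto
  have rs: "0 < r / sin x" "r / sin x \<le> 1" using s r by simp_all
  then have rs2: "0 < (r / sin x)\<^sup>2" "(r / sin x)\<^sup>2 \<le> 1" by (auto simp: power_le_one zero_less_power)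
  have \<rho>b: "0 \<le> \<rho> x" "\<rho> x < 1" using rs2 by (simp_all add: \<rho>_def)
  have \<rho>2: "(\<rho> x)\<^sup>2 = 1 - (r / sin x)\<^sup>2" using rs2 by (simp add: \<rho>_def)
  have "sin x * sqrt (1 - (\<rho> x)\<^sup>2) = r"
    unfolding \<rho>2 using rs s r by simp
  moreover have "Complex (cos x) (\<rho> x * sin x) = of_real R * cis (arccos (cos x / R))"
  proof -
    have "R * sin (arccos (cos x / R)) = \<rho> x * sin x"
    proof -
      have "(R * sin (arccos (cos x / R)))\<^sup>2 = R\<^sup>2 * (1 - (cos x / R)\<^sup>2)"
        using cos_le[OF x] by (simp add: power_mult_distrib sin_squared_eq cos_arccos_abs)
      also have "\<dots> = R\<^sup>2 - (cos x)\<^sup>2" using R(1) by (simp add: power_divide right_diff_distrib)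
      also have "\<dots> = (sin x)\<^sup>2 - r\<^sup>2" using R sin_cos_squared_add[of x] by linarith
      also have "\<dots> = (\<rho> x * sin x)\<^sup>2" using s by (simp add: power_mult_distrib \<rho>2 power_divide left_diff_distrib)
      finally have sq: "(R * sin (arccos (cos x / R)))\<^sup>2 = (\<rho> x * sin x)\<^sup>2" .
      have "0 \<le> arccos (cos x / R)" "arccos (cos x / R) \<le> pi"
        using cos_le[OF x] by (auto simp only: abs_le_iff intro!: arccos_lbound arccos_ubound)
      then show ?thesis
        using sq R(1) s \<rho>b
        by (intro power2_eq_imp_eq[of "R * sin (arccos (cos x / R))"]) (auto intro!: mult_nonneg_nonneg sin_ge_zero)
    qed
    then show ?thesis using R cos_le[OF x] by (simp add: complex_eq_iff cos_arccos_abs)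
  qed
  then have "Complex (cos x) (\<rho> x * sin x) * cis (- (\<rho> x * x)) = of_real R * cis (f x)"
    by (simp add: f_def cis_mult mult.assoc)
  moreover have "of_real R * cis (f x) = \<alpha>"
    unfolding fx R_def using rcis_cmod_Arg[of \<alpha>] by (simp add: rcis_def)
  ultimately show ?thesis using x x0b \<rho>b by (intro exI[of _ x] exI[of _ "\<rho> x"]) auto
qed

text \<open>For r = 0 the arc has to run to the antipode, x = pi, where the first entry is
  \<open>cis (pi - \<rho> * pi)\<close>; as \<open>\<rho>\<close> runs through (-1, 1) this covers
  the unit circle without 1. The lower half plane follows by conjugation, which changes the sign of
  \<open>\<rho>\<close>.\<close>

lemma geo_angle_exists:
  assumes n: "(cmod \<alpha>)\<^sup>2 + r\<^sup>2 = 1" and r: "0 \<le> r" and \<alpha>: "\<alpha> \<noteq> 1"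
  shows "\<exists>x \<rho>. 0 < x \<and> x \<le> pi \<and> -1 < \<rho> \<and> \<rho> < 1 \<and> sin x * sqrt (1 - \<rho>\<^sup>2) = r
     \<and> Complex (cos x) (\<rho> * sin x) * cis (- (\<rho> * x)) = \<alpha>"
proof (cases "r = 0")
  case True
  then have "cmod \<alpha> = 1" using n by (simp add: power2_eq_1_iff) (metis norm_ge_zero not_one_le_zero neg_0_le_iff_le)
  then have p: "cis (Arg2pi \<alpha>) = \<alpha>" using Arg2pi_eq[of \<alpha>] by (simp add: cis_conv_exp)
  define \<rho> where "\<rho> = 1 - Arg2pi \<alpha> / pi"
  have "Arg2pi \<alpha> \<noteq> 0" using p \<alpha> by auto
  then have "0 < Arg2pi \<alpha>" "Arg2pi \<alpha> < 2 * pi" using Arg2pi_ge_0[of \<alpha>] Arg2pi_lt_2pi[of \<alpha>] by simp_all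
  then have "-1 < \<rho>" "\<rho> < 1" by (simp_all add: \<rho>_def field_simps)
  moreover have "Complex (cos pi) (\<rho> * sin pi) * cis (- (\<rho> * pi)) = \<alpha>"
  proof -
    have "Complex (cos pi) (\<rho> * sin pi) = cis pi" by (simp add: complex_eq_iff)
    moreover have "pi + - (\<rho> * pi) = Arg2pi \<alpha>" by (simp add: \<rho>_def field_simps)
    ultimately show ?thesis using p by (simp only: cis_mult)
  qed
  ultimately show ?thesis using True by (intro exI[of _ pi] exI[of _ \<rho>]) simp
next
  case False
  then have r: "0 < r" using r by simp
  show ?thesis
  proof (cases "0 \<le> Im \<alpha>")
    case True
    then show ?thesis using geo_angle_exists_upper[OF n r] by blast
  next
    case False
    have "(cmod (cnj \<alpha>))\<^sup>2 + r\<^sup>2 = 1" using n by simp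
    from geo_angle_exists_upper[OF this r] False obtain x \<rho> where x: "0 < x" "x \<le> pi" "-1 < \<rho>" "\<rho> < 1"
        "sin x * sqrt (1 - \<rho>\<^sup>2) = r" and e: "Complex (cos x) (\<rho> * sin x) * cis (- (\<rho> * x)) = cnj \<alpha>"
      by auto
    have "Complex (cos x) (- \<rho> * sin x) * cis (- (- \<rho> * x)) = \<alpha>"
      using arg_cong[OF e, of cnj] by (simp add: complex_eq_iff)
    then show ?thesis using x by (intro exI[of _ x] exI[of _ "- \<rho>"]) auto
  qed
qed

lemma geo_exists:
  assumes n: "(cmod \<alpha>)\<^sup>2 + (cmod \<beta>)\<^sup>2 = 1" and \<alpha>: "\<alpha> \<noteq> 1"
  obtains c u T where "0 < T" "cmod u = 1" "sqrt (1 + c\<^sup>2) * T \<le> 2 * pi" "geo c u T = su \<alpha> \<beta>"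
proof -
  obtain x \<rho> where x: "0 < x" "x \<le> pi" "-1 < \<rho>" "\<rho> < 1" and b: "sin x * sqrt (1 - \<rho>\<^sup>2) = cmod \<beta>"
    and a: "Complex (cos x) (\<rho> * sin x) * cis (- (\<rho> * x)) = \<alpha>"
    using geo_angle_exists[OF n norm_ge_zero \<alpha>] by blast
  obtain c T where T: "0 < T" "sqrt (1 + c\<^sup>2) * T = 2 * x" and A: "geoA c T = \<alpha>"
    and B: "\<And>u. geoB c u T = u * (of_real (cmod \<beta>) * cis (\<rho> * x))"
    using geo_parameter[OF x(3,4,1)] a b by metis
  define u where "u = (if \<beta> = 0 then 1 else sgn \<beta> * cis (- (\<rho> * x)))"
  have "cmod u = 1" by (simp add: u_def norm_mult norm_sgn)
  moreover have "geoB c u T = \<beta>"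
  proof (cases "\<beta> = 0")
    case False
    have "geoB c u T = of_real (cmod \<beta>) * sgn \<beta> * (cis (- (\<rho> * x)) * cis (\<rho> * x))"
      unfolding B using False by (simp add: u_def mult_ac)
    also have "\<dots> = \<beta>" using False by (simp add: cis_mult sgn_eq)
    finally show ?thesis .
  qed (simp add: B)
  ultimately show ?thesis using that[of T u c] T x A by (simp add: geo_def)
qed

section \<open>Minimizers and the distance on the group\<close>

text \<open>The first row of \<open>g\<close> multiplied on the right by \<open>exp (t c k)\<close>.
  As a pair in C^2 with the real inner product, elements of \<open>SU2\<close> lie on the unit
  three-sphere, without the factor sqrt 2 of the matrix norm.\<close>

definition twist :: "real \<Rightarrow> real \<Rightarrow> cmat \<Rightarrow> complex \<times> complex" where
  "twist c t g = (g $ 1 $ 1 * cis (c * t / 2), g $ 1 $ 2 * cis (- (c * t / 2)))"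

lemma norm_twist: "g \<in> SU2 \<Longrightarrow> norm (twist c t g) = 1"
  by (elim SU2E) (simp add: twist_def norm_Pair norm_mult)

lemma inner_twist:
  assumes "g \<in> SU2" "h \<in> SU2"
  shows "twist c s g \<bullet> twist c t h = Re ((matrix_inv g ** h) $ 1 $ 1 * cis (c * (t - s) / 2))"
proof -
  obtain a b where g: "g = su a b" "(cmod a)\<^sup>2 + (cmod b)\<^sup>2 = 1" using assms(1) by (rule SU2E)
  obtain p q where h: "h = su p q" using assms(2) by (rule SU2E)
  have i: "x \<bullet> y = Re (cnj x * y)" "x \<bullet> y = Re (x * cnj y)" for x y :: complex
    by (simp_all add: inner_complex_def)
  have e: "cnj (cis (c * s / 2)) * cis (c * t / 2) = cis (c * (t - s) / 2)"
    "cis (- (c * s / 2)) * cnj (cis (- (c * t / 2))) = cis (c * (t - s) / 2)"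
    by (simp_all add: cis_cnj cis_mult right_diff_distrib diff_divide_distrib)
  have "twist c s g \<bullet> twist c t h = Re (cnj (a * cis (c * s / 2)) * (p * cis (c * t / 2)))
      + Re (b * cis (- (c * s / 2)) * cnj (q * cis (- (c * t / 2))))"
    unfolding twist_def g h inner_Pair su_nth i(1)[of "a * _"] i(2)[of "b * _"] ..
  also have "cnj (a * cis (c * s / 2)) * (p * cis (c * t / 2)) = cnj a * p * cis (c * (t - s) / 2)"
    unfolding e(1)[symmetric] by (simp add: mult_ac)
  also have "b * cis (- (c * s / 2)) * cnj (q * cis (- (c * t / 2))) = b * cnj q * cis (c * (t - s) / 2)"
    unfolding e(2)[symmetric] by (simp add: mult_ac)
  finally show ?thesis using g(2) by (simp add: g h matrix_inv_su su_mult algebra_simps)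
qed

lemma inner_twist_ge:
  assumes hor: "horizontal \<gamma> s t" and len: "hlength \<gamma> s t = t - s" and le: "sqrt (1 + c\<^sup>2) * (t - s) / 2 \<le> pi"
  shows "twist c s (\<gamma> s) \<bullet> twist c t (\<gamma> t) \<ge> cos (sqrt (1 + c\<^sup>2) * (t - s) / 2)"
proof -
  note h = horizontalD[OF hor]
  then have S: "\<gamma> s \<in> SU2" "\<gamma> t \<in> SU2" by auto
  show ?thesis unfolding inner_twist[OF S]
    using horizontal_arccos_le[OF hor len[symmetric], of c] le
    by (intro cos_le_of_arccos_le SU2_entry_Re_cis_le SU2_mult matrix_inv_SU2 S) auto
qed

text \<open>Equality in \<open>horizontal_arccos_le\<close>: the twisted curve runs along the unique great circle
  arc between its end points, which are not antipodal.\<close>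

lemma minimizer_twisted:
  assumes hor: "horizontal \<gamma> 0 T" and start: "\<gamma> 0 = Id2"
    and len: "\<And>s t. 0 \<le> s \<Longrightarrow> s \<le> t \<Longrightarrow> t \<le> T \<Longrightarrow> hlength \<gamma> s t = t - s"
    and e: "\<gamma> T $ 1 $ 1 = geoA c T" and T: "0 < T" "sqrt (1 + c\<^sup>2) * T < 2 * pi"
    and t: "0 \<le> t" "t \<le> T"
  defines "w \<equiv> sqrt (1 + c\<^sup>2)"
  shows "sin (w * T / 2) *\<^sub>R twist c t (\<gamma> t) = sin (w * T / 2 - w * t / 2) *\<^sub>R twist c 0 Id2
      + sin (w * t / 2) *\<^sub>R twist c T (\<gamma> T)"
proof (rule spherical_segment_unique)
  have w: "w > 0" using sqrt_1_plus_square_pos by (simp add: w_def)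
  have wt: "w * t \<le> w * T" using w t by simp
  have S: "\<gamma> t \<in> SU2" "\<gamma> T \<in> SU2" using horizontalD[OF hor] t by auto
  show "norm (twist c t (\<gamma> t)) = 1" "norm (twist c 0 Id2) = 1" "norm (twist c T (\<gamma> T)) = 1"
    by (rule norm_twist S Id2_in_SU2)+
  have "matrix_inv Id2 = Id2" by (simp add: Id2_eq_su matrix_inv_su)
  then show "twist c 0 Id2 \<bullet> twist c T (\<gamma> T) = cos (w * T / 2)"
    unfolding inner_twist[OF Id2_in_SU2 S(2)] using geoA_twisted[of c T] e by (simp add: Id2_def w_def)
  show "0 < w * T / 2" "w * T / 2 < pi" using w T by (simp_all add: w_def)
  show "0 \<le> w * t / 2" "w * t / 2 \<le> w * T / 2" using w t wt by simp_all
  have le: "w * t / 2 \<le> pi" "w * (T - t) / 2 \<le> pi"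
  proof -
    have "w * (T - t) \<le> w * T" using w t by (intro mult_left_mono) auto
    moreover have "w * T < 2 * pi" using T by (simp add: w_def)
    ultimately show "w * t / 2 \<le> pi" "w * (T - t) / 2 \<le> pi" using wt by auto
  qed
  \<comment> \<open>Applied to the two subarcs, the spherical bound says that the angles from the
    twisted point to the two ends add up to at most \<open>w * T / 2\<close>, the angle between the
    ends themselves.\<close>
  have "twist c 0 (\<gamma> 0) \<bullet> twist c t (\<gamma> t) \<ge> cos (sqrt (1 + c\<^sup>2) * (t - 0) / 2)"
    by (rule inner_twist_ge[OF horizontal_restrict[OF hor]]) (use t len le in \<open>auto simp: w_def\<close>)
  then show "cos (w * t / 2) \<le> twist c t (\<gamma> t) \<bullet> twist c 0 Id2"
    by (simp add: start w_def inner_commute)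
  have "twist c t (\<gamma> t) \<bullet> twist c T (\<gamma> T) \<ge> cos (sqrt (1 + c\<^sup>2) * (T - t) / 2)"
    by (rule inner_twist_ge[OF horizontal_restrict[OF hor]]) (use t len le in \<open>auto simp: w_def\<close>)
  then show "cos (w * T / 2 - w * t / 2) \<le> twist c t (\<gamma> t) \<bullet> twist c T (\<gamma> T)"
    by (simp add: w_def[symmetric] right_diff_distrib diff_divide_distrib)
qed

lemma twist_inject:
  assumes "g \<in> SU2" "h \<in> SU2" "twist c t g = twist c t h"
  shows "g = h"
  using assms by (elim SU2E) (auto simp: twist_def)

lemma minimizer_unique:
  assumes hor: "horizontal \<gamma> 0 T" "horizontal \<delta> 0 T" and start: "\<gamma> 0 = Id2" "\<delta> 0 = Id2"
    and len: "\<And>s t. 0 \<le> s \<Longrightarrow> s \<le> t \<Longrightarrow> t \<le> T \<Longrightarrow> hlength \<gamma> s t = t - s"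
     "\<And>s t. 0 \<le> s \<Longrightarrow> s \<le> t \<Longrightarrow> t \<le> T \<Longrightarrow> hlength \<delta> s t = t - s"
    and e: "\<gamma> T $ 1 $ 1 = geoA c T" "\<delta> T = \<gamma> T" and T: "0 < T" "sqrt (1 + c\<^sup>2) * T < 2 * pi"
    and t: "t \<in> {0..T}"
  shows "\<gamma> t = \<delta> t"
proof (rule twist_inject)
  show "\<gamma> t \<in> SU2" "\<delta> t \<in> SU2" using horizontalD hor t by blast+
  have t': "0 \<le> t" "t \<le> T" using t by auto
  \<comment> \<open>Here the time is strictly before the antipode, so the sine is nonzero and the
    great circle formula determines the twisted point.\<close>
  have "sin (sqrt (1 + c\<^sup>2) * T / 2) \<noteq> 0"
    using T sqrt_1_plus_square_pos sin_gt_zero[of "sqrt (1 + c\<^sup>2) * T / 2"] by simp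
  moreover have "sin (sqrt (1 + c\<^sup>2) * T / 2) *\<^sub>R twist c t (\<gamma> t)
      = sin (sqrt (1 + c\<^sup>2) * T / 2) *\<^sub>R twist c t (\<delta> t)"
    using minimizer_twisted[OF hor(1) start(1) len(1) e(1) T t'] minimizer_twisted[OF hor(2) start(2) len(2) _ T t'] e
    by simp
  ultimately show "twist c t (\<gamma> t) = twist c t (\<delta> t)" by simp
qed

text \<open>Rotating \<open>u\<close> rotates the second entry, whose modulus is already fixed by
  the first.\<close>

lemma geo_with_first_entry:
  assumes "g \<in> SU2" "g $ 1 $ 1 = geoA c T"
  obtains u where "cmod u = 1" "geo c u T = g"
proof -
  obtain a b where g: "g = su a b" "(cmod a)\<^sup>2 + (cmod b)\<^sup>2 = 1" using assms(1) by (rule SU2E)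
  have sc: "geoB c u T = u * geoB c 1 T" for u by (simp add: geoB_def)
  have a: "a = geoA c T" using assms g by simp
  have "(cmod b)\<^sup>2 = (cmod (geoB c 1 T))\<^sup>2" using geo_SU2(1)[OF norm_one, of c T] g(2)[unfolded a] by linarith
  then have n: "cmod b = cmod (geoB c 1 T)" by (simp add: power2_eq_iff_nonneg)
  define u where "u = (if b = 0 then 1 else b / geoB c 1 T)"
  have "cmod u = 1" "u * geoB c 1 T = b" using n by (auto simp: u_def norm_divide)
  then show ?thesis using that[of u] g a sc[of u] by (simp add: geo_def)
qed

text \<open>The infimum defining the distance is a minimum, attained by a translated arc, and its
  value can be read off from the first entry of the difference.\<close>

lemma sr_dist_geoA:
  assumes gh: "g \<in> SU2" "h \<in> SU2" and T: "0 \<le> T" "sqrt (1 + c\<^sup>2) * T \<le> 2 * pi"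
    and e: "(matrix_inv g ** h) $ 1 $ 1 = geoA c T"
  shows "sr_dist g h = T" "\<exists>\<gamma>. horizontal \<gamma> 0 T \<and> \<gamma> 0 = g \<and> \<gamma> T = h \<and> hlength \<gamma> 0 T = T"
proof -
  have "matrix_inv g ** h \<in> SU2" by (intro SU2_mult matrix_inv_SU2 gh)
  then obtain u where u: "cmod u = 1" "geo c u T = matrix_inv g ** h"
    using e by (rule geo_with_first_entry)
  note t = horizontal_translate[OF geo_horizontal(1)[OF u(1) T(1)] gh(1) Id2_in_Z4]
  define \<gamma> where "\<gamma> = (\<lambda>t. g ** geo c u t ** Id2)"
  have \<gamma>: "horizontal \<gamma> 0 T \<and> \<gamma> 0 = g \<and> \<gamma> T = h \<and> hlength \<gamma> 0 T = T"
    using t[folded \<gamma>_def] geo_horizontal(2)[OF u(1) T(1), of c] u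
    by (simp add: \<gamma>_def geo_0 Id2_def SU2_inv_mult_cancel gh)
  then show "\<exists>\<gamma>. horizontal \<gamma> 0 T \<and> \<gamma> 0 = g \<and> \<gamma> T = h \<and> hlength \<gamma> 0 T = T" by blast
  show "sr_dist g h = T" unfolding sr_dist_def
  proof (rule cInf_eq_minimum)
    show "T \<in> {hlength \<gamma> a b |\<gamma> a b. horizontal \<gamma> a b \<and> \<gamma> a = g \<and> \<gamma> b = h}"
      using \<gamma> by (metis (mono_tags, lifting) mem_Collect_eq)
    fix x assume "x \<in> {hlength \<gamma> a b |\<gamma> a b. horizontal \<gamma> a b \<and> \<gamma> a = g \<and> \<gamma> b = h}"
    then show "T \<le> x" using geo_time_le_hlength[OF _ T] e by blast
  qed
qed

lemma SU2_inv_mult_eq_1D: "g \<in> SU2 \<Longrightarrow> h \<in> SU2 \<Longrightarrow> (matrix_inv g ** h) $ 1 $ 1 = 1 \<Longrightarrow> g = h"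
proof -
  assume gh: "g \<in> SU2" "h \<in> SU2" and e: "(matrix_inv g ** h) $ 1 $ 1 = 1"
  have "matrix_inv g ** h \<in> SU2" by (intro SU2_mult matrix_inv_SU2 gh)
  then obtain a b where "matrix_inv g ** h = su a b" "(cmod a)\<^sup>2 + (cmod b)\<^sup>2 = 1" by (rule SU2E)
  then have "matrix_inv g ** h = mat 1" using e by (simp add: mat_1_eq_su)
  then show "g = h" using SU2_inv_mult_cancel(2)[OF gh(1), of h] by simp
qed

text \<open>Existence of minimizers without a compactness argument: every difference is reached by
  an arc within its optimal range, so the distance is the time of that arc.\<close>

lemma sr_dist_parameters:
  assumes gh: "g \<in> SU2" "h \<in> SU2"
  obtains c where "0 \<le> sr_dist g h" "sqrt (1 + c\<^sup>2) * sr_dist g h \<le> 2 * pi"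
    "(matrix_inv g ** h) $ 1 $ 1 = geoA c (sr_dist g h)" "sr_dist g h = 0 \<longleftrightarrow> g = h"
proof (cases "(matrix_inv g ** h) $ 1 $ 1 = 1")
  case True
  then have "(matrix_inv g ** h) $ 1 $ 1 = geoA 0 0" by (simp add: geoA_def complex_eq_iff)
  moreover from this have "sr_dist g h = 0" by (intro sr_dist_geoA(1)[OF gh]) auto
  ultimately show ?thesis using that[of 0] SU2_inv_mult_eq_1D[OF gh True] by simp
next
  case False
  have "matrix_inv g ** h \<in> SU2" by (intro SU2_mult matrix_inv_SU2 gh)
  then obtain a b where m: "matrix_inv g ** h = su a b" and n: "(cmod a)\<^sup>2 + (cmod b)\<^sup>2 = 1" by (rule SU2E)
  have a: "a \<noteq> 1" using False m by simp
  obtain c u T where T: "0 < T" "cmod u = 1" "sqrt (1 + c\<^sup>2) * T \<le> 2 * pi" "geo c u T = su a b"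
    using geo_exists[OF n a] by blast
  have e: "(matrix_inv g ** h) $ 1 $ 1 = geoA c T" using T(4) m by (simp add: geo_def)
  have "g \<noteq> h" using False gh by (auto simp: matrix_inv_SU2 mat_1_eq_su)
  moreover have "sr_dist g h = T" using T e by (intro sr_dist_geoA(1)[OF gh]) auto
  ultimately show ?thesis using that[of c] T e by simp
qed

lemma sr_dist_attained:
  assumes gh: "g \<in> SU2" "h \<in> SU2"
  obtains \<gamma> where "horizontal \<gamma> 0 (sr_dist g h)" "\<gamma> 0 = g" "\<gamma> (sr_dist g h) = h"
    "hlength \<gamma> 0 (sr_dist g h) = sr_dist g h"
  using sr_dist_parameters[OF gh] sr_dist_geoA(2)[OF gh] by metis

lemma sr_dist_eq_0_iff: "g \<in> SU2 \<Longrightarrow> h \<in> SU2 \<Longrightarrow> sr_dist g h = 0 \<longleftrightarrow> g = h"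
  using sr_dist_parameters by metis

lemma sr_dist_le_hlength:
  assumes "horizontal \<gamma> a b"
  shows "sr_dist (\<gamma> a) (\<gamma> b) \<le> hlength \<gamma> a b"
proof -
  have S: "\<gamma> a \<in> SU2" "\<gamma> b \<in> SU2" using horizontalD[OF assms] by auto
  obtain c where "0 \<le> sr_dist (\<gamma> a) (\<gamma> b)" "sqrt (1 + c\<^sup>2) * sr_dist (\<gamma> a) (\<gamma> b) \<le> 2 * pi"
    "(matrix_inv (\<gamma> a) ** \<gamma> b) $ 1 $ 1 = geoA c (sr_dist (\<gamma> a) (\<gamma> b))"
    using sr_dist_parameters[OF S] by metis
  then show ?thesis by (rule geo_time_le_hlength[OF assms])
qed

lemma geoA_uminus: "geoA (- c) t = cnj (geoA c t)"
  by (simp add: geoA_def complex_eq_iff)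

text \<open>Conjugating the first entry amounts to replacing \<open>c\<close> by \<open>- c\<close>,
  which changes neither the time nor its bound. Symmetry of the distance and invariance under
  \<open>Z4\<close> are both instances.\<close>

lemma sr_dist_cong_first_entry:
  assumes S: "g \<in> SU2" "h \<in> SU2" "g' \<in> SU2" "h' \<in> SU2"
    and e: "(matrix_inv g' ** h') $ 1 $ 1 = (matrix_inv g ** h) $ 1 $ 1
      \<or> (matrix_inv g' ** h') $ 1 $ 1 = cnj ((matrix_inv g ** h) $ 1 $ 1)"
  shows "sr_dist g' h' = sr_dist g h"
proof -
  obtain c where c: "0 \<le> sr_dist g h" "sqrt (1 + c\<^sup>2) * sr_dist g h \<le> 2 * pi"
    "(matrix_inv g ** h) $ 1 $ 1 = geoA c (sr_dist g h)" using sr_dist_parameters[OF S(1,2)] by metis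
  from e show ?thesis
  proof
    assume "(matrix_inv g' ** h') $ 1 $ 1 = (matrix_inv g ** h) $ 1 $ 1"
    then show ?thesis using sr_dist_geoA(1)[OF S(3,4) c(1,2)] c(3) by simp
  next
    assume "(matrix_inv g' ** h') $ 1 $ 1 = cnj ((matrix_inv g ** h) $ 1 $ 1)"
    then have "(matrix_inv g' ** h') $ 1 $ 1 = geoA (- c) (sr_dist g h)" using c(3) by (simp add: geoA_uminus)
    then show ?thesis using sr_dist_geoA(1)[OF S(3,4) c(1), of "- c"] c(2) by simp
  qed
qed

lemma sr_dist_commute:
  assumes "g \<in> SU2" "h \<in> SU2"
  shows "sr_dist h g = sr_dist g h"
proof (rule sr_dist_cong_first_entry[OF assms assms(2,1)], rule disjI2)
  show "(matrix_inv h ** g) $ 1 $ 1 = cnj ((matrix_inv g ** h) $ 1 $ 1)"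
    using assms by (elim SU2E) (simp add: matrix_inv_su su_mult mult.commute)
qed

lemma sr_dist_right_Z4:
  assumes S: "g \<in> SU2" "h \<in> SU2" and z: "z \<in> Z4"
  shows "sr_dist (g ** z) (h ** z) = sr_dist g h"
proof (rule sr_dist_cong_first_entry[OF S])
  have zS: "z \<in> SU2" using z Z4_subset_SU2 by blast
  show "g ** z \<in> SU2" "h ** z \<in> SU2" by (intro SU2_mult S zS)+
  have "matrix_inv g ** h \<in> SU2" by (intro SU2_mult matrix_inv_SU2 S)
  then obtain a b where ab: "matrix_inv g ** h = su a b" by (rule SU2E)
  have "matrix_inv (g ** z) ** (h ** z) = matrix_inv z ** (matrix_inv g ** h) ** z"
    by (simp add: matrix_inv_mult_SU2[OF S(1) zS] matrix_mul_assoc)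
  then have "matrix_inv (g ** z) ** (h ** z) = matrix_inv z ** su a b ** z" by (simp only: ab)
  \<comment> \<open>The central elements 1 and -1 leave \<open>a\<close> fixed; the other two
    elements conjugate it.\<close>
  moreover have "(matrix_inv z ** su a b ** z) $ 1 $ 1 = a \<or> (matrix_inv z ** su a b ** z) $ 1 $ 1 = cnj a"
    using z by (auto simp: Z4_def matrix_inv_su su_mult complex_eq_iff)
  ultimately show "(matrix_inv (g ** z) ** (h ** z)) $ 1 $ 1 = (matrix_inv g ** h) $ 1 $ 1 \<or>
      (matrix_inv (g ** z) ** (h ** z)) $ 1 $ 1 = cnj ((matrix_inv g ** h) $ 1 $ 1)"
    by (simp add: ab)
qed

text \<open>Passes from distances between \<open>g\<close> and the fibre of the identity, as in
  \<open>K_sym\<close>, to distances between the identity and the fibre of \<open>g\<close>, as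
  needed for curves starting at \<open>Id2\<close>.\<close>

lemma sr_dist_right_Z4_inv:
  assumes "g \<in> SU2" "z \<in> Z4"
  shows "sr_dist g z = sr_dist Id2 (g ** matrix_inv z)"
proof -
  have z: "z \<in> SU2" "matrix_inv z \<in> Z4" using assms Z4_subset_SU2 Z4_inv by auto
  have "sr_dist g z = sr_dist (g ** matrix_inv z) (z ** matrix_inv z)"
    using sr_dist_right_Z4[OF assms(1) z] by simp
  also have "\<dots> = sr_dist (g ** matrix_inv z) Id2" using z by (simp add: matrix_inv_SU2 Id2_def)
  also have "\<dots> = sr_dist Id2 (g ** matrix_inv z)"
    using z assms Z4_subset_SU2 by (intro sr_dist_commute Id2_in_SU2 SU2_mult) auto
  finally show ?thesis .
qed

section \<open>The quotient\<close>

text \<open>Unique lifting for a covering: the quotient of two lifts is continuous with values in a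
  finite set, hence constant on an interval.\<close>

lemma cls_lift_unique:
  assumes hor: "horizontal \<gamma> a b" "horizontal \<delta> a b"
    and eq: "\<And>t. t \<in> {a..b} \<Longrightarrow> cls (\<gamma> t) = cls (\<delta> t)"
  obtains z where "z \<in> Z4" "\<And>t. t \<in> {a..b} \<Longrightarrow> \<delta> t = \<gamma> t ** z"
proof -
  have c: "continuous_on {a..b} \<eta>" if "horizontal \<eta> a b" for \<eta>
    using horizontalD(3)[OF that] lipschitz_on_continuous_on by blast
  have c': "continuous_on {a..b} (\<lambda>t. \<eta> t $ i $ j)" if "horizontal \<eta> a b" for \<eta> i j
    using c[OF that] by (intro continuous_intros)
  \<comment> \<open>The first row of \<open>matrix_inv (\<gamma> t) ** \<delta> t\<close>, written
    as a polynomial in the entries so that continuity is evident.\<close>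
  define p where "p t = (cnj (\<gamma> t $ 1 $ 1) * \<delta> t $ 1 $ 1 + \<gamma> t $ 1 $ 2 * cnj (\<delta> t $ 1 $ 2),
      cnj (\<gamma> t $ 1 $ 1) * \<delta> t $ 1 $ 2 - \<gamma> t $ 1 $ 2 * cnj (\<delta> t $ 1 $ 1))" for t
  have z: "\<exists>z\<in>Z4. \<delta> t = \<gamma> t ** z \<and> z = su (fst (p t)) (snd (p t))" if t: "t \<in> {a..b}" for t
  proof -
    have S: "\<gamma> t \<in> SU2" "\<delta> t \<in> SU2" using hor horizontalD t by blast+
    obtain z where z: "z \<in> Z4" "\<delta> t = \<gamma> t ** z" using cls_eqD[OF eq[OF t] S] .
    have "z = matrix_inv (\<gamma> t) ** \<delta> t" using z SU2_inv_mult_cancel[OF S(1)] by simp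
    also have "\<dots> = su (fst (p t)) (snd (p t))"
      using S by (elim SU2E) (simp add: p_def matrix_inv_su su_mult)
    finally show ?thesis using z by blast
  qed
  have pZ: "p t \<in> (\<lambda>z. (z $ 1 $ 1, z $ 1 $ 2)) ` Z4" if "t \<in> {a..b}" for t
    using z[OF that] by (force intro!: image_eqI[of _ _ "su (fst (p t)) (snd (p t))"])
  have const: "(\<lambda>t. f (p t)) constant_on {a..b}" if "continuous_on UNIV f" for f :: "complex \<times> complex \<Rightarrow> complex"
  proof (rule continuous_finite_range_constant)
    have "continuous_on {a..b} p"
      unfolding p_def by (intro continuous_intros c' hor)
    then show "continuous_on {a..b} (\<lambda>t. f (p t))"
      by (rule continuous_on_compose2[OF that]) simp
    have "(\<lambda>t. f (p t)) ` {a..b} \<subseteq> f ` (\<lambda>z. (z $ 1 $ 1, z $ 1 $ 2)) ` Z4" using pZ by blast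
    moreover have "finite Z4" by (simp add: Z4_def)
    ultimately show "finite ((\<lambda>t. f (p t)) ` {a..b})" by (meson finite_imageI finite_subset)
  qed simp
  obtain y1 y2 where "\<And>t. t \<in> {a..b} \<Longrightarrow> fst (p t) = y1" "\<And>t. t \<in> {a..b} \<Longrightarrow> snd (p t) = y2"
    using const[OF continuous_on_fst[OF continuous_on_id]] const[OF continuous_on_snd[OF continuous_on_id]]
    unfolding constant_on_def by metis
  then have y: "\<And>t. t \<in> {a..b} \<Longrightarrow> p t = (y1, y2)" by (metis prod.collapse)
  have "a \<in> {a..b}" using horizontalD[OF hor(1)] by simp
  then show ?thesis using that[of "su y1 y2"] z y by (metis fst_conv snd_conv)
qed

lemma hlength_cong:
  assumes hor: "horizontal \<gamma> a b" and eq: "\<And>t. t \<in> {a..b} \<Longrightarrow> \<gamma> t = \<delta> t"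
  shows "hlength \<gamma> a b = hlength \<delta> a b"
proof (cases "a < b")
  case True
  obtain N W K where N: "negligible N" and
      W: "\<And>t. t \<in> {a..b} - N \<Longrightarrow> (\<gamma> has_vector_derivative \<gamma> t ** su 0 (W t)) (at t within {a..b})" and
      "\<And>t. cmod (W t) \<le> K" "(\<lambda>t. 2 * cmod (W t)) integrable_on {a..b}" and
      len: "hlength \<gamma> a b = integral {a..b} (\<lambda>t. 2 * cmod (W t))"
    using hor True by (rule horizontal_velocity) (rule that)
  have "(\<delta> has_vector_derivative \<delta> t ** su 0 (W t)) (at t within {a..b})" if "t \<in> {a..b} - N" for t
  proof -
    have t: "t \<in> {a..b}" using that by blast
    show ?thesis
      by (rule has_vector_derivative_transform[OF t _ W[OF that, unfolded eq[OF t]]]) (simp add: eq)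
  qed
  from hlength_eq[OF _ _ N this] len show ?thesis
    using horizontalD[OF hor] eq by metis
next
  case False
  then have "a = b" using horizontalD(1)[OF hor] by simp
  then show ?thesis by (simp add: hlength_def)
qed

text \<open>Lifts differ by an element of \<open>Z4\<close>, acting as an isometry, so the lift
  chosen in \<open>hlength_L\<close> may be replaced by any other.\<close>

lemma hlength_L_eq:
  assumes hor: "horizontal \<gamma> a b" and G: "\<And>t. t \<in> {a..b} \<Longrightarrow> \<Gamma> t = cls (\<gamma> t)"
  shows "hlength_L \<Gamma> a b = hlength \<gamma> a b"
proof -
  define \<delta> where "\<delta> = (SOME \<gamma>. horizontal \<gamma> a b \<and> (\<forall>t\<in>{a..b}. \<Gamma> t = cls (\<gamma> t)))"
  have \<delta>: "horizontal \<delta> a b" "\<forall>t\<in>{a..b}. \<Gamma> t = cls (\<delta> t)"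
  proof -
    have "\<exists>\<gamma>. horizontal \<gamma> a b \<and> (\<forall>t\<in>{a..b}. \<Gamma> t = cls (\<gamma> t))" using hor G by blast
    from someI_ex[OF this] show "horizontal \<delta> a b" "\<forall>t\<in>{a..b}. \<Gamma> t = cls (\<delta> t)"
      unfolding \<delta>_def by blast+
  qed
  obtain z where z: "z \<in> Z4" "\<And>t. t \<in> {a..b} \<Longrightarrow> \<delta> t = \<gamma> t ** z"
    using cls_lift_unique[OF hor \<delta>(1)] G \<delta>(2) by metis
  note t = horizontal_translate[OF hor Id2_in_SU2 z(1)]
  have "hlength (\<lambda>t. Id2 ** \<gamma> t ** z) a b = hlength \<delta> a b"
    by (rule hlength_cong[OF t(1)]) (simp add: z Id2_def)
  then show ?thesis using t(2) by (simp add: hlength_L_def \<delta>_def)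
qed

lemma dist_L_le:
  assumes hor: "horizontal \<gamma> a b"
  shows "dist_L (cls (\<gamma> a)) (cls (\<gamma> b)) \<le> hlength \<gamma> a b"
  unfolding dist_L_def
proof (rule cInf_lower)
  have "hlength_L (\<lambda>t. cls (\<gamma> t)) a b = hlength \<gamma> a b" by (rule hlength_L_eq[OF hor]) simp
  moreover have "horizontal_L (\<lambda>t. cls (\<gamma> t)) a b" using hor unfolding horizontal_L_def by blast
  ultimately show "hlength \<gamma> a b \<in> {hlength_L \<Gamma> a' b' |\<Gamma> a' b'.
      horizontal_L \<Gamma> a' b' \<and> \<Gamma> a' = cls (\<gamma> a) \<and> \<Gamma> b' = cls (\<gamma> b)}"
    by (metis (mono_tags, lifting) mem_Collect_eq)
  show "bdd_below {hlength_L \<Gamma> a' b' |\<Gamma> a' b'.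
      horizontal_L \<Gamma> a' b' \<and> \<Gamma> a' = cls (\<gamma> a) \<and> \<Gamma> b' = cls (\<gamma> b)}"
  proof (rule bdd_belowI[of _ 0])
    fix x assume "x \<in> {hlength_L \<Gamma> a' b' |\<Gamma> a' b'.
      horizontal_L \<Gamma> a' b' \<and> \<Gamma> a' = cls (\<gamma> a) \<and> \<Gamma> b' = cls (\<gamma> b)}"
    then show "0 \<le> x" unfolding horizontal_L_def using hlength_L_eq hlength_nonneg by fastforce
  qed
qed

lemma dist_L_le_sr_dist:
  assumes S: "g \<in> SU2" "h \<in> SU2" and z: "z \<in> Z4"
  shows "dist_L (cls g) (cls h) \<le> sr_dist g (h ** z)"
proof -
  have hz: "h ** z \<in> SU2" using S z Z4_subset_SU2 SU2_mult by blast
  obtain \<gamma> where "horizontal \<gamma> 0 (sr_dist g (h ** z))" "\<gamma> 0 = g" "\<gamma> (sr_dist g (h ** z)) = h ** z"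
    "hlength \<gamma> 0 (sr_dist g (h ** z)) = sr_dist g (h ** z)"
    using S(1) hz by (rule sr_dist_attained) (rule that)
  then show ?thesis using dist_L_le[of \<gamma> 0 "sr_dist g (h ** z)"] cls_right_Z4[OF S(2) z] by simp
qed

text \<open>Together with the preceding lemma: the quotient distance is the least distance from
  \<open>g\<close> to the fibre of \<open>h\<close>. The lift of a competitor may start elsewhere in
  the fibre of \<open>g\<close>; a right translation by \<open>Z4\<close> brings it back.\<close>

lemma dist_L_ge:
  assumes S: "g \<in> SU2" "h \<in> SU2" and le: "\<And>z. z \<in> Z4 \<Longrightarrow> r \<le> sr_dist g (h ** z)"
  shows "r \<le> dist_L (cls g) (cls h)"
  unfolding dist_L_def
proof (rule cInf_greatest)
  obtain \<gamma> where \<gamma>: "horizontal \<gamma> 0 (sr_dist g h)" "\<gamma> 0 = g" "\<gamma> (sr_dist g h) = h"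
    using S by (rule sr_dist_attained) (rule that)
  then have "horizontal_L (\<lambda>t. cls (\<gamma> t)) 0 (sr_dist g h)" unfolding horizontal_L_def by blast
  then show "{hlength_L \<Gamma> a b |\<Gamma> a b. horizontal_L \<Gamma> a b \<and> \<Gamma> a = cls g \<and> \<Gamma> b = cls h} \<noteq> {}"
    using \<gamma> by fastforce
  fix x assume "x \<in> {hlength_L \<Gamma> a b |\<Gamma> a b. horizontal_L \<Gamma> a b \<and> \<Gamma> a = cls g \<and> \<Gamma> b = cls h}"
  then obtain \<Gamma> a b \<delta> where x: "x = hlength_L \<Gamma> a b" and e: "\<Gamma> a = cls g" "\<Gamma> b = cls h"
    and hor: "horizontal \<delta> a b" and \<delta>: "\<And>t. t \<in> {a..b} \<Longrightarrow> \<Gamma> t = cls (\<delta> t)"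
    unfolding horizontal_L_def by blast
  note d = horizontalD[OF hor]
  have \<delta>S: "\<delta> a \<in> SU2" "\<delta> b \<in> SU2" using d by auto
  have c: "cls (\<delta> a) = cls g" "cls h = cls (\<delta> b)" using \<delta>[of a] \<delta>[of b] e d by auto
  obtain y where y: "y \<in> Z4" "g = \<delta> a ** y" using cls_eqD[OF c(1) \<delta>S(1) S(1)] .
  obtain z where z: "z \<in> Z4" "\<delta> b = h ** z" using cls_eqD[OF c(2) S(2) \<delta>S(2)] .
  have "r \<le> sr_dist (\<delta> a ** y) (\<delta> b ** y)"
    using le[OF Z4_mult[OF z(1) y(1)]] y z by (simp add: matrix_mul_assoc)
  also have "\<dots> = sr_dist (\<delta> a) (\<delta> b)" by (rule sr_dist_right_Z4[OF \<delta>S y(1)])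
  also have "\<dots> \<le> x" using sr_dist_le_hlength[OF hor] hlength_L_eq[OF hor \<delta>] x by simp
  finally show "r \<le> x" .
qed

text \<open>Distinct points of a fibre are at distance at least \<open>pi\<close>; hence short geodesic arcs remain
  minimizing after projection.\<close>

lemma geo_fibre_dist:
  assumes u: "cmod u = 1" and st: "s \<le> t" "t - s \<le> pi / 2" "sqrt (1 + c\<^sup>2) * (t - s) \<le> 2 * pi" and z: "z \<in> Z4"
  shows "t - s \<le> sr_dist (geo c u s) (geo c u t ** z)"
proof (rule ccontr)
  assume "\<not> t - s \<le> sr_dist (geo c u s) (geo c u t ** z)"
  then have D: "sr_dist (geo c u s) (geo c u t ** z) < t - s" by simp
  have S: "geo c u s \<in> SU2" "geo c u t \<in> SU2" "geo c u t ** z \<in> SU2"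
    using geo_SU2(2)[OF u] z Z4_subset_SU2 SU2_mult by blast+
  have m: "matrix_inv (geo c u s) ** geo c u t \<in> SU2" by (intro SU2_mult matrix_inv_SU2 S)
  then obtain a b where ab: "matrix_inv (geo c u s) ** geo c u t = su a b" "(cmod a)\<^sup>2 + (cmod b)\<^sup>2 = 1" by (rule SU2E)
  have mz: "matrix_inv (geo c u s) ** (geo c u t ** z) = su a b ** z"
    unfolding matrix_mul_assoc ab(1) ..
  have "a = geoA c (t - s)" using geo_difference[OF u, of c s t] ab(1) by (simp add: geo_def)
  then have "sr_dist (geo c u s) (geo c u t) = t - s"
    using st ab by (intro sr_dist_geoA(1)[OF S(1,2)]) auto
  then have z1: "z \<noteq> su 1 0" using D by (auto simp: mat_1_eq_su[symmetric])
  define \<tau> where "\<tau> = (t - s) / 2"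
  have \<tau>: "0 \<le> \<tau>" "\<tau> \<le> pi / 4" using st by (simp_all add: \<tau>_def)
  \<comment> \<open>The untwisted bound, r = 0: the real part of the first entry is at least the
    cosine of half the length.\<close>
  have "arccos (Re (a * cis 0)) \<le> \<tau>"
    using horizontal_arccos_le[OF geo_horizontal(1)[OF u st(1)] geo_horizontal(2)[OF u st(1), symmetric], of c 0] ab
    by (simp add: \<tau>_def)
  then have "cos \<tau> \<le> Re (a * cis 0)"
    using SU2_entry_Re_cis_le[OF m, of 0] \<tau> ab by (intro cos_le_of_arccos_le) auto
  then have a: "cos \<tau> \<le> Re a" by simp
  have c4: "cos (pi / 4) \<le> cos \<tau>" using \<tau> by (intro cos_monotone_0_pi_le) auto
  have c4': "cos (pi / 4) > 0" "(cos (pi / 4))\<^sup>2 = 1 / 2"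
    by (simp_all add: cos_45 power_divide)
  define r where "r = sr_dist (geo c u s) (geo c u t ** z)"
  obtain \<gamma> where \<gamma>: "horizontal \<gamma> 0 r" "\<gamma> 0 = geo c u s" "\<gamma> r = geo c u t ** z" "hlength \<gamma> 0 r = r"
    using sr_dist_attained[OF S(1,3), folded r_def] by metis
  have r: "0 \<le> r" "r / 2 < pi / 4" using horizontalD(1)[OF \<gamma>(1)] D \<tau> by (simp_all add: r_def \<tau>_def)
  have "arccos (Re ((su a b ** z) $ 1 $ 1 * cis 0)) \<le> r / 2"
    using horizontal_arccos_le[OF \<gamma>(1) \<gamma>(4)[symmetric], of 0] \<gamma>(2,3) mz by simp
  then have "cos (r / 2) \<le> Re ((su a b ** z) $ 1 $ 1 * cis 0)"
    using SU2_entry_Re_cis_le[of "su a b ** z" 0] r SU2_mult m ab(1) z Z4_subset_SU2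
    by (intro cos_le_of_arccos_le) auto
  moreover have "cos (pi / 4) < cos (r / 2)" using r by (intro cos_monotone_0_pi) auto
  ultimately have az: "cos (pi / 4) < Re ((su a b ** z) $ 1 $ 1)" by simp
  \<comment> \<open>For the three nontrivial \<open>z\<close> the real part of the new first entry
    is - Re a, - Im b or Im b. Times up to pi/2 have halves up to pi/4, where the squared cosine is
    1/2: so Re a is at least cos (pi/4), which forces \<open>cmod b\<close> to be at most cos
    (pi/4), and none of the three values exceeds it.\<close>
  have "(cos (pi / 4))\<^sup>2 \<le> (Re a)\<^sup>2" using a c4 c4' by (intro power_mono) auto
  also have "\<dots> \<le> (cmod a)\<^sup>2" by (simp add: cmod_power2)
  finally have b: "(cmod b)\<^sup>2 \<le> (cos (pi / 4))\<^sup>2" using ab(2) c4'(2) by linarith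
  then have "cmod b \<le> cos (pi / 4)" by (rule power2_le_imp_le[OF _ less_imp_le[OF c4'(1)]])
  then have "\<bar>Im b\<bar> \<le> cos (pi / 4)" using abs_Im_le_cmod[of b] by simp
  then show False using z z1 az a c4 c4'(1) by (auto simp: Z4_def su_mult)
qed

lemma geo_geodesic_L:
  assumes u: "cmod u = 1" and T: "0 \<le> T" "sqrt (1 + c\<^sup>2) * T \<le> 2 * pi"
  shows "geodesic_L (\<lambda>t. cls (geo c u t)) T"
proof -
  have len: "hlength_L (\<lambda>t. cls (geo c u t)) a b = b - a" if "a \<le> b" for a b
    using hlength_L_eq[OF geo_horizontal(1)[OF u that], of "\<lambda>t. cls (geo c u t)" c] geo_horizontal(2)[OF u that] by simp
  have min: "minimizing_L (\<lambda>t. cls (geo c u t)) a b" if ab: "0 \<le> a" "a \<le> b" "b \<le> T" "b - a \<le> pi / 2" for a b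
    unfolding minimizing_L_def len[OF ab(2)]
  proof (rule antisym)
    have "sqrt (1 + c\<^sup>2) * (b - a) \<le> sqrt (1 + c\<^sup>2) * T" using ab by (intro mult_left_mono) auto
    then show "b - a \<le> dist_L (cls (geo c u a)) (cls (geo c u b))"
      using ab T by (intro dist_L_ge geo_SU2 u geo_fibre_dist) auto
    show "dist_L (cls (geo c u a)) (cls (geo c u b)) \<le> b - a"
      using dist_L_le[OF geo_horizontal(1)[OF u ab(2)]] geo_horizontal(2)[OF u ab(2)] by simp
  qed
  have near: "b - a \<le> pi / 2" if "\<bar>a - s\<bar> < pi / 4" "\<bar>b - s\<bar> < pi / 4" for a b s :: real
    using that by linarith
  show ?thesis unfolding geodesic_L_def
  proof (intro conjI ballI)
    show "horizontal_L (\<lambda>t. cls (geo c u t)) 0 T"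
      unfolding horizontal_L_def using geo_horizontal(1)[OF u T(1)] by blast
    show "arclength_L (\<lambda>t. cls (geo c u t)) T" unfolding arclength_L_def using len by simp
    show "\<exists>\<epsilon>>0. \<forall>a b. a \<in> {0..T} \<and> b \<in> {0..T} \<and> a \<le> b \<and> \<bar>a - s\<bar> < \<epsilon> \<and> \<bar>b - s\<bar> < \<epsilon> \<longrightarrow>
        minimizing_L (\<lambda>t. cls (geo c u t)) a b" for s
      by (intro exI[of _ "pi / 4"] conjI allI impI min) (use near in auto)
  qed
qed

section \<open>Criteria for points of the cut locus\<close>

lemma geo_minimizing_L:
  assumes u: "cmod u = 1" and T: "0 \<le> T"
    and le: "\<And>z. z \<in> Z4 \<Longrightarrow> T \<le> sr_dist Id2 (geo c u T ** z)"
  shows "minimizing_L (\<lambda>t. cls (geo c u t)) 0 T"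
  unfolding minimizing_L_def
proof -
  have "hlength_L (\<lambda>t. cls (geo c u t)) 0 T = T"
    using hlength_L_eq[OF geo_horizontal(1)[OF u T], of "\<lambda>t. cls (geo c u t)" c] geo_horizontal(2)[OF u T] by simp
  moreover have "T \<le> dist_L (cls (geo c u 0)) (cls (geo c u T))"
    unfolding geo_0 by (intro dist_L_ge Id2_in_SU2 geo_SU2 u le)
  moreover have "dist_L (cls (geo c u 0)) (cls (geo c u T)) \<le> T"
    using dist_L_le[OF geo_horizontal(1)[OF u T]] geo_horizontal(2)[OF u T] by simp
  ultimately show "hlength_L (\<lambda>t. cls (geo c u t)) 0 T = dist_L (cls (geo c u 0)) (cls (geo c u T))" by simp
qed

text \<open>Distinctness can be checked on the group because both arcs start at \<open>Id2\<close>: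
  if the projections agreed, the arcs would differ by a constant element of \<open>Z4\<close>, which
  time 0 shows to be 1.\<close>

lemma cut_locus_LI:
  assumes u: "cmod u = 1" "cmod v = 1" and T: "0 < T" "sqrt (1 + c\<^sup>2) * T \<le> 2 * pi" "sqrt (1 + d\<^sup>2) * T \<le> 2 * pi"
    and q: "cls (geo c u T) = q" "cls (geo d v T) = q"
    and le: "\<And>z. z \<in> Z4 \<Longrightarrow> T \<le> sr_dist Id2 (geo c u T ** z)"
    and ne: "s \<in> {0..T}" "geo c u s \<noteq> geo d v s"
  shows "q \<in> cut_locus_L"
proof -
  have T0: "0 \<le> T" using T by simp
  have S: "geo c u T \<in> SU2" "geo d v T \<in> SU2" using geo_SU2 u by auto
  obtain y where y: "y \<in> Z4" "geo d v T = geo c u T ** y" using cls_eqD[OF _ S] q by auto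
  have le': "T \<le> sr_dist Id2 (geo d v T ** z)" if "z \<in> Z4" for z
    using le[OF Z4_mult[OF y(1) that]] y(2) by (simp add: matrix_mul_assoc)
  have "\<exists>s\<in>{0..T}. cls (geo c u s) \<noteq> cls (geo d v s)"
  proof (rule ccontr)
    assume "\<not> ?thesis"
    then obtain z where z: "\<And>t. t \<in> {0..T} \<Longrightarrow> geo d v t = geo c u t ** z"
      using cls_lift_unique[OF geo_horizontal(1)[OF u(1) T0] geo_horizontal(1)[OF u(2) T0]] by metis
    have "Id2 = Id2 ** z" using z[of 0] T0 by (simp add: geo_0)
    then have "z = mat 1" by (simp add: Id2_def)
    then show False using z ne by simp
  qed
  moreover have "q \<in> L41" using q S by (auto simp: L41_def)
  ultimately show ?thesis
    unfolding cut_locus_L_def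
    using T q geo_geodesic_L[OF u(1) T0 T(2)] geo_geodesic_L[OF u(2) T0 T(3)]
      geo_minimizing_L[OF u(1) T0 le] geo_minimizing_L[OF u(2) T0 le'] geo_0
    by (intro CollectI conjI exI[of _ T] exI[of _ "\<lambda>t. cls (geo c u t)"] exI[of _ "\<lambda>t. cls (geo d v t)"]) auto
qed

lemma geo_reaching:
  assumes g: "g \<in> SU2" "g \<noteq> Id2"
  obtains c u where "0 < sr_dist Id2 g" "cmod u = 1" "sqrt (1 + c\<^sup>2) * sr_dist Id2 g \<le> 2 * pi" "geo c u (sr_dist Id2 g) = g"
proof -
  have I: "matrix_inv Id2 ** g = g" by (simp add: Id2_eq_su matrix_inv_su) (simp add: mat_1_eq_su[symmetric])
  obtain c where c: "0 \<le> sr_dist Id2 g" "sqrt (1 + c\<^sup>2) * sr_dist Id2 g \<le> 2 * pi"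
    "(matrix_inv Id2 ** g) $ 1 $ 1 = geoA c (sr_dist Id2 g)" "sr_dist Id2 g = 0 \<longleftrightarrow> Id2 = g"
    using Id2_in_SU2 g(1) by (rule sr_dist_parameters)
  obtain u where "cmod u = 1" "geo c u (sr_dist Id2 g) = g"
    using geo_with_first_entry[OF g(1)] c(3) I by metis
  then show ?thesis using that c g by force
qed

text \<open>Arcs of equal length to two nearest points of one fibre end at different points of the
  group, which makes their projections distinct although these meet at time T.\<close>

lemma two_minimizing_lifts_in_cut_locus:
  assumes g: "g \<in> SU2" and z: "z \<in> Z4" "z \<noteq> Id2" "sr_dist Id2 (g ** z) = sr_dist Id2 g"
    and le: "\<And>z. z \<in> Z4 \<Longrightarrow> sr_dist Id2 g \<le> sr_dist Id2 (g ** z)"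
  shows "cls g \<in> cut_locus_L"
proof -
  have gz: "g ** z \<in> SU2" using g z Z4_subset_SU2 SU2_mult by blast
  have ne: "g \<noteq> g ** z"
  proof
    assume "g = g ** z"
    then have "matrix_inv g ** g = matrix_inv g ** (g ** z)" by simp
    then show False using z(2) g by (simp add: SU2_inv_mult_cancel matrix_inv_SU2 Id2_def)
  qed
  then have nI: "g \<noteq> Id2" "g ** z \<noteq> Id2"
    using sr_dist_eq_0_iff[OF Id2_in_SU2 g] sr_dist_eq_0_iff[OF Id2_in_SU2 gz] z(3) by metis+
  define T where "T = sr_dist Id2 g"
  obtain c u where 1: "0 < T" "cmod u = 1" "sqrt (1 + c\<^sup>2) * T \<le> 2 * pi" "geo c u T = g"
    using geo_reaching[OF g nI(1), folded T_def] by metis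
  obtain d v where 2: "cmod v = 1" "sqrt (1 + d\<^sup>2) * T \<le> 2 * pi" "geo d v T = g ** z"
    using geo_reaching[OF gz nI(2), unfolded z(3), folded T_def] by metis
  show ?thesis
  proof (rule cut_locus_LI[OF 1(2) 2(1) 1(1,3) 2(2)])
    show "cls (geo c u T) = cls g" "cls (geo d v T) = cls g" using 1 2 cls_right_Z4[OF g z(1)] by simp_all
    show "T \<le> sr_dist Id2 (geo c u T ** z)" if "z \<in> Z4" for z using le[OF that] 1 by (simp add: T_def)
    show "T \<in> {0..T}" "geo c u T \<noteq> geo d v T" using 1 2 ne by auto
  qed
qed

section \<open>Both sets lie in the cut locus\<close>

lemma K_sym_subset: "K_sym \<subseteq> cut_locus_L"
proof
  fix P assume "P \<in> K_sym"
  then obtain g x y where P: "P \<in> L41" and g: "g \<in> P" and xy: "x \<in> Z4" "y \<in> Z4" "x \<noteq> y"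
    and min: "\<And>z. z \<in> Z4 \<Longrightarrow> sr_dist g x = sr_dist g y \<and> sr_dist g y \<le> sr_dist g z"
    unfolding K_sym_def cls_Id2 by blast
  obtain h where h: "h \<in> SU2" "P = cls h" using P unfolding L41_def by blast
  then obtain w where w: "w \<in> Z4" "g = h ** w" using g by (auto simp: cls_eq)
  have gS: "g \<in> SU2" using w h Z4_subset_SU2 SU2_mult by blast
  have gP: "cls g = P" using cls_right_Z4 w h by simp
  have S: "x \<in> SU2" "y \<in> SU2" using xy Z4_subset_SU2 by auto
  \<comment> \<open>The nearest points x and y to g correspond to the points
    \<open>g ** matrix_inv x\<close> and \<open>g ** matrix_inv y\<close> of the fibre, both nearest
    to the identity; this is the element of \<open>Z4\<close> carrying one to the other.\<close>
  have yx: "g ** matrix_inv x ** (x ** matrix_inv y) = g ** matrix_inv y"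
    by (simp add: matrix_mul_assoc SU2_inv_mult_cancel S)
  have "cls (g ** matrix_inv x) \<in> cut_locus_L"
  proof (rule two_minimizing_lifts_in_cut_locus)
    show "g ** matrix_inv x \<in> SU2" by (intro SU2_mult matrix_inv_SU2 gS S)
    show "x ** matrix_inv y \<in> Z4" by (intro Z4_mult Z4_inv xy)
    show "x ** matrix_inv y \<noteq> Id2"
    proof
      assume "x ** matrix_inv y = Id2"
      then have "x ** matrix_inv y ** y = Id2 ** y" by simp
      then show False using xy S by (simp add: SU2_inv_mult_cancel Id2_def)
    qed
    show "sr_dist Id2 (g ** matrix_inv x ** (x ** matrix_inv y)) = sr_dist Id2 (g ** matrix_inv x)"
      unfolding yx using sr_dist_right_Z4_inv[OF gS] xy min[OF xy(1)] by simp
    fix z assume z: "z \<in> Z4"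
    then have zx: "matrix_inv z ** x \<in> Z4" by (intro Z4_mult Z4_inv xy)
    \<comment> \<open>An arbitrary competitor \<open>g ** matrix_inv x ** z\<close> in the fibre
      thus corresponds to the point \<open>matrix_inv z ** x\<close> of \<open>Z4\<close>.\<close>
    have "matrix_inv (matrix_inv z ** x) = matrix_inv x ** z"
    proof (rule matrix_inv_eqI)
      have zS: "z \<in> SU2" using z Z4_subset_SU2 by blast
      show "(matrix_inv z ** x) ** (matrix_inv x ** z) = mat 1"
        "(matrix_inv x ** z) ** (matrix_inv z ** x) = mat 1"
        by (simp_all add: matrix_mul_assoc SU2_inv_mult_cancel matrix_inv_SU2 S zS)
    qed
    then have "sr_dist g (matrix_inv z ** x) = sr_dist Id2 (g ** matrix_inv x ** z)"
      using sr_dist_right_Z4_inv[OF gS zx] by (simp add: matrix_mul_assoc)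
    then show "sr_dist Id2 (g ** matrix_inv x) \<le> sr_dist Id2 (g ** matrix_inv x ** z)"
      using min[OF zx] sr_dist_right_Z4_inv[OF gS xy(1)] by simp
  qed
  then show "P \<in> cut_locus_L" using cls_right_Z4[OF gS Z4_inv[OF xy(1)]] gP by simp
qed

text \<open>Replacing u by - u changes the sign of the second entry, which is invisible at a
  diagonal end point. At half the time the angle is at most pi/2 and positive, so there the second
  entry does not vanish.\<close>

lemma geo_diagonal_two:
  assumes u: "cmod u = 1" and T: "0 < T" "sqrt (1 + c\<^sup>2) * T \<le> 2 * pi" and e: "geo c u T = su a 0"
  shows "geo c (- u) T = su a 0" "geo c u (T / 2) \<noteq> geo c (- u) (T / 2)"
proof -
  have m: "geoB c (- u) t = - geoB c u t" for t by (simp add: geoB_def)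
  show "geo c (- u) T = su a 0" using e by (simp add: geo_def m)
  define x where "x = sqrt (1 + c\<^sup>2) * (T / 2) / 2"
  have "0 < x" using T sqrt_1_plus_square_pos[of c] by (simp add: x_def)
  moreover have "x < pi" using T(2) pi_gt_zero unfolding x_def by linarith
  ultimately have "sin x \<noteq> 0" using sin_gt_zero by force
  then have "geoB c u (T / 2) \<noteq> 0"
    using geoB_norm[OF u, of c "T/2"] sqrt_1_plus_square_pos[of c] by (auto simp: x_def)
  then show "geo c u (T / 2) \<noteq> geo c (- u) (T / 2)" by (simp add: geo_def m)
qed

lemma K_loc_subset: "K_loc \<subseteq> cut_locus_L"
proof
  fix q assume "q \<in> K_loc"
  then obtain t where q: "q = cls (su (cis t) 0)" "q \<noteq> cls Id2"
    unfolding K_loc_def by (auto simp: mexp_kk)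
  define k where "k = su (cis t) 0"
  have k: "k \<in> SU2" by (simp add: k_def su_in_SU2_iff)
  have "finite Z4" "Z4 \<noteq> {}" by (simp_all add: Z4_def)
  then obtain y where y: "y \<in> Z4" and ymin: "\<And>z. z \<in> Z4 \<Longrightarrow> sr_dist Id2 (k ** y) \<le> sr_dist Id2 (k ** z)"
    using ex_min_if_finite[of "(\<lambda>z. sr_dist Id2 (k ** z)) ` Z4"] by (auto simp: not_less)
  define g where "g = k ** y"
  have g: "g \<in> SU2" unfolding g_def using k y Z4_subset_SU2 SU2_mult by blast
  have cg: "cls g = q" unfolding g_def using cls_right_Z4[OF k y] q k_def by simp
  have gmin: "sr_dist Id2 g \<le> sr_dist Id2 (g ** z)" if "z \<in> Z4" for z
    using ymin[OF Z4_mult[OF y that]] by (simp add: g_def matrix_mul_assoc)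
  have gI: "g \<noteq> Id2" using cg q by auto
  have "(\<exists>a. g = su a 0) \<or> (\<exists>b. g = su 0 b)"
    using y unfolding g_def k_def by (auto simp: Z4_def su_mult)
  then show "q \<in> cut_locus_L"
  proof
    assume "\<exists>a. g = su a 0"
    then obtain a where a: "g = su a 0" by blast
    define T where "T = sr_dist Id2 g"
    obtain c u where 1: "0 < T" "cmod u = 1" "sqrt (1 + c\<^sup>2) * T \<le> 2 * pi" "geo c u T = g"
      using geo_reaching[OF g gI, folded T_def] by metis
    note d = geo_diagonal_two[OF 1(2,1,3) 1(4)[unfolded a]]
    show ?thesis
    proof (rule cut_locus_LI[OF 1(2) _ 1(1,3,3)])
      show "cmod (- u) = 1" using 1 by simp
      show "cls (geo c u T) = q" "cls (geo c (- u) T) = q" using 1 d cg a by simp_all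
      show "T \<le> sr_dist Id2 (geo c u T ** z)" if "z \<in> Z4" for z using gmin[OF that] 1 by (simp add: T_def)
      show "T / 2 \<in> {0..T}" using 1 by simp
      show "geo c u (T / 2) \<noteq> geo c (- u) (T / 2)" by (rule d)
    qed
  next
    assume "\<exists>b. g = su 0 b"
    then obtain b where b: "g = su 0 b" by blast
    have m: "su (-1) 0 \<in> Z4" "su (-1) 0 \<noteq> Id2" by (simp_all add: Z4_def Id2_eq_su)
    \<comment> \<open>Both first entries vanish, and the distance from \<open>Id2\<close> depends on
      nothing else.\<close>
    have "sr_dist Id2 (g ** su (-1) 0) = sr_dist Id2 g"
    proof (rule sr_dist_cong_first_entry[OF Id2_in_SU2 g Id2_in_SU2])
      show "g ** su (-1) 0 \<in> SU2" using g m Z4_subset_SU2 SU2_mult by blast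
    qed (simp add: b su_mult Id2_eq_su matrix_inv_su)
    then show ?thesis using two_minimizing_lifts_in_cut_locus[OF g m _ gmin] cg by simp
  qed
qed

section \<open>Lifting minimizers; the reverse inclusion\<close>

lemma minimizing_geodesic_L_lift:
  assumes geod: "geodesic_L \<Gamma> T" and start: "\<Gamma> 0 = cls Id2" and min: "minimizing_L \<Gamma> 0 T" and T: "0 < T"
  obtains \<gamma> where "horizontal \<gamma> 0 T" "\<gamma> 0 = Id2" "\<And>t. t \<in> {0..T} \<Longrightarrow> \<Gamma> t = cls (\<gamma> t)"
    "\<And>s t. 0 \<le> s \<Longrightarrow> s \<le> t \<Longrightarrow> t \<le> T \<Longrightarrow> hlength \<gamma> s t = t - s"
    "\<And>z. z \<in> Z4 \<Longrightarrow> T \<le> sr_dist Id2 (\<gamma> T ** z)" "sr_dist Id2 (\<gamma> T) = T"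
proof -
  obtain \<delta> where \<delta>: "horizontal \<delta> 0 T" "\<And>t. t \<in> {0..T} \<Longrightarrow> \<Gamma> t = cls (\<delta> t)"
    using geod unfolding geodesic_L_def horizontal_L_def by blast
  have \<delta>S: "\<delta> t \<in> SU2" if "t \<in> {0..T}" for t using horizontalD[OF \<delta>(1)] that by blast
  have "cls (\<delta> 0) = cls Id2" using \<delta>(2)[of 0] start T by simp
  then obtain z where z: "z \<in> Z4" "Id2 = \<delta> 0 ** z" using cls_eqD[of "\<delta> 0" Id2] \<delta>S[of 0] T Id2_in_SU2 by force
  \<comment> \<open>The given lift may start anywhere in the fibre of the identity; right
    translation by \<open>z\<close> makes it start at \<open>Id2\<close> without changing its
    projection.\<close>
  define \<gamma> where "\<gamma> = (\<lambda>t. Id2 ** \<delta> t ** z)"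
  have \<gamma>: "\<gamma> t = \<delta> t ** z" for t by (simp add: \<gamma>_def Id2_def)
  have hor: "horizontal \<gamma> 0 T" unfolding \<gamma>_def by (rule horizontal_translate[OF \<delta>(1) Id2_in_SU2 z(1)])
  have G: "\<Gamma> t = cls (\<gamma> t)" if "t \<in> {0..T}" for t
    using \<delta>(2)[OF that] cls_right_Z4[OF \<delta>S[OF that] z(1)] by (simp add: \<gamma>)
  have len: "hlength \<gamma> s t = t - s" if st: "0 \<le> s" "s \<le> t" "t \<le> T" for s t
  proof -
    have "hlength_L \<Gamma> s t = hlength \<gamma> s t"
      by (rule hlength_L_eq[OF horizontal_restrict[OF hor st]]) (use G st in auto)
    then show ?thesis using geod st unfolding geodesic_L_def arclength_L_def by auto
  qed
  have g0: "\<gamma> 0 = Id2" using z by (simp add: \<gamma>)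
  have gT: "\<gamma> T \<in> SU2" using horizontalD[OF hor] by auto
  have "hlength_L \<Gamma> 0 T = T" using hlength_L_eq[OF hor G] len[of 0 T] T by simp
  then have "dist_L (cls Id2) (cls (\<gamma> T)) = T"
    using min G[of T] start T unfolding minimizing_L_def by simp
  then have le: "T \<le> sr_dist Id2 (\<gamma> T ** z)" if "z \<in> Z4" for z
    using dist_L_le_sr_dist[OF Id2_in_SU2 gT that] by simp
  have "sr_dist Id2 (\<gamma> T) \<le> T" using sr_dist_le_hlength[OF hor] g0 len[of 0 T] T by simp
  moreover have "T \<le> sr_dist Id2 (\<gamma> T)" using le[OF Id2_in_Z4] by (simp add: Id2_def)
  ultimately show ?thesis using that[of \<gamma>] hor g0 G len le by simp
qed

lemma cut_locus_subset: "cut_locus_L \<subseteq> K_loc \<union> K_sym"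
proof
  fix q assume "q \<in> cut_locus_L"
  then obtain T G1 G2 where q: "q \<in> L41" and T: "0 < T" and g1: "geodesic_L G1 T" "G1 0 = cls Id2" "minimizing_L G1 0 T"
    and g2: "geodesic_L G2 T" "G2 0 = cls Id2" "minimizing_L G2 0 T" and e: "G1 T = q" "G2 T = q"
    and ne: "\<exists>s\<in>{0..T}. G1 s \<noteq> G2 s"
    unfolding cut_locus_L_def by blast
  obtain \<gamma> where \<gamma>: "horizontal \<gamma> 0 T" "\<gamma> 0 = Id2" "\<And>t. t \<in> {0..T} \<Longrightarrow> G1 t = cls (\<gamma> t)"
    "\<And>s t. 0 \<le> s \<Longrightarrow> s \<le> t \<Longrightarrow> t \<le> T \<Longrightarrow> hlength \<gamma> s t = t - s"
    and \<gamma>min: "\<And>z. z \<in> Z4 \<Longrightarrow> T \<le> sr_dist Id2 (\<gamma> T ** z)" and \<gamma>T: "sr_dist Id2 (\<gamma> T) = T"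
    using g1 T by (rule minimizing_geodesic_L_lift) (rule that)
  obtain \<delta> where \<delta>: "horizontal \<delta> 0 T" "\<delta> 0 = Id2" "\<And>t. t \<in> {0..T} \<Longrightarrow> G2 t = cls (\<delta> t)"
    "\<And>s t. 0 \<le> s \<Longrightarrow> s \<le> t \<Longrightarrow> t \<le> T \<Longrightarrow> hlength \<delta> s t = t - s"
    and "\<And>z. z \<in> Z4 \<Longrightarrow> T \<le> sr_dist Id2 (\<delta> T ** z)" and \<delta>T: "sr_dist Id2 (\<delta> T) = T"
    using g2 T by (rule minimizing_geodesic_L_lift) (rule that)
  have S: "\<gamma> T \<in> SU2" "\<delta> T \<in> SU2" using horizontalD[OF \<gamma>(1)] horizontalD[OF \<delta>(1)] by auto
  have qc: "q = cls (\<gamma> T)" "q = cls (\<delta> T)" using \<gamma>(3)[of T] \<delta>(3)[of T] e T by auto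
  obtain z where z: "z \<in> Z4" "\<delta> T = \<gamma> T ** z" using cls_eqD[OF _ S] qc by auto
  have dist_g: "sr_dist (\<gamma> T) x = sr_dist Id2 (\<gamma> T ** matrix_inv x)" if "x \<in> Z4" for x
    using sr_dist_right_Z4_inv[OF S(1) that] .
  show "q \<in> K_loc \<union> K_sym"
  proof (cases "\<gamma> T = \<delta> T")
    case False
    have zS: "z \<in> SU2" using z Z4_subset_SU2 by blast
    have zz: "matrix_inv (matrix_inv z) = z"
      using zS by (intro matrix_inv_eqI) (simp_all add: matrix_inv_SU2)
    have II: "matrix_inv Id2 = Id2" by (simp add: Id2_eq_su matrix_inv_su)
    have 1: "sr_dist (\<gamma> T) Id2 = T" using dist_g[OF Id2_in_Z4] \<gamma>T by (simp add: II) (simp add: Id2_def)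
    \<comment> \<open>The second nearest point is \<open>matrix_inv z\<close>: multiplying
      \<open>\<gamma> T\<close> by its inverse gives \<open>\<delta> T\<close>, the other end
      point.\<close>
    have 2: "sr_dist (\<gamma> T) (matrix_inv z) = T" using dist_g[OF Z4_inv[OF z(1)]] \<delta>T z by (simp add: zz)
    have "matrix_inv z \<noteq> Id2" using False z zz II by (metis Id2_def matrix_mul_rid)
    moreover have "sr_dist (\<gamma> T) (matrix_inv z) \<le> sr_dist (\<gamma> T) x" if "x \<in> Z4" for x
      using \<gamma>min[OF Z4_inv[OF that]] dist_g[OF that] 2 by simp
    ultimately have "q \<in> K_sym"
      unfolding K_sym_def cls_Id2
      using q qc(1) cls_self[OF S(1)] Id2_in_Z4 Z4_inv[OF z(1)] 1 2
      by (intro CollectI conjI bexI[of _ "\<gamma> T"] bexI[of _ Id2] bexI[of _ "matrix_inv z"]) auto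
    then show ?thesis ..
  next
    case True
    obtain a b where ab: "\<gamma> T = su a b" "(cmod a)\<^sup>2 + (cmod b)\<^sup>2 = 1" using S(1) by (rule SU2E)
    have nI: "\<gamma> T \<noteq> Id2" using \<gamma>T T sr_dist_eq_0_iff[OF Id2_in_SU2 S(1)] by auto
    obtain c u where c: "cmod u = 1" "sqrt (1 + c\<^sup>2) * T \<le> 2 * pi" "geo c u T = \<gamma> T"
      using geo_reaching[OF S(1) nI] \<gamma>T by metis
    \<comment> \<open>A nonzero second entry puts the end point strictly before the antipode, where
      the minimizer is unique; then both lifts, and with them G1 and G2, would coincide.\<close>
    have "b = 0"
    proof (rule ccontr)
      assume "b \<noteq> 0"
      have "sqrt (1 + c\<^sup>2) * T \<noteq> 2 * pi"
      proof
        assume "sqrt (1 + c\<^sup>2) * T = 2 * pi"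
        then have "sin (sqrt (1 + c\<^sup>2) * T / 2) = 0" by simp
        then have "geoB c u T = 0" using geoB_norm[OF c(1), of c T] by simp
        then show False using c(3) ab(1) \<open>b \<noteq> 0\<close> by (simp add: geo_def)
      qed
      then have w: "sqrt (1 + c\<^sup>2) * T < 2 * pi" using c(2) by simp
      have "\<gamma> T $ 1 $ 1 = geoA c T" unfolding c(3)[symmetric] by (simp add: geo_def)
      then have "\<gamma> t = \<delta> t" if "t \<in> {0..T}" for t
        using minimizer_unique[OF \<gamma>(1) \<delta>(1) \<gamma>(2) \<delta>(2) \<gamma>(4) \<delta>(4) _ True[symmetric] T w that] by blast
      then show False using ne \<gamma>(3) \<delta>(3) by force
    qed
    then have "cmod a = 1" using ab by (simp add: power2_eq_1_iff) (metis norm_ge_zero not_one_le_zero neg_0_le_iff_le)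
    then have "cis (Arg a) = a" using rcis_cmod_Arg[of a] by (simp add: rcis_def)
    then have "\<gamma> T = mexp ((2 * Arg a) *\<^sub>R kk)" using ab(1) \<open>b = 0\<close> by (simp add: mexp_kk del: scaleR_left_distrib)
    \<comment> \<open>Otherwise \<open>Id2\<close> itself is a point of the fibre over q, all of
      whose points have distance at least T > 0 from \<open>Id2\<close>.\<close>
    moreover have "q \<noteq> cls Id2"
    proof
      assume "q = cls Id2"
      then obtain y where y: "y \<in> Z4" "Id2 = \<gamma> T ** y" using cls_eqD[OF _ S(1) Id2_in_SU2] qc by auto
      then have "T \<le> 0" using \<gamma>min[OF y(1)] sr_dist_eq_0_iff[OF Id2_in_SU2 Id2_in_SU2] by simp
      then show False using T by simp
    qed
    ultimately have "q \<in> K_loc" unfolding K_loc_def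
      using qc(1) by (intro DiffI CollectI exI[of _ "2 * Arg a"] conjI TrueI) (simp_all only: singleton_iff not_False_eq_True)
    then show ?thesis ..
  qed
qed

theorem theorem4:
  shows "cut_locus_L = K_loc \<union> K_sym"
  using cut_locus_subset K_loc_subset K_sym_subset by blast

end
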